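(* There is an algorithm that, given a polyomino graph $G$ with a perfect matching, computes its maximum forcing number $F(G)$ in time polynomial in the size of $G$.
   Context: A polyomino graph is a connected finite subgraph of the infinite plane square grid such that each interior (finite) face is bounded by a unit square and each edge belongs to at least one such square. A forcing set of a perfect matching $M$ of $G$ is a subset $S\subseteq M$ contained in no other perfect matching of $G$; the forcing number $f(G,M)$ is the minimum size of a forcing set of $M$, and the maximum forcing number $F(G)$ is the maximum of $f(G,M)$ over all perfect matchings $M$ of $G$. *)

theory Defs
  imports "HOL-Analysis.Analysis" "HOL-Computational_Algebra.Polynomial"
begin

section \<open>Perfect matchings and forcing numbers\<close>

record 'a sgraph =
  verts :: "'a set"
  edges :: "'a set set"

definition perfect_matching :: "'a sgraph \<Rightarrow> 'a set set \<Rightarrow> bool" where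
  "perfect_matching G M \<longleftrightarrow> M \<subseteq> edges G \<and> (\<forall>v\<in>verts G. \<exists>!e. e \<in> M \<and> v \<in> e)"

definition forcing_set :: "'a sgraph \<Rightarrow> 'a set set \<Rightarrow> 'a set set \<Rightarrow> bool" where
  "forcing_set G M S \<longleftrightarrow>
     S \<subseteq> M \<and> (\<forall>M'. perfect_matching G M' \<and> S \<subseteq> M' \<longrightarrow> M' = M)"

definition forcing_number :: "'a sgraph \<Rightarrow> 'a set set \<Rightarrow> nat" where
  "forcing_number G M = Min (card ` {S. forcing_set G M S})"

definition max_forcing_number :: "'a sgraph \<Rightarrow> nat" where
  "max_forcing_number G = Max (forcing_number G ` {M. perfect_matching G M})"


section \<open>Polyomino graphs\<close>

type_synonym grid_graph = "(int \<times> int) sgraph"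

definition grid_adjacent :: "int \<times> int \<Rightarrow> int \<times> int \<Rightarrow> bool" where
  "grid_adjacent u v \<longleftrightarrow> \<bar>fst u - fst v\<bar> + \<bar>snd u - snd v\<bar> = 1"

definition grid_subgraph :: "grid_graph \<Rightarrow> bool" where
  "grid_subgraph G \<longleftrightarrow>
     edges G \<subseteq> {{u, v} | u v. u \<in> verts G \<and> v \<in> verts G \<and> grid_adjacent u v}"

definition connected_graph :: "'a sgraph \<Rightarrow> bool" where
  "connected_graph G \<longleftrightarrow>
     verts G \<noteq> {} \<and>
     (\<forall>u\<in>verts G. \<forall>v\<in>verts G. (\<lambda>x y. {x, y} \<in> edges G)\<^sup>*\<^sup>* u v)"

definition grid_point :: "int \<times> int \<Rightarrow> real \<times> real" where
  "grid_point v = (real_of_int (fst v), real_of_int (snd v))"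

text \<open>The convex hull of the two end points of an edge is the line segment drawn for it.\<close>

definition drawn_edges :: "(int \<times> int) set set \<Rightarrow> (real \<times> real) set" where
  "drawn_edges E = (\<Union>e\<in>E. convex hull (grid_point ` e))"

definition interior_faces :: "grid_graph \<Rightarrow> (real \<times> real) set set" where
  "interior_faces G =
     {f \<in> components (- (grid_point ` verts G \<union> drawn_edges (edges G))). bounded f}"

text \<open>The sides of the unit square whose lower left corner is the given grid point.\<close>

fun square_edges :: "int \<times> int \<Rightarrow> (int \<times> int) set set" where
  "square_edges (x, y) =
     {{(x, y), (x + 1, y)}, {(x + 1, y), (x + 1, y + 1)},
      {(x + 1, y + 1), (x, y + 1)}, {(x, y + 1), (x, y)}}"

definition bounded_by_square :: "(real \<times> real) set \<Rightarrow> int \<times> int \<Rightarrow> bool" where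
  "bounded_by_square f q \<longleftrightarrow> frontier f = drawn_edges (square_edges q)"

definition polyomino_graph :: "grid_graph \<Rightarrow> bool" where
  "polyomino_graph G \<longleftrightarrow>
     finite (verts G) \<and> grid_subgraph G \<and> connected_graph G \<and>
     (\<forall>f\<in>interior_faces G. \<exists>q. bounded_by_square f q) \<and>
     (\<forall>e\<in>edges G. \<exists>q. e \<in> square_edges q \<and> (\<exists>f\<in>interior_faces G. bounded_by_square f q))"


section \<open>Random access machines\<close>

text \<open>
  Programs of a random access machine in structured form. The memory consists of arrays of
  natural numbers of unbounded length; a program names finitely many of them, so they could be
  interleaved in one address space. The arithmetic operations are addition and truncated
  subtraction only. Without multiplication a computation of \<open>t\<close> steps lengthens
  the binary representations of the stored numbers by at most \<open>O(t)\<close> bits, so that unit cost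
  is polynomially equivalent to time on a Turing machine.
\<close>

type_synonym memory = "nat \<Rightarrow> nat \<Rightarrow> nat"

datatype exp =
    Num nat
  | Cell nat exp
  | Add exp exp
  | Sub exp exp

datatype com =
    Skip
  | Store nat exp exp
  | Seq com com
  | If exp com com
  | While exp com

primrec val :: "exp \<Rightarrow> memory \<Rightarrow> nat" where
  "val (Num n) s = n"
| "val (Cell a e) s = s a (val e s)"
| "val (Add e e') s = val e s + val e' s"
| "val (Sub e e') s = val e s - val e' s"

primrec cost :: "exp \<Rightarrow> nat" where
  "cost (Num n) = 1"
| "cost (Cell a e) = 1 + cost e"
| "cost (Add e e') = 1 + cost e + cost e'"
| "cost (Sub e e') = 1 + cost e + cost e'"

text \<open>
  \<open>exec c s t s'\<close>: started in memory \<open>s\<close>, the program \<open>c\<close> halts after \<open>t\<close> elementary steps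
  with memory \<open>s'\<close>. Conditions are true iff their value is nonzero.
\<close>

inductive exec :: "com \<Rightarrow> memory \<Rightarrow> nat \<Rightarrow> memory \<Rightarrow> bool" where
  Skip: "exec Skip s 1 s"
| Store: "exec (Store a i e) s (1 + cost i + cost e) (s(a := (s a)(val i s := val e s)))"
| Seq: "exec c s t s' \<Longrightarrow> exec c' s' t' s'' \<Longrightarrow> exec (Seq c c') s (t + t') s''"
| IfTrue: "val b s \<noteq> 0 \<Longrightarrow> exec c s t s' \<Longrightarrow> exec (If b c c') s (1 + cost b + t) s'"
| IfFalse: "val b s = 0 \<Longrightarrow> exec c' s t s' \<Longrightarrow> exec (If b c c') s (1 + cost b + t) s'"
| WhileFalse: "val b s = 0 \<Longrightarrow> exec (While b c) s (1 + cost b) s"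
| WhileTrue: "val b s \<noteq> 0 \<Longrightarrow> exec c s t s' \<Longrightarrow> exec (While b c) s' t' s'' \<Longrightarrow>
    exec (While b c) s (1 + cost b + t + t') s''"

inductive_cases exec_SkipE: "exec Skip s t s'"
inductive_cases exec_StoreE: "exec (Store a i e) s t s'"
inductive_cases exec_SeqE: "exec (Seq c c') s t s'"
inductive_cases exec_IfE: "exec (If b c c') s t s'"
inductive_cases exec_WhileE: "exec (While b c) s t s'"

lemma exec_deterministic:
  assumes "exec c s t s'" and "exec c s u r"
  shows "u = t \<and> r = s'"
  using assms
proof (induction arbitrary: u r rule: exec.induct)
  case (Skip s)
  then show ?case by (rule exec_SkipE) simp
next
  case (Store a i e s)
  then show ?case by (rule exec_StoreE) simp
next
  case (Seq c s t s' c' t' s'')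
  from Seq.prems obtain t1 s1 t2 where 1: "exec c s t1 s1" "exec c' s1 t2 r" and u: "u = t1 + t2"
    by (rule exec_SeqE) simp
  from Seq.IH(1)[OF 1(1)] have "t1 = t" "s1 = s'" by simp_all
  with Seq.IH(2) 1(2) u show ?case by simp
next
  case (IfTrue b s c t s' c')
  from IfTrue.prems obtain t1 where 1: "exec c s t1 r" and u: "u = 1 + cost b + t1"
    by (rule exec_IfE) (use IfTrue.hyps(1) in simp_all)
  from IfTrue.IH[OF 1] u show ?case by simp
next
  case (IfFalse b s c' t s' c)
  from IfFalse.prems obtain t1 where 1: "exec c' s t1 r" and u: "u = 1 + cost b + t1"
    by (rule exec_IfE) (use IfFalse.hyps(1) in simp_all)
  from IfFalse.IH[OF 1] u show ?case by simp
next
  case (WhileFalse b s c)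
  from WhileFalse.prems show ?case by (rule exec_WhileE) (use WhileFalse.hyps(1) in simp_all)
next
  case (WhileTrue b s c t s' t' s'')
  from WhileTrue.prems obtain t1 s1 t2
    where 1: "exec c s t1 s1" "exec (While b c) s1 t2 r" and u: "u = 1 + cost b + t1 + t2"
    by (rule exec_WhileE) (use WhileTrue.hyps(1) in simp_all)
  from WhileTrue.IH(1)[OF 1(1)] have "t1 = t" "s1 = s'" by simp_all
  with WhileTrue.IH(2) 1(2) u show ?case by simp
qed


section \<open>Grid graphs as inputs\<close>

text \<open>
  A grid graph is given by a list of its vertices with their coordinates and a list of its
  edges, an edge being a pair of positions in the vertex list. Order and orientation are
  arbitrary.
\<close>

definition represents :: "(int \<times> int) list \<Rightarrow> (nat \<times> nat) list \<Rightarrow> grid_graph \<Rightarrow> bool" where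
  "represents vs es G \<longleftrightarrow>
     distinct vs \<and> set vs = verts G \<and>
     (\<forall>(i, j)\<in>set es. i < length vs \<and> j < length vs) \<and>
     (\<lambda>(i, j). {vs ! i, vs ! j}) ` set es = edges G \<and> length es = card (edges G)"

definition array :: "nat list \<Rightarrow> nat \<Rightarrow> nat" where
  "array xs i = (if i < length xs then xs ! i else 0)"

text \<open>
  An integer coordinate \<open>z\<close> is stored as the pair of natural numbers \<open>nat z\<close>, \<open>nat (- z)\<close>,
  whose difference it is.
\<close>

definition input_memory :: "(int \<times> int) list \<Rightarrow> (nat \<times> nat) list \<Rightarrow> memory" where
  "input_memory vs es = (\<lambda>_ _. 0)
     (0 := array [length vs, length es],
      1 := array (map (\<lambda>v. nat (fst v)) vs),
      2 := array (map (\<lambda>v. nat (- fst v)) vs),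
      3 := array (map (\<lambda>v. nat (snd v)) vs),
      4 := array (map (\<lambda>v. nat (- snd v)) vs),
      5 := array (map fst es),
      6 := array (map snd es))"

definition result :: "memory \<Rightarrow> nat" where
  "result s = s 0 0"

definition graph_size :: "'a sgraph \<Rightarrow> nat" where
  "graph_size G = card (verts G) + card (edges G)"

end

theory Submission imports Defs begin

text \<open>
  Two perfect matchings of \<open>G\<close> differ by a height function on the cells which vanishes outside the
  squares of \<open>G\<close>. Hence the sets of cells that meet a matching \<open>M\<close> in a directed cut form a crossing
  family, the forcing sets of \<open>M\<close> are the sets that hit all of these cuts, and by the theorem of
  Lucchesi and Younger \<open>f(G,M)\<close> is the maximal number of disjoint cuts. Uncrossed, these cuts are
  nested regions with alternating boundaries, and inside every such region a matching can be
  changed so that it has one more alternating square. So \<open>F(G)\<close> is the maximal size of a resonant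
  set, that is, of a set of edge-disjoint squares that alternate with respect to a common matching.

  In terms of height functions this is the maximum of a linear functional over the solutions of a
  system of difference constraints with coefficients bounded by the size of \<open>G\<close>, hence the dual of
  a minimum cost flow problem. It is solved by cycle cancelling. As the costs are polynomially
  bounded, additions and subtractions suffice: potentials are found by lowering values one by one,
  and a negative cycle is what remains when arcs are deleted as long as no potential exists.
\<close>

section \<open>The Lucchesi-Younger theorem for crossing families\<close>

section \<open>Directed cuts\<close>

text \<open>The faces in the definition enter through one consequence only: a finite set of cells
  whose separating edges all belong to \<open>G\<close> consists of squares of \<open>G\<close>.
  Therefore heights vanish off the squares, all other cells can be merged into one vertex of the cut
  system, and of a cut and its complement the side without this vertex is the bounded region. The
  Lucchesi-Younger theorem is proved for crossing families, not for digraphs, because a forcing set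
  has to consist of matched edges: these are the arcs, while unmatched edges merely restrict the
  family. A matching \<open>M\<close> yields a resonant set of size at least \<open>f(G,M)\<close>
  with respect to a possibly different matching. This suffices for the maximum, since conversely a
  forcing set has to hit each of the edge-disjoint squares that alternate with respect to its own
  matching. A resonant set becomes a potential by giving each of its squares two heights, one for
  each way of alternating. Integrality costs nothing: at every vertex the slacks of the four edges
  and the height gaps of the four cells are nonnegative integers with sum 1.\<close>

locale cut_system =
  fixes V :: "'v set" and A :: "'e set" and src dst :: "'e \<Rightarrow> 'v"
  assumes finite_V: "finite V" and finite_A: "finite A"
    and src_in: "a \<in> A \<Longrightarrow> src a \<in> V" and dst_in: "a \<in> A \<Longrightarrow> dst a \<in> V"
begin

definition cutset :: "'v set \<Rightarrow> 'e set" where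
  "cutset D = {a \<in> A. dst a \<in> D \<and> src a \<notin> D}"

definition crossing_family :: "'v set set \<Rightarrow> bool" where
  "crossing_family F \<longleftrightarrow>
     (\<forall>D\<in>F. D \<subseteq> V \<and> (\<forall>a\<in>A. src a \<in> D \<longrightarrow> dst a \<in> D) \<and> cutset D \<noteq> {}) \<and>
     (\<forall>D\<in>F. \<forall>D'\<in>F. D \<inter> D' \<noteq> {} \<longrightarrow> D \<union> D' \<noteq> V \<longrightarrow> D \<inter> D' \<in> F \<and> D \<union> D' \<in> F)"

text \<open>Members are indexed, so that a cut may occur several times. This matters once capacities
  exceed 1 and packings are superposed.\<close>

definition packing :: "'v set set \<Rightarrow> ('e \<Rightarrow> nat) \<Rightarrow> nat \<Rightarrow> (nat \<Rightarrow> 'v set) \<Rightarrow> bool" where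
  "packing F w n D \<longleftrightarrow> (\<forall>i<n. D i \<in> F) \<and>
     (\<forall>a\<in>A. (\<Sum>i<n. of_bool (a \<in> cutset (D i))) \<le> w a)"

definition cross_free :: "nat \<Rightarrow> (nat \<Rightarrow> 'v set) \<Rightarrow> bool" where
  "cross_free n D \<longleftrightarrow> (\<forall>i<n. \<forall>j<n. D i \<subseteq> D j \<or> D j \<subseteq> D i \<or> D i \<inter> D j = {} \<or> D i \<union> D j = V)"

lemma sum_two_updates:
  fixes f :: "nat \<Rightarrow> nat"
  assumes "i < n" "j < n" "i \<noteq> j"
  shows "(\<Sum>k<n. f k) = f i + f j + (\<Sum>k\<in>{..<n} - {i, j}. f k)"
proof -
  have "(\<Sum>k<n. f k) = f i + (\<Sum>k\<in>{..<n} - {i}. f k)"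
    using assms by (subst sum.remove[of _ i]) auto
  also have "(\<Sum>k\<in>{..<n} - {i}. f k) = f j + (\<Sum>k\<in>{..<n} - {i} - {j}. f k)"
    using assms by (subst sum.remove[of _ j]) auto
  also have "{..<n} - {i} - {j} = {..<n} - {i, j}" by auto
  finally show ?thesis by (simp only: add.assoc)
qed

text \<open>Replacing a crossing pair by its intersection and union keeps the number of times that
  each arc is covered, because no arc leaves a member. It strictly increases the sum of the squared
  sizes, so a packing that maximizes this sum is cross-free.\<close>

lemma uncrossing:
  assumes F: "crossing_family F" and D: "packing F w n D"
  shows "\<exists>D'. packing F w n D' \<and> cross_free n D'"
proof -
  define \<mu> :: "(nat \<Rightarrow> 'v set) \<Rightarrow> nat" where "\<mu> D = (\<Sum>i<n. (card (D i))\<^sup>2)" for D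
  have "\<mu> D < n * (card V)\<^sup>2 + 1" if "packing F w n D" for D
  proof -
    have "(card (D i))\<^sup>2 \<le> (card V)\<^sup>2" if "i < n" for i
      using that \<open>packing F w n D\<close> F finite_V
      by (auto simp: packing_def crossing_family_def intro!: power_mono card_mono)
    then have "\<mu> D \<le> (\<Sum>i<n. (card V)\<^sup>2)" unfolding \<mu>_def by (intro sum_mono) auto
    then show ?thesis by simp
  qed
  then obtain E where E: "packing F w n E" and max: "\<And>D. packing F w n D \<Longrightarrow> \<mu> D \<le> \<mu> E"
    using ex_has_greatest_nat[of "packing F w n" D \<mu> "n * (card V)\<^sup>2 + 1"] D by auto
  have "cross_free n E"
  proof (rule ccontr)
    assume "\<not> cross_free n E"
    then obtain i j where ij: "i < n" "j < n" and cr: "\<not> E i \<subseteq> E j" "\<not> E j \<subseteq> E i"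
      "E i \<inter> E j \<noteq> {}" "E i \<union> E j \<noteq> V" unfolding cross_free_def by blast
    then have ne: "i \<noteq> j" by auto
    have EF: "E i \<in> F" "E j \<in> F" using E ij by (auto simp: packing_def)
    then have new: "E i \<inter> E j \<in> F" "E i \<union> E j \<in> F"
      using conjunct2[OF F[unfolded crossing_family_def], rule_format, OF EF cr(3,4)] by auto
    define D' where "D' = E(i := E i \<inter> E j, j := E i \<union> E j)"
    have "packing F w n D'"
      unfolding packing_def
    proof (intro conjI allI impI ballI)
      show "D' k \<in> F" if "k < n" for k
        using that new E by (auto simp: D'_def packing_def)
      fix a assume a: "a \<in> A"
      have "(\<Sum>k<n. of_bool (a \<in> cutset (D' k))) = (\<Sum>k<n. of_bool (a \<in> cutset (E k)) :: nat)"
      proof -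
        have "src a \<in> E i \<longrightarrow> dst a \<in> E i" "src a \<in> E j \<longrightarrow> dst a \<in> E j"
          using F EF a by (auto simp: crossing_family_def)
        then have "of_bool (a \<in> cutset (D' i)) + of_bool (a \<in> cutset (D' j)) =
            (of_bool (a \<in> cutset (E i)) + of_bool (a \<in> cutset (E j)) :: nat)"
          using ne by (auto simp: D'_def cutset_def)
        moreover have "(\<Sum>k\<in>{..<n} - {i, j}. of_bool (a \<in> cutset (D' k))) =
            (\<Sum>k\<in>{..<n} - {i, j}. of_bool (a \<in> cutset (E k)) :: nat)"
          by (intro sum.cong) (auto simp: D'_def)
        ultimately show ?thesis by (simp only: sum_two_updates[OF ij ne])
      qed
      then show "(\<Sum>k<n. of_bool (a \<in> cutset (D' k))) \<le> w a"
        using E a by (simp add: packing_def)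
    qed
    then have le: "\<mu> D' \<le> \<mu> E" by (rule max)
    have fin: "finite (E i)" "finite (E j)"
      using EF F finite_V by (auto simp: crossing_family_def intro: finite_subset)
    define c where "c = card (E i \<inter> E j)"
    have "c < card (E i)" "c < card (E j)"
      unfolding c_def using cr fin by (auto intro!: psubset_card_mono)
    then obtain x y where xy: "card (E i) = c + x" "card (E j) = c + y" "x > 0" "y > 0"
      by (metis less_imp_add_positive)
    then have "card (E i \<union> E j) = c + x + y"
      using card_Un_Int[OF fin] by (simp add: c_def)
    then have "(card (E i \<inter> E j))\<^sup>2 + (card (E i \<union> E j))\<^sup>2 = (card (E i))\<^sup>2 + (card (E j))\<^sup>2 + 2 * x * y"
      using xy by (simp add: c_def[symmetric] power2_eq_square algebra_simps)
    then have "(card (D' i))\<^sup>2 + (card (D' j))\<^sup>2 > (card (E i))\<^sup>2 + (card (E j))\<^sup>2"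
      using ne xy by (simp add: D'_def)
    moreover have "(\<Sum>k\<in>{..<n} - {i, j}. (card (D' k))\<^sup>2) = (\<Sum>k\<in>{..<n} - {i, j}. (card (E k))\<^sup>2)"
      by (intro sum.cong) (auto simp: D'_def)
    ultimately have "\<mu> D' > \<mu> E"
      unfolding \<mu>_def by (simp only: sum_two_updates[OF ij ne])
    with le show False by simp
  qed
  with E show ?thesis by blast
qed

end

text \<open>The number of successors maps a finite strict order bijectively onto an initial segment
  of the naturals. The parity of this number splits a chain of cuts into two nearly equal
  halves.\<close>

lemma even_rank_card:
  fixes U :: "nat set" and R :: "nat \<Rightarrow> nat \<Rightarrow> bool"
  assumes "finite U" and irr: "\<And>i. i \<in> U \<Longrightarrow> \<not> R i i"
    and tr: "\<And>i j k. \<lbrakk>i \<in> U; j \<in> U; k \<in> U; R i j; R j k\<rbrakk> \<Longrightarrow> R i k"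
    and tot: "\<And>i j. \<lbrakk>i \<in> U; j \<in> U; i \<noteq> j\<rbrakk> \<Longrightarrow> R i j \<or> R j i"
  shows "card {i \<in> U. even (card {j \<in> U. R i j})} = (card U + 1) div 2"
    and "card {i \<in> U. odd (card {j \<in> U. R i j})} = card U div 2"
proof -
  let ?r = "\<lambda>i. card {j \<in> U. R i j}"
  have lt: "?r j < ?r i" if "i \<in> U" "j \<in> U" "R i j" for i j
  proof (rule psubset_card_mono)
    have "{k \<in> U. R j k} \<subseteq> {k \<in> U. R i k}" using tr[OF that(1,2)] that(3) by auto
    moreover have "j \<in> {k \<in> U. R i k}" "j \<notin> {k \<in> U. R j k}" using that irr by auto
    ultimately show "{k \<in> U. R j k} \<subset> {k \<in> U. R i k}" by blast
  qed (use assms in auto)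
  have inj: "inj_on ?r U"
  proof (rule inj_onI, rule ccontr)
    fix i j assume "i \<in> U" "j \<in> U" "?r i = ?r j" "i \<noteq> j"
    then show False using lt[of i j] lt[of j i] tot[of i j] by auto
  qed
  have "?r ` U \<subseteq> {..<card U}"
  proof safe
    fix i assume "i \<in> U"
    then have "{j \<in> U. R i j} \<subset> U" using irr[of i] by auto
    then show "?r i < card U" using assms(1) by (rule psubset_card_mono[rotated])
  qed
  then have im: "?r ` U = {..<card U}"
    using inj by (intro card_subset_eq) (auto simp: card_image)
  have cnt: "card {i \<in> U. P (?r i)} = card {k. k < card U \<and> P k}" for P
  proof -
    have "card {i \<in> U. P (?r i)} = card (?r ` {i \<in> U. P (?r i)})"
      by (rule card_image[symmetric]) (use inj in \<open>auto simp: inj_on_def\<close>)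
    also have "?r ` {i \<in> U. P (?r i)} = {k. k < card U \<and> P k}"
    proof (intro equalityI subsetI)
      fix k assume k: "k \<in> {k. k < card U \<and> P k}"
      then have "k \<in> ?r ` U" using im by simp
      then show "k \<in> ?r ` {i \<in> U. P (?r i)}" using k by auto
    qed (use im in auto)
    finally show ?thesis .
  qed
  have e: "card {k. k < n \<and> even k} = (n + 1) div 2 \<and> card {k. k < n \<and> odd k} = n div 2" for n :: nat
  proof (induction n)
    case (Suc n)
    have "{k. k < Suc n \<and> even k} = (if even n then insert n {k. k < n \<and> even k} else {k. k < n \<and> even k})"
      "{k. k < Suc n \<and> odd k} = (if odd n then insert n {k. k < n \<and> odd k} else {k. k < n \<and> odd k})"
      by (auto simp: less_Suc_eq)
    then show ?case using Suc by auto
  qed auto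
  show "card {i \<in> U. even (?r i)} = (card U + 1) div 2" "card {i \<in> U. odd (?r i)} = card U div 2"
    using cnt[of even] cnt[of odd] e[of "card U"] by simp_all
qed

context cut_system
begin

text \<open>Complementing the cuts that contain \<open>r\<close> turns the cross-free family into a
  laminar one. It is coloured with two colours such that every arc is met about equally often by
  both, and the larger colour class is the packing sought.\<close>

lemma halving:
  assumes F: "crossing_family F" and D: "packing F (\<lambda>a. 2 * w a) n D" and cf: "cross_free n D"
    and "r \<in> V"
  shows "\<exists>k D'. packing F w k D' \<and> n \<le> 2 * k"
proof -
  define Q where "Q i = (if r \<in> D i then V - D i else D i)" for i
  \<comment> \<open>Ties between equal sets are broken by the index, so that the sets met by an arc
    are strictly ordered even if cuts are repeated.\<close>
  define R where "R i j \<longleftrightarrow> Q i \<subset> Q j \<or> Q i = Q j \<and> i < j" for i j :: nat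
  \<comment> \<open>The colour is the parity of the depth, reversed for complemented cuts. The cuts
    met by an arc form one chain of either sort. Due to the reversal each colour gets the rounded up
    half of one chain and the rounded down half of the other, and the sum stays within
    \<open>w\<close>.\<close>
  define col where "col i \<longleftrightarrow> even (of_bool (r \<in> D i) + card {j. j < n \<and> R i j})" for i
  have DF: "D i \<in> F" if "i < n" for i using D that by (simp add: packing_def)
  have DV: "D i \<subseteq> V" if "i < n" for i using DF[OF that] F by (simp add: crossing_family_def)
  have closed: "dst a \<in> D i" if "i < n" "a \<in> A" "src a \<in> D i" for i a
    using DF[OF that(1)] F that by (simp add: crossing_family_def)
  have lam: "Q i \<subseteq> Q j \<or> Q j \<subseteq> Q i \<or> Q i \<inter> Q j = {}" if "i < n" "j < n" for i j
    using cf[unfolded cross_free_def, rule_format, OF that] DV[OF that(1)] DV[OF that(2)] \<open>r \<in> V\<close>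
    unfolding Q_def by (cases "r \<in> D i"; cases "r \<in> D j") (simp_all, blast+)
  have half: "card {i. i < n \<and> col i \<and> a \<in> cutset (D i)} \<le> w a \<and>
      card {i. i < n \<and> \<not> col i \<and> a \<in> cutset (D i)} \<le> w a" if a: "a \<in> A" for a
  proof -
    define U where "U = {i. i < n \<and> a \<in> cutset (D i) \<and> r \<notin> D i}"
    define W where "W = {i. i < n \<and> a \<in> cutset (D i) \<and> r \<in> D i}"
    \<comment> \<open>\<open>\<kappa>\<close> counts the sets around both ends of the arc. They
      contribute equally to the depth of every member of either chain.\<close>
    define \<kappa> where "\<kappa> = card {j. j < n \<and> dst a \<in> Q j \<and> src a \<in> Q j}"
    have finU: "finite U" "finite W" by (auto simp: U_def W_def)
    have U: "i \<in> U \<longleftrightarrow> i < n \<and> dst a \<in> Q i \<and> src a \<notin> Q i" for i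
      using a closed[of i a] src_in[OF a] dst_in[OF a] by (auto simp: U_def Q_def cutset_def)
    have W: "i \<in> W \<longleftrightarrow> i < n \<and> dst a \<notin> Q i \<and> src a \<in> Q i" for i
      using a closed[of i a] src_in[OF a] dst_in[OF a] by (auto simp: W_def Q_def cutset_def)
    have depth: "card {j. j < n \<and> R i j} = card {j \<in> X. R i j} + \<kappa>"
      if "i \<in> X" "X = U \<or> X = W" for i X
    proof -
      have "{j. j < n \<and> R i j} = {j \<in> X. R i j} \<union> {j. j < n \<and> dst a \<in> Q j \<and> src a \<in> Q j}"
      proof (intro equalityI subsetI)
        fix j assume "j \<in> {j. j < n \<and> R i j}"
        then show "j \<in> {j \<in> X. R i j} \<union> {j. j < n \<and> dst a \<in> Q j \<and> src a \<in> Q j}"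
          using that U W by (auto simp: R_def)
      next
        fix j assume "j \<in> {j \<in> X. R i j} \<union> {j. j < n \<and> dst a \<in> Q j \<and> src a \<in> Q j}"
        then show "j \<in> {j. j < n \<and> R i j}"
          using that U W lam[of i j] by (auto simp: R_def)
      qed
      moreover have "{j \<in> X. R i j} \<inter> {j. j < n \<and> dst a \<in> Q j \<and> src a \<in> Q j} = {}"
        using that U W by auto
      moreover have "finite {j \<in> X. R i j}" using that finU by auto
      ultimately show ?thesis by (simp add: card_Un_disjoint \<kappa>_def)
    qed
    have rank: "card {i \<in> X. even (card {j \<in> X. R i j})} = (card X + 1) div 2"
        "card {i \<in> X. odd (card {j \<in> X. R i j})} = card X div 2" if X: "X = U \<or> X = W" for X
    proof -
      have tot: "R i j \<or> R j i" if "i \<in> X" "j \<in> X" "i \<noteq> j" for i j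
      proof -
        have ij: "i < n" "j < n" "dst a \<in> Q i \<and> dst a \<in> Q j \<or> src a \<in> Q i \<and> src a \<in> Q j"
          using that X U W by blast+
        then show ?thesis using lam[OF ij(1,2)] \<open>i \<noteq> j\<close> unfolding R_def by auto
      qed
      have tr: "R i k" if "R i j" "R j k" for i j k using that by (auto simp: R_def)
      have irr: "\<not> R i i" for i by (simp add: R_def)
      show "card {i \<in> X. even (card {j \<in> X. R i j})} = (card X + 1) div 2"
        "card {i \<in> X. odd (card {j \<in> X. R i j})} = card X div 2"
        using even_rank_card[of X R, OF _ irr tr tot] X finU by auto
    qed
    have "card U + card W = card {i. i < n \<and> a \<in> cutset (D i)}"
      using finU by (subst card_Un_disjoint[symmetric]) (auto simp: U_def W_def intro!: arg_cong[where f = card])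
    also have "\<dots> = (\<Sum>i<n. of_bool (a \<in> cutset (D i)))"
      by (simp add: Int_def)
    finally have uw: "card U + card W \<le> 2 * w a" using D a by (simp add: packing_def)
    have colU: "col i \<longleftrightarrow> even (card {j \<in> U. R i j} + \<kappa>)" if "i \<in> U" for i
      using depth[OF that] that by (simp add: col_def U_def)
    have colW: "col i \<longleftrightarrow> odd (card {j \<in> W. R i j} + \<kappa>)" if "i \<in> W" for i
      using depth[OF that] that by (simp add: col_def W_def)
    have split: "card {i. i < n \<and> P i \<and> a \<in> cutset (D i)} = card {i \<in> U. P i} + card {i \<in> W. P i}" for P
      using finU by (subst card_Un_disjoint[symmetric])
        (auto simp: U_def W_def intro!: arg_cong[where f = card])
    have "{i \<in> U. col i} = {i \<in> U. even (card {j \<in> U. R i j} + \<kappa>)}"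
      "{i \<in> U. \<not> col i} = {i \<in> U. odd (card {j \<in> U. R i j} + \<kappa>)}"
      "{i \<in> W. col i} = {i \<in> W. odd (card {j \<in> W. R i j} + \<kappa>)}"
      "{i \<in> W. \<not> col i} = {i \<in> W. even (card {j \<in> W. R i j} + \<kappa>)}"
      using colU colW by auto
    then show ?thesis
      unfolding split using rank[of U] rank[of W] uw by (cases "even \<kappa>") auto
  qed
  have sub: "\<exists>D'. packing F w (card I) D'"
    if "I \<subseteq> {..<n}" and le: "\<And>a. a \<in> A \<Longrightarrow> card {i \<in> I. a \<in> cutset (D i)} \<le> w a" for I
  proof -
    have "finite I" using that(1) finite_subset by blast
    then obtain f where f: "bij_betw f {0..<card I} I" using ex_bij_betw_nat_finite by blast
    have "packing F w (card I) (D \<circ> f)"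
      unfolding packing_def
    proof (intro conjI allI impI ballI)
      show "(D \<circ> f) i \<in> F" if "i < card I" for i
        using bij_betwE[OF f] that \<open>I \<subseteq> {..<n}\<close> DF by (simp add: subset_iff)
      fix a assume a: "a \<in> A"
      have "(\<Sum>i<card I. of_bool (a \<in> cutset ((D \<circ> f) i))) = (\<Sum>i\<in>I. of_bool (a \<in> cutset (D i)) :: nat)"
        using sum.reindex_bij_betw[OF f, of "\<lambda>i. of_bool (a \<in> cutset (D i)) :: nat"]
        by (simp add: atLeast0LessThan)
      also have "\<dots> = card {i \<in> I. a \<in> cutset (D i)}" using \<open>finite I\<close> by (simp add: Int_def)
      finally show "(\<Sum>i<card I. of_bool (a \<in> cutset ((D \<circ> f) i))) \<le> w a" using le[OF a] by simp
    qed
    then show ?thesis by blast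
  qed
  define I J where "I = {i. i < n \<and> col i}" and "J = {i. i < n \<and> \<not> col i}"
  have "n = card {i. i < n}" by simp
  also have "\<dots> = card (I \<union> J)" by (rule arg_cong[where f = card]) (auto simp: I_def J_def)
  also have "\<dots> = card I + card J" by (rule card_Un_disjoint) (auto simp: I_def J_def)
  finally have n: "n = card I + card J" .
  obtain D1 where "packing F w (card I) D1"
    using sub[of I] half unfolding I_def by (auto simp: conj_ac)
  moreover obtain D2 where "packing F w (card J) D2"
    using sub[of J] half unfolding J_def by (auto simp: conj_ac)
  moreover have "n \<le> 2 * card I \<or> n \<le> 2 * card J" using n by linarith
  ultimately show ?thesis by blast
qed

text \<open>Every member uses at least one arc, because cuts of the family are not empty. Hence the
  greatest number in \<open>dicut_number\<close> exists.\<close>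

lemma packing_bound:
  assumes F: "crossing_family F" and D: "packing F w n D"
  shows "n \<le> sum w A"
proof -
  have "n = (\<Sum>i<n. 1)" by simp
  also have "\<dots> \<le> (\<Sum>i<n. \<Sum>a\<in>A. of_bool (a \<in> cutset (D i)))"
  proof (rule sum_mono)
    fix i assume "i \<in> {..<n}"
    then have "cutset (D i) \<noteq> {}" using D F by (auto simp: packing_def crossing_family_def)
    then obtain a where "a \<in> A" "a \<in> cutset (D i)" by (auto simp: cutset_def)
    then have "1 \<le> card (A \<inter> cutset (D i))"
      using finite_A by (metis IntI Suc_leI card_gt_0_iff empty_iff finite_Int One_nat_def)
    then show "1 \<le> (\<Sum>a\<in>A. of_bool (a \<in> cutset (D i)) :: nat)" using finite_A by (simp add: Int_def)
  qed
  also have "\<dots> = (\<Sum>a\<in>A. \<Sum>i<n. of_bool (a \<in> cutset (D i)))" by (rule sum.swap)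
  also have "\<dots> \<le> sum w A" using D by (intro sum_mono) (simp add: packing_def)
  finally show ?thesis .
qed

definition dicut_number :: "'v set set \<Rightarrow> nat" where
  "dicut_number F = (GREATEST n. \<exists>D. packing F (\<lambda>_. 1) n D)"

lemma dicut_number:
  assumes "crossing_family F"
  shows "\<exists>D. packing F (\<lambda>_. 1) (dicut_number F) D"
    and "packing F (\<lambda>_. 1) n D \<Longrightarrow> n \<le> dicut_number F"
proof -
  have b: "\<forall>n. (\<exists>D. packing F (\<lambda>_. 1) n D) \<longrightarrow> n \<le> card A"
    using packing_bound[OF assms, of "\<lambda>_. 1"] by auto
  have "packing F (\<lambda>_. 1) 0 undefined" by (simp add: packing_def)
  then show "\<exists>D. packing F (\<lambda>_. 1) (dicut_number F) D"
    unfolding dicut_number_def by (intro GreatestI_nat[where P = "\<lambda>n. \<exists>D. packing F (\<lambda>_. 1) n D", OF _ b[rule_format]]) auto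
  show "packing F (\<lambda>_. 1) n D \<Longrightarrow> n \<le> dicut_number F"
    unfolding dicut_number_def by (rule Greatest_le_nat[OF _ b[rule_format]]) auto
qed

lemma packing_append:
  assumes "packing F w1 n1 D1" "packing F w2 n2 D2"
  shows "packing F (\<lambda>a. w1 a + w2 a) (n1 + n2) (\<lambda>i. if i < n1 then D1 i else D2 (i - n1))"
proof -
  have "(\<Sum>i<n1 + n2. f (if i < n1 then D1 i else D2 (i - n1))) = (\<Sum>i<n1. f (D1 i)) + (\<Sum>i<n2. f (D2 i))"
    for f :: "'v set \<Rightarrow> nat"
  proof (induction n2)
    case 0 then show ?case by (auto intro!: sum.cong)
  qed auto
  note split = this
  show ?thesis
    unfolding packing_def
  proof (intro conjI ballI allI impI)
    show "(if i < n1 then D1 i else D2 (i - n1)) \<in> F" if "i < n1 + n2" for i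
      using that assms by (auto simp: packing_def)
    show "(\<Sum>i<n1 + n2. of_bool (a \<in> cutset (if i < n1 then D1 i else D2 (i - n1)))) \<le> w1 a + w2 a"
      if "a \<in> A" for a
      unfolding split[of "\<lambda>D. of_bool (a \<in> cutset D)"]
      by (rule add_mono) (use assms that in \<open>simp_all add: packing_def\<close>)
  qed
qed

text \<open>An arc that enters an intersection or a union enters one of the two sets.\<close>

lemma crossing_family_avoiding:
  assumes "crossing_family F"
  shows "crossing_family {D \<in> F. a \<notin> cutset D}"
proof -
  have "a \<notin> cutset (D \<inter> D')" "a \<notin> cutset (D \<union> D')" if "a \<notin> cutset D" "a \<notin> cutset D'" for D D'
    using that by (auto simp: cutset_def)
  then show ?thesis using assms unfolding crossing_family_def by simp
qed

text \<open>Lovasz's argument: let \<open>B\<close> be a maximal set of arcs whose capacity can be raised to 2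
  without enlarging the optimal packing. An arc outside \<open>B\<close> has the desired property, since
  otherwise two packings could be superposed, uncrossed and halved.\<close>

lemma exists_essential_arc:
  assumes F: "crossing_family F" "F \<noteq> {}"
  shows "\<exists>a\<in>A. dicut_number {D \<in> F. a \<notin> cutset D} < dicut_number F"
proof (rule ccontr)
  assume neg: "\<not> ?thesis"
  define \<nu> where "\<nu> = dicut_number F"
  obtain D0 where D0: "D0 \<in> F" using F by blast
  then have "packing F (\<lambda>_. 1) 1 (\<lambda>_. D0)" by (simp add: packing_def)
  then have pos: "\<nu> \<ge> 1" unfolding \<nu>_def by (rule dicut_number[OF F(1)])
  have "cutset D0 \<noteq> {}" using F(1) D0 by (simp add: crossing_family_def)
  then obtain r where r: "r \<in> V" using src_in by (auto simp: cutset_def)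
  define ok where "ok B \<longleftrightarrow> (\<forall>n D. packing F (\<lambda>a. 1 + of_bool (a \<in> B)) n D \<longrightarrow> n \<le> \<nu>)" for B :: "'e set"
  have "ok {}" using dicut_number(2)[OF F(1)] by (simp add: ok_def \<nu>_def)
  then have "{B. B \<subseteq> A \<and> ok B} \<noteq> {}" by blast
  then obtain B where B: "B \<subseteq> A" "ok B" and Bmax: "\<And>B'. B' \<subseteq> A \<Longrightarrow> ok B' \<Longrightarrow> B \<subseteq> B' \<Longrightarrow> B' = B"
    using finite_has_maximal[of "{B. B \<subseteq> A \<and> ok B}"] finite_A by auto metis
  \<comment> \<open>With capacity 2 everywhere an optimal packing can be taken twice.\<close>
  have "\<not> ok A"
  proof
    assume okA: "ok A"
    obtain D where D: "packing F (\<lambda>_. 1) \<nu> D" using dicut_number(1)[OF F(1)] by (auto simp: \<nu>_def)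
    from packing_append[OF D D] have "\<exists>D. packing F (\<lambda>a. 1 + of_bool (a \<in> A)) (\<nu> + \<nu>) D"
      by (auto simp: packing_def)
    then show False using okA pos unfolding ok_def by force
  qed
  then have "B \<noteq> A" using B(2) by blast
  then obtain b where b: "b \<in> A" "b \<notin> B" using B(1) by blast
  then have "\<not> ok (insert b B)" using Bmax[of "insert b B"] B by auto
  then obtain n1 D1 where D1: "packing F (\<lambda>a. 1 + of_bool (a \<in> insert b B)) n1 D1" "n1 > \<nu>"
    unfolding ok_def by (auto simp: not_le)
  define Fb where "Fb = {D \<in> F. b \<notin> cutset D}"
  have "\<nu> \<le> dicut_number Fb" using neg b(1) by (auto simp: \<nu>_def Fb_def not_less)
  moreover obtain D2 where "packing Fb (\<lambda>_. 1) (dicut_number Fb) D2"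
    using dicut_number(1)[OF crossing_family_avoiding[OF F(1)]] by (auto simp: Fb_def)
  ultimately obtain n2 where n2: "n2 \<ge> \<nu>" and D2: "packing Fb (\<lambda>_. 1) n2 D2" by blast
  have D2': "packing F (\<lambda>a. of_bool (a \<noteq> b)) n2 D2"
    using D2 unfolding packing_def Fb_def by (auto simp: sum.neutral)
  \<comment> \<open>On \<open>b\<close> the first packing may use 2 and the second one uses nothing;
    on any other arc the second one adds at most 1. So the doubled capacities suffice.\<close>
  have "\<exists>D. packing F (\<lambda>a. 2 * (1 + of_bool (a \<in> B))) (n1 + n2) D"
  proof -
    have "packing F w' n D" if "packing F w n D" "\<And>a. a \<in> A \<Longrightarrow> w a \<le> w' a" for w w' n D
      using that unfolding packing_def by (meson order_trans)
    note mono = this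
    have "packing F (\<lambda>a. 2 * (1 + of_bool (a \<in> B))) (n1 + n2) (\<lambda>i. if i < n1 then D1 i else D2 (i - n1))"
      by (rule mono[OF packing_append[OF D1(1) D2']]) (use b in auto)
    then show ?thesis by blast
  qed
  then obtain D where "packing F (\<lambda>a. 2 * (1 + of_bool (a \<in> B))) (n1 + n2) D" by blast
  then obtain D' where "packing F (\<lambda>a. 2 * (1 + of_bool (a \<in> B))) (n1 + n2) D'" "cross_free (n1 + n2) D'"
    using uncrossing[OF F(1)] by blast
  then obtain k D'' where "packing F (\<lambda>a. 1 + of_bool (a \<in> B)) k D''" "n1 + n2 \<le> 2 * k"
    using halving[where w = "\<lambda>a. 1 + of_bool (a \<in> B)", OF F(1) _ _ r] by blast
  then have "k \<le> \<nu>" using B(2) unfolding ok_def by blast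
  then show False using D1(2) n2 \<open>n1 + n2 \<le> 2 * k\<close> by linarith
qed

text \<open>An essential arc is put into the hitting set. The cuts that it misses form a crossing
  family with a smaller packing number, to which induction applies. The packing is delivered
  uncrossed, as nested regions are needed later.\<close>

theorem lucchesi_younger:
  assumes "crossing_family F"
  shows "\<exists>S n D. S \<subseteq> A \<and> card S \<le> n \<and> (\<forall>D\<in>F. cutset D \<inter> S \<noteq> {}) \<and>
    packing F (\<lambda>_. 1) n D \<and> cross_free n D"
proof -
  have "\<exists>S. S \<subseteq> A \<and> card S \<le> dicut_number F \<and> (\<forall>D\<in>F. cutset D \<inter> S \<noteq> {})"
    using assms
  proof (induction "dicut_number F" arbitrary: F rule: less_induct)
    case less
    show ?case
    proof (cases "F = {}")
      case True
      then show ?thesis by (intro exI[of _ "{}"]) auto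
    next
      case False
      then obtain a where a: "a \<in> A" and lt: "dicut_number {D \<in> F. a \<notin> cutset D} < dicut_number F"
        using exists_essential_arc less.prems by blast
      obtain S where S: "S \<subseteq> A" "card S \<le> dicut_number {D \<in> F. a \<notin> cutset D}"
          "\<forall>D\<in>{D \<in> F. a \<notin> cutset D}. cutset D \<inter> S \<noteq> {}"
        using less.hyps[OF lt crossing_family_avoiding[OF less.prems]] by blast
      have "card (insert a S) \<le> dicut_number F"
        using S(2) lt card_insert_le_m1[of "dicut_number F" S a] by simp
      then show ?thesis using S a by (intro exI[of _ "insert a S"]) auto
    qed
  qed
  moreover obtain D where "packing F (\<lambda>_. 1) (dicut_number F) D" "cross_free (dicut_number F) D"
    using dicut_number(1)[OF assms] uncrossing[OF assms] by blast
  ultimately show ?thesis by blast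
qed

end

section \<open>Switching matchings along alternating boundaries\<close>

section \<open>Matchings of lattice graphs\<close>

type_synonym cell = "int \<times> int"

text \<open>\<open>(True, x, y)\<close> is the lattice edge from \<open>(x, y)\<close> to \<open>(x + 1, y)\<close>, and \<open>(False, x, y)\<close> the one
  from \<open>(x, y)\<close> to \<open>(x, y + 1)\<close>. A unit cell is named by its lower left corner.\<close>

type_synonym ledge = "bool \<times> int \<times> int"

fun upc :: "ledge \<Rightarrow> cell" where
  "upc (b, x, y) = (x, y)"

fun dnc :: "ledge \<Rightarrow> cell" where
  "dnc (b, x, y) = (if b then (x, y - 1) else (x - 1, y))"

text \<open>The cells to the left and to the right of an edge directed from its end with even
  coordinate sum to the other one.\<close>

fun lft :: "ledge \<Rightarrow> cell" where
  "lft (b, x, y) = (if b = even (x + y) then upc (b, x, y) else dnc (b, x, y))"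

fun rgt :: "ledge \<Rightarrow> cell" where
  "rgt (b, x, y) = (if b = even (x + y) then dnc (b, x, y) else upc (b, x, y))"

fun star :: "cell \<Rightarrow> ledge set" where
  "star (x, y) = {(True, x, y), (True, x - 1, y), (False, x, y), (False, x, y - 1)}"

fun sides :: "cell \<Rightarrow> ledge set" where
  "sides (x, y) = {(True, x, y), (True, x, y + 1), (False, x, y), (False, x + 1, y)}"

definition bdry :: "cell set \<Rightarrow> ledge set" where
  "bdry Q = {e. (upc e \<in> Q) \<noteq> (dnc e \<in> Q)}"

text \<open>With respect to \<open>lft\<close> and \<open>rgt\<close>, the edges along the boundary of \<open>Q\<close> have \<open>Q\<close> alternately to their
  left and to their right. The phase \<open>s\<close> says which of them are in \<open>m\<close>.\<close>

definition alt :: "bool \<Rightarrow> ledge set \<Rightarrow> cell set \<Rightarrow> bool" where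
  "alt s m Q \<longleftrightarrow> (\<forall>e\<in>bdry Q. e \<in> m \<longleftrightarrow> (rgt e \<in> Q \<longleftrightarrow> s))"

definition altc :: "ledge set \<Rightarrow> cell \<Rightarrow> bool" where
  "altc m q \<longleftrightarrow> (\<exists>s. alt s m {q})"

text \<open>A resonant set, except that the cells are not yet required to be squares of the
  graph.\<close>

definition packed :: "ledge set \<Rightarrow> cell set \<Rightarrow> bool" where
  "packed m K \<longleftrightarrow> (\<forall>q\<in>K. altc m q) \<and> (\<forall>q\<in>K. \<forall>q'\<in>K. q \<noteq> q' \<longrightarrow> sides q \<inter> sides q' = {})"

definition agree :: "cell set \<Rightarrow> ledge set \<Rightarrow> ledge set \<Rightarrow> bool" where
  "agree Q m m' \<longleftrightarrow> (\<forall>e. upc e \<notin> Q \<longrightarrow> dnc e \<notin> Q \<longrightarrow> (e \<in> m' \<longleftrightarrow> e \<in> m))"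

lemma bdry_single: "bdry {q} = sides q"
proof -
  obtain x y where "q = (x, y)" by (cases q)
  then show ?thesis by (auto simp: bdry_def split: if_splits)
qed

text \<open>Alternation in coordinates. On the boundary, vertical and horizontal sides of a cell
  have opposite status, and which of them are matched depends on the colour of the cell and the
  phase alone.\<close>

lemma alt_sides:
  assumes "alt s m Q" "(a, b) \<in> Q"
  shows "(a - 1, b) \<notin> Q \<Longrightarrow> (False, a, b) \<in> m \<longleftrightarrow> (even (a + b) = s)"
    and "(a + 1, b) \<notin> Q \<Longrightarrow> (False, a + 1, b) \<in> m \<longleftrightarrow> (even (a + b) = s)"
    and "(a, b - 1) \<notin> Q \<Longrightarrow> (True, a, b) \<in> m \<longleftrightarrow> (even (a + b) \<noteq> s)"
    and "(a, b + 1) \<notin> Q \<Longrightarrow> (True, a, b + 1) \<in> m \<longleftrightarrow> (even (a + b) \<noteq> s)"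
proof -
  note A = assms(1)[unfolded alt_def, rule_format]
  show "(a - 1, b) \<notin> Q \<Longrightarrow> (False, a, b) \<in> m \<longleftrightarrow> (even (a + b) = s)"
    using A[of "(False, a, b)"] assms(2) by (auto simp: bdry_def)
  show "(a + 1, b) \<notin> Q \<Longrightarrow> (False, a + 1, b) \<in> m \<longleftrightarrow> (even (a + b) = s)"
    using A[of "(False, a + 1, b)"] assms(2) by (auto simp: bdry_def)
  show "(a, b - 1) \<notin> Q \<Longrightarrow> (True, a, b) \<in> m \<longleftrightarrow> (even (a + b) \<noteq> s)"
    using A[of "(True, a, b)"] assms(2) by (auto simp: bdry_def)
  show "(a, b + 1) \<notin> Q \<Longrightarrow> (True, a, b + 1) \<in> m \<longleftrightarrow> (even (a + b) \<noteq> s)"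
    using A[of "(True, a, b + 1)"] assms(2) by (auto simp: bdry_def)
qed

lemma altc_iff:
  "altc m (a, b) \<longleftrightarrow> ((False, a + 1, b) \<in> m) = ((False, a, b) \<in> m) \<and>
     ((True, a, b) \<in> m) = ((False, a, b) \<notin> m) \<and> ((True, a, b + 1) \<in> m) = ((False, a, b) \<notin> m)"
  (is "_ \<longleftrightarrow> ?R")
proof
  assume "altc m (a, b)"
  then obtain s where s: "alt s m {(a, b)}" by (auto simp: altc_def)
  show ?R using alt_sides[OF s, of a b] by auto
next
  assume ?R
  then have "alt (even (a + b) = ((False, a, b) \<in> m)) m {(a, b)}"
    by (auto simp: alt_def bdry_single)
  then show "altc m (a, b)" by (auto simp: altc_def)
qed

lemma altc_cong:
  assumes "altc m q" "\<And>e. e \<in> sides q \<Longrightarrow> e \<in> m' \<longleftrightarrow> e \<in> m"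
  shows "altc m' q"
  using assms unfolding altc_def alt_def bdry_single by blast

lemma alt_flip: "alt s m Q \<Longrightarrow> alt (\<not> s) (sym_diff m (bdry Q)) Q"
  unfolding alt_def by blast

lemma alt_cong:
  assumes "alt s m Q" "\<And>e. e \<in> bdry Q \<Longrightarrow> e \<in> m' \<longleftrightarrow> e \<in> m"
  shows "alt s m' Q"
  using assms unfolding alt_def by blast

lemma packed_cong:
  assumes "packed m K" "\<And>q e. q \<in> K \<Longrightarrow> e \<in> sides q \<Longrightarrow> e \<in> m' \<longleftrightarrow> e \<in> m"
  shows "packed m' K"
proof -
  have "altc m' q" if "q \<in> K" for q
    by (rule altc_cong[of m]) (use assms that in \<open>auto simp: packed_def\<close>)
  then show ?thesis using assms(1) by (simp add: packed_def)
qed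

lemma sides_neighbours:
  assumes "e \<in> sides (x, y)" "e \<in> sides q" "q \<noteq> (x, y)"
  shows "q \<in> {(x + 1, y), (x - 1, y), (x, y + 1), (x, y - 1)}"
  using assms by (cases q) auto

lemma agree_trans: "agree Q m m' \<Longrightarrow> agree Q m' m'' \<Longrightarrow> agree Q m m''"
  by (simp add: agree_def)

lemma agree_mono: "agree Q' m m' \<Longrightarrow> Q' \<subseteq> Q \<Longrightarrow> agree Q m m'"
  unfolding agree_def by blast

lemma agree_flip: "Q' \<subseteq> Q \<Longrightarrow> agree Q m (sym_diff m (bdry Q'))"
  unfolding agree_def bdry_def by blast

lemma ex1_four:
  assumes "distinct [a, b, c, d]"
  shows "(\<exists>!e. e \<in> m \<and> e \<in> {a, b, c, d}) \<longleftrightarrow>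
    (a \<in> m \<or> b \<in> m \<or> c \<in> m \<or> d \<in> m) \<and> \<not> (a \<in> m \<and> b \<in> m) \<and> \<not> (a \<in> m \<and> c \<in> m) \<and>
    \<not> (a \<in> m \<and> d \<in> m) \<and> \<not> (b \<in> m \<and> c \<in> m) \<and> \<not> (b \<in> m \<and> d \<in> m) \<and> \<not> (c \<in> m \<and> d \<in> m)"
proof -
  have "(\<exists>!e. e \<in> m \<and> e \<in> {a, b, c, d}) \<longleftrightarrow> (\<exists>!e. e \<in> m \<inter> {a, b, c, d})" by simp
  also have "m \<inter> {a, b, c, d} = (if a \<in> m then {a} else {}) \<union> (if b \<in> m then {b} else {}) \<union>
      (if c \<in> m then {c} else {}) \<union> (if d \<in> m then {d} else {})" by auto
  also have "(\<exists>!e. e \<in> \<dots>) \<longleftrightarrow>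
    (a \<in> m \<or> b \<in> m \<or> c \<in> m \<or> d \<in> m) \<and> \<not> (a \<in> m \<and> b \<in> m) \<and> \<not> (a \<in> m \<and> c \<in> m) \<and>
    \<not> (a \<in> m \<and> d \<in> m) \<and> \<not> (b \<in> m \<and> c \<in> m) \<and> \<not> (b \<in> m \<and> d \<in> m) \<and> \<not> (c \<in> m \<and> d \<in> m)"
    using assms by (cases "a \<in> m"; cases "b \<in> m"; cases "c \<in> m"; cases "d \<in> m") auto
  finally show ?thesis .
qed

text \<open>Switching seen from a single vertex: \<open>a\<close>, \<open>b\<close>,
  \<open>c\<close>, \<open>d\<close> are its east, west, north and south edges, and
  \<open>q1\<close>, \<open>q2\<close>, \<open>q3\<close>, \<open>q4\<close> tell whether the
  north-east, north-west, south-east and south-west cells belong to the region. All 64 cases are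
  checked.\<close>

lemma flip_bool:
  assumes "(a \<or> b \<or> c \<or> d) \<and> \<not> (a \<and> b) \<and> \<not> (a \<and> c) \<and> \<not> (a \<and> d) \<and> \<not> (b \<and> c) \<and> \<not> (b \<and> d) \<and> \<not> (c \<and> d)"
    and "q1 \<noteq> q3 \<longrightarrow> a = ((ev \<and> q3 \<or> \<not> ev \<and> q1) = s)"
    and "q2 \<noteq> q4 \<longrightarrow> b = ((ev \<and> q2 \<or> \<not> ev \<and> q4) = s)"
    and "q1 \<noteq> q2 \<longrightarrow> c = ((ev \<and> q1 \<or> \<not> ev \<and> q2) = s)"
    and "q3 \<noteq> q4 \<longrightarrow> d = ((ev \<and> q4 \<or> \<not> ev \<and> q3) = s)"
    and "a' = (a \<noteq> (q1 \<noteq> q3))" "b' = (b \<noteq> (q2 \<noteq> q4))" "c' = (c \<noteq> (q1 \<noteq> q2))" "d' = (d \<noteq> (q3 \<noteq> q4))"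
  shows "(a' \<or> b' \<or> c' \<or> d') \<and> \<not> (a' \<and> b') \<and> \<not> (a' \<and> c') \<and> \<not> (a' \<and> d') \<and> \<not> (b' \<and> c') \<and> \<not> (b' \<and> d') \<and> \<not> (c' \<and> d')"
  by (insert assms, cases ev; cases s; cases q1; cases q2; cases q3; cases q4; simp)

locale lattice_graph =
  fixes Vt :: "cell set" and E :: "ledge set"
  assumes E_h: "(True, x, y) \<in> E \<Longrightarrow> (x, y) \<in> Vt \<and> (x + 1, y) \<in> Vt"
    and E_v: "(False, x, y) \<in> E \<Longrightarrow> (x, y) \<in> Vt \<and> (x, y + 1) \<in> Vt"
begin

definition pm :: "ledge set \<Rightarrow> bool" where
  "pm m \<longleftrightarrow> m \<subseteq> E \<and> (\<forall>v\<in>Vt. \<exists>!e. e \<in> m \<and> e \<in> star v)"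

definition Sq :: "cell set" where
  "Sq = {q. sides q \<subseteq> E}"

lemma star_Vt:
  assumes "e \<in> E" "e \<in> star v"
  shows "v \<in> Vt"
proof -
  obtain x y where v: "v = (x, y)" by (cases v)
  show ?thesis
    using assms E_h[of x y] E_h[of "x - 1" y] E_v[of x y] E_v[of x "y - 1"] unfolding v by auto
qed

lemma Sq_corners:
  assumes "(x, y) \<in> Sq"
  shows "(x, y) \<in> Vt" "(x + 1, y) \<in> Vt" "(x, y + 1) \<in> Vt" "(x + 1, y + 1) \<in> Vt"
  using assms E_h[of x y] E_h[of x "y + 1"] by (auto simp: Sq_def)

lemma pm_unique:
  assumes "pm m" "e \<in> m" "e' \<in> m" "e \<in> star v" "e' \<in> star v"
  shows "e = e'"
proof -
  have "v \<in> Vt" using assms star_Vt[of e v] by (auto simp: pm_def)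
  then show ?thesis using assms unfolding pm_def by blast
qed

lemma pm_cases:
  assumes "pm m" "(x, y) \<in> Vt"
  shows "(True, x, y) \<in> m \<or> (True, x - 1, y) \<in> m \<or> (False, x, y) \<in> m \<or> (False, x, y - 1) \<in> m"
proof -
  obtain e where "e \<in> m" "e \<in> star (x, y)" using assms unfolding pm_def by blast
  then show ?thesis by auto
qed

text \<open>A vertex meets the boundary in an even number of edges. Four of them would alternate in
  such a way that two are matched, which is impossible, so there are none or one matched and one
  unmatched edge. The boundary may consist of several cycles.\<close>

lemma pm_flip:
  assumes m: "pm m" and al: "alt s m Q" and "bdry Q \<subseteq> E"
  shows "pm (sym_diff m (bdry Q))"
  unfolding pm_def
proof (intro conjI ballI)
  show "sym_diff m (bdry Q) \<subseteq> E" using m assms(3) by (auto simp: pm_def)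
  fix v assume "v \<in> Vt"
  obtain x y where v: "v = (x, y)" by (cases v)
  have ex: "\<exists>!e. e \<in> m \<and> e \<in> star (x, y)" using m \<open>v \<in> Vt\<close> unfolding pm_def v by blast
  have d: "distinct [(True, x, y), (True, x - 1, y), (False, x, y), (False, x, y - 1)]" by simp
  note A = al[unfolded alt_def, rule_format]
  have p: "even (x - 1 + y) = odd (x + y)" "even (x + (y - 1)) = odd (x + y)" by presburger+
  have b: "(True, x, y) \<in> bdry Q \<longleftrightarrow> ((x, y) \<in> Q) \<noteq> ((x, y - 1) \<in> Q)"
    "(True, x - 1, y) \<in> bdry Q \<longleftrightarrow> ((x - 1, y) \<in> Q) \<noteq> ((x - 1, y - 1) \<in> Q)"
    "(False, x, y) \<in> bdry Q \<longleftrightarrow> ((x, y) \<in> Q) \<noteq> ((x - 1, y) \<in> Q)"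
    "(False, x, y - 1) \<in> bdry Q \<longleftrightarrow> ((x, y - 1) \<in> Q) \<noteq> ((x - 1, y - 1) \<in> Q)"
    by (simp_all add: bdry_def)
  have e: "e \<in> sym_diff m (bdry Q) \<longleftrightarrow> (e \<in> m) \<noteq> (e \<in> bdry Q)" for e by blast
  show "\<exists>!e. e \<in> sym_diff m (bdry Q) \<and> e \<in> star v"
    unfolding v star.simps ex1_four[OF d]
    unfolding e b
  proof (rule flip_bool[OF _ _ _ _ _ refl refl refl refl])
    show "((x, y) \<in> Q) \<noteq> ((x, y - 1) \<in> Q) \<longrightarrow> ((True, x, y) \<in> m) =
      ((even (x + y) \<and> (x, y - 1) \<in> Q \<or> \<not> even (x + y) \<and> (x, y) \<in> Q) = s)"
      using A[of "(True, x, y)"] unfolding b by simp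
    show "((x - 1, y) \<in> Q) \<noteq> ((x - 1, y - 1) \<in> Q) \<longrightarrow> ((True, x - 1, y) \<in> m) =
      ((even (x + y) \<and> (x - 1, y) \<in> Q \<or> \<not> even (x + y) \<and> (x - 1, y - 1) \<in> Q) = s)"
      using A[of "(True, x - 1, y)"] p unfolding b by simp
    show "((x, y) \<in> Q) \<noteq> ((x - 1, y) \<in> Q) \<longrightarrow> ((False, x, y) \<in> m) =
      ((even (x + y) \<and> (x, y) \<in> Q \<or> \<not> even (x + y) \<and> (x - 1, y) \<in> Q) = s)"
      using A[of "(False, x, y)"] unfolding b by simp
    show "((x, y - 1) \<in> Q) \<noteq> ((x - 1, y - 1) \<in> Q) \<longrightarrow> ((False, x, y - 1) \<in> m) =
      ((even (x + y) \<and> (x - 1, y - 1) \<in> Q \<or> \<not> even (x + y) \<and> (x, y - 1) \<in> Q) = s)"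
      using A[of "(False, x, y - 1)"] p unfolding b by simp
  qed (use ex[unfolded star.simps ex1_four[OF d]] in blast)
qed

end

section \<open>Gaining one alternating cell inside an alternating region\<close>

section \<open>Augmenting resonant sets\<close>

context lattice_graph
begin

definition admissible :: "ledge set \<Rightarrow> cell set \<Rightarrow> cell set \<Rightarrow> bool \<Rightarrow> bool" where
  "admissible m Q K s \<longleftrightarrow> pm m \<and> finite Q \<and> Q \<subseteq> Sq \<and> alt s m Q \<and> K \<subseteq> Q \<and> packed m K \<and>
     (\<forall>q\<in>K. sides q \<inter> bdry Q = {})"

text \<open>The cell lies on the uppermost diagonal \<open>y - x = d\<close> that meets the region.
  Its left and upper neighbours are outside, so the phase determines the status of its left and
  upper sides.\<close>

definition extreme :: "cell set \<Rightarrow> cell \<Rightarrow> bool" where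
  "extreme Q c \<longleftrightarrow> c \<in> Q \<and> (\<forall>q\<in>Q. snd q - fst q \<le> snd c - fst c)"

definition augmentable :: "ledge set \<Rightarrow> cell set \<Rightarrow> cell set \<Rightarrow> bool" where
  "augmentable m Q K \<longleftrightarrow> (\<exists>m' K'. pm m' \<and> K' \<subseteq> Q \<and> card K' = card K + 1 \<and> packed m' K' \<and> agree Q m m')"

lemma pm_excl:
  assumes "pm m"
  shows "(True, x, y) \<in> m \<Longrightarrow> (True, x - 1, y) \<notin> m" "(True, x, y) \<in> m \<Longrightarrow> (False, x, y) \<notin> m"
    "(True, x, y) \<in> m \<Longrightarrow> (False, x, y - 1) \<notin> m" "(True, x - 1, y) \<in> m \<Longrightarrow> (False, x, y) \<notin> m"
    "(True, x - 1, y) \<in> m \<Longrightarrow> (False, x, y - 1) \<notin> m" "(False, x, y) \<in> m \<Longrightarrow> (False, x, y - 1) \<notin> m"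
  using pm_unique[OF assms, of "(True, x, y)" "(True, x - 1, y)" "(x, y)"]
    pm_unique[OF assms, of "(True, x, y)" "(False, x, y)" "(x, y)"]
    pm_unique[OF assms, of "(True, x, y)" "(False, x, y - 1)" "(x, y)"]
    pm_unique[OF assms, of "(True, x - 1, y)" "(False, x, y)" "(x, y)"]
    pm_unique[OF assms, of "(True, x - 1, y)" "(False, x, y - 1)" "(x, y)"]
    pm_unique[OF assms, of "(False, x, y)" "(False, x, y - 1)" "(x, y)"]
  by auto

lemma altc_vertical:
  assumes "pm m" "(False, x, y) \<in> m" "(False, x + 1, y) \<in> m"
  shows "altc m (x, y)"
  unfolding altc_iff
  using assms pm_excl(2)[OF assms(1), of x y] pm_excl(3)[OF assms(1), of x "y + 1"] by auto

lemma altc_horizontal: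
  assumes "pm m" "(True, x, y) \<in> m" "(True, x, y + 1) \<in> m"
  shows "altc m (x, y)"
  unfolding altc_iff
  using assms pm_excl(2)[OF assms(1), of x y] pm_excl(4)[OF assms(1), of "x + 1" y] by auto

text \<open>Each corner of an alternating cell is already covered by one of its sides. This is
  mostly applied backwards: a cell with a matched edge leaving one of its corners is not in
  \<open>K\<close>.\<close>

lemma altc_corner:
  assumes "pm m" "altc m q" "e \<in> m" "e \<in> star v"
    and "v = q \<or> v = (fst q + 1, snd q) \<or> v = (fst q, snd q + 1) \<or> v = (fst q + 1, snd q + 1)"
  shows "e \<in> sides q"
proof -
  obtain x y where q: "q = (x, y)" by (cases q)
  have "\<exists>e'. e' \<in> m \<and> e' \<in> star v \<and> e' \<in> sides q"
  proof (cases "(False, x, y) \<in> m")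
    case True
    then have "(False, x + 1, y) \<in> m" using assms(2) by (simp add: q altc_iff)
    moreover have "(False, x, y) \<in> star v \<or> (False, x + 1, y) \<in> star v"
      using assms(5) by (auto simp: q)
    ultimately show ?thesis using True unfolding q sides.simps by blast
  next
    case False
    then have "(True, x, y) \<in> m" "(True, x, y + 1) \<in> m" using assms(2) by (simp_all add: q altc_iff)
    moreover have "(True, x, y) \<in> star v \<or> (True, x, y + 1) \<in> star v"
      using assms(5) by (auto simp: q)
    ultimately show ?thesis unfolding q sides.simps by blast
  qed
  then show ?thesis using pm_unique[OF assms(1,3) _ assms(4)] by blast
qed

lemma augmentable_agree: "augmentable m' Q K \<Longrightarrow> agree Q m m' \<Longrightarrow> augmentable m Q K"
  unfolding augmentable_def using agree_trans by blast

lemma augmentable_add: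
  assumes "pm m" "packed m K" "finite K" "K \<subseteq> Q" "(x, y) \<in> Q" "altc m (x, y)" "(x, y) \<notin> K"
    "(x + 1, y) \<notin> K" "(x - 1, y) \<notin> K" "(x, y + 1) \<notin> K" "(x, y - 1) \<notin> K"
  shows "augmentable m Q K"
proof -
  have disj: "sides (x, y) \<inter> sides q = {}" if "q \<in> K" for q
    using sides_neighbours[of _ x y q] that assms(7-) by blast
  have "packed m (insert (x, y) K)"
    unfolding packed_def
  proof (intro conjI ballI impI)
    show "altc m q" if "q \<in> insert (x, y) K" for q
      using that assms(2,6) by (auto simp: packed_def)
    show "sides q \<inter> sides q' = {}" if "q \<in> insert (x, y) K" "q' \<in> insert (x, y) K" "q \<noteq> q'" for q q'
      using that disj[of q] disj[of q'] assms(2) unfolding packed_def by blast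
  qed
  moreover have "card (insert (x, y) K) = card K + 1" using assms(3,7) by simp
  ultimately show ?thesis
    unfolding augmentable_def using assms(1,4,5)
    by (intro exI[of _ m] exI[of _ "insert (x, y) K"]) (auto simp: agree_def)
qed

lemma bdry_Sq: "Q \<subseteq> Sq \<Longrightarrow> bdry Q \<subseteq> E"
proof
  fix e assume e: "Q \<subseteq> Sq" "e \<in> bdry Q"
  obtain b x y where "e = (b, x, y)" by (cases e)
  then have "e \<in> sides (upc e)" "e \<in> sides (dnc e)" by (cases b; simp)+
  then show "e \<in> E" using e unfolding bdry_def Sq_def by blast
qed

lemma admissible_flip:
  assumes "admissible m Q K s"
  shows "admissible (sym_diff m (bdry Q)) Q K (\<not> s)"
proof -
  let ?m = "sym_diff m (bdry Q)"
  have "pm ?m" using assms pm_flip[of m s Q] bdry_Sq[of Q] unfolding admissible_def by blast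
  moreover have "alt (\<not> s) ?m Q" using assms alt_flip[of s m Q] unfolding admissible_def by blast
  moreover have "packed ?m K"
    by (rule packed_cong[of m]) (use assms in \<open>unfold admissible_def, blast+\<close>)
  ultimately show ?thesis using assms by (simp add: admissible_def)
qed

text \<open>The sides of a cell of \<open>K\<close> avoid the boundary of \<open>Q\<close> and the
  sides of the other cells of \<open>K\<close>, so switching it disturbs neither.\<close>

lemma admissible_flip_cell:
  assumes "admissible m Q K s" "c \<in> K"
  shows "admissible (sym_diff m (sides c)) Q K s"
proof -
  let ?m = "sym_diff m (sides c)"
  obtain s' where s': "alt s' m {c}" using assms by (auto simp: admissible_def packed_def altc_def)
  have c: "c \<in> Sq" using assms by (auto simp: admissible_def)
  have "pm ?m"
    using pm_flip[of m s' "{c}"] s' c assms(1) by (simp add: admissible_def bdry_single Sq_def)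
  moreover have "alt s ?m Q"
    by (rule alt_cong[of s m]) (use assms in \<open>unfold admissible_def, blast+\<close>)
  moreover have "packed ?m K"
    unfolding packed_def
  proof (intro conjI ballI)
    fix q assume q: "q \<in> K"
    show "altc ?m q"
    proof (cases "q = c")
      case True
      then show ?thesis using alt_flip[OF s'] by (auto simp: altc_def bdry_single)
    next
      case False
      then have "sides q \<inter> sides c = {}" using assms q by (auto simp: admissible_def packed_def)
      moreover have "altc m q" using assms q by (auto simp: admissible_def packed_def)
      ultimately show ?thesis by (elim altc_cong) blast
    qed
  qed (use assms in \<open>auto simp: admissible_def packed_def\<close>)
  ultimately show ?thesis using assms by (simp add: admissible_def)
qed

lemma agree_flip_cell: "c \<in> Q \<Longrightarrow> agree Q m (sym_diff m (sides c))"
  using agree_flip[of "{c}" Q m] by (simp add: bdry_single)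

lemma extreme_outside:
  assumes "extreme Q (x, y)"
  shows "(x - 1, y) \<notin> Q" "(x, y + 1) \<notin> Q" "(x, y) \<in> Q"
  using assms by (auto simp: extreme_def)

text \<open>The east, west and north neighbours of the vertex \<open>(a, b - 1)\<close> are covered
  by the three given edges, so this vertex is matched downwards. The cell \<open>(a, b - 2)\<close>
  has a corner that is matched upwards. Together this moves the hypothesis of
  \<open>augmentable_lower\<close> one cell down the diagonal.\<close>

lemma diagonal_step:
  assumes "pm m" "(a - 1, b - 1) \<in> Sq" "(False, a - 1, b - 1) \<in> m" "(False, a, b) \<in> m"
    "(False, a + 1, b - 1) \<in> m"
  shows "(False, a, b - 2) \<in> m" and "\<not> altc m (a, b - 2)"
proof -
  have "(a, b - 1) \<in> Vt" using Sq_corners(2)[OF assms(2)] by simp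
  moreover have "(True, a, b - 1) \<notin> m" using pm_excl(4)[OF assms(1), of "a + 1" "b - 1"] assms(5) by auto
  moreover have "(True, a - 1, b - 1) \<notin> m" using pm_excl(2)[OF assms(1), of "a - 1" "b - 1"] assms(3) by auto
  moreover have "(False, a, b - 1) \<notin> m" using pm_excl(6)[OF assms(1), of a b] assms(4) by auto
  ultimately show "(False, a, b - 2) \<in> m" using pm_cases[OF assms(1), of a "b - 1"] by auto
  show "\<not> altc m (a, b - 2)"
    using altc_corner[OF assms(1) _ assms(5), of "(a, b - 2)" "(a + 1, b - 1)"] by auto
qed

text \<open>The next two lemmas change \<open>m\<close> and \<open>K\<close> only near the diagonal \<open>y - x = d\<close> of extreme cells. In the
  first one, the hypothesis is carried down this diagonal until a cell with lower left neighbour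
  outside \<open>Q\<close> is reached.\<close>

lemma augmentable_lower:
  assumes S: "admissible m Q K s" and ex: "extreme Q (x, y)" and s: "s = even (x + y)"
    and e: "(False, x + 1, y - 1) \<in> m" and Y: "(x + 1, y - 1) \<notin> K"
  shows "augmentable m Q K"
proof -
  define d where "d = y - x"
  \<comment> \<open>The positions on the diagonal at which the hypothesis holds. At the least of
    them the descent stops.\<close>
  define A where "A = {a. (a, a + d) \<in> Q \<and> (False, a + 1, a + d - 1) \<in> m \<and> (a + 1, a + d - 1) \<notin> K}"
  have pm: "pm m" and finQ: "finite Q" and QS: "Q \<subseteq> Sq" and al: "alt s m Q" and KQ: "K \<subseteq> Q"
    and pk: "packed m K" and Kb: "\<And>q e. q \<in> K \<Longrightarrow> e \<in> sides q \<Longrightarrow> e \<notin> bdry Q"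
    using S unfolding admissible_def by blast+
  have "x \<in> A" using e Y ex by (simp add: A_def d_def extreme_def)
  moreover have "finite A"
    by (rule finite_surj[OF finQ, of _ fst]) (force simp: A_def)
  ultimately have A: "Min A \<in> A" and Amin: "\<And>a. a \<in> A \<Longrightarrow> Min A \<le> a" by (auto intro: Min_in)
  define a where "a = Min A"
  define b where "b = a + d"
  have aQ: "(a, b) \<in> Q" and D: "(False, a + 1, b - 1) \<in> m" and YK: "(a + 1, b - 1) \<notin> K"
    using A by (auto simp: a_def b_def A_def)
  have exa: "extreme Q (a, b)" using ex aQ by (simp add: extreme_def b_def d_def)
  note out = extreme_outside(1,2)[OF exa]
  have "even (a + b) \<longleftrightarrow> even (x + y)" unfolding b_def d_def by presburger
  with s have s': "s = even (a + b)" by simp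
  have left: "(False, a, b) \<in> m" using alt_sides(1)[OF al aQ out(1)] s' by simp
  have top: "(True, a, b + 1) \<notin> m" using alt_sides(4)[OF al aQ out(2)] s' by simp
  have topb: "(True, a, b + 1) \<in> bdry Q" using aQ out by (simp add: bdry_def)
  have XK: "(a, b) \<notin> K" using Kb[of "(a, b)" "(True, a, b + 1)"] topb by auto
  have bot: "(True, a, b) \<notin> m" using pm_excl(2)[OF pm, of a b] left by auto
  have Bl: "(False, a, b - 1) \<notin> m" using pm_excl(6)[OF pm, of a b] left by auto
  have out': "(a - 1, b - 1) \<notin> Q"
  proof
    assume XQ: "(a - 1, b - 1) \<in> Q"
    have exa': "extreme Q (a - 1, b - 1)" using exa XQ by (simp add: extreme_def)
    have l: "(False, a - 1, b - 1) \<in> m"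
      using alt_sides(1)[OF al XQ] extreme_outside(1)[OF exa'] s' by simp
    have sq: "(a - 1, b - 1) \<in> Sq" using XQ QS by blast
    have "(a, b - 2) \<notin> K" using diagonal_step(2)[OF pm sq l left D] pk unfolding packed_def by blast
    then have "a - 1 \<in> A" using diagonal_step(1)[OF pm sq l left D] XQ by (simp add: A_def b_def algebra_simps)
    then show False using Amin[of "a - 1"] by (simp add: a_def)
  qed
  \<comment> \<open>After switching along the boundary of \<open>Q\<close> the upper side of
    \<open>(a, b)\<close> is matched. Then \<open>(a, b)\<close> alternates if the cell below it is
    outside \<open>Q\<close>, and otherwise that lower cell alternates.\<close>
  define m2 where "m2 = sym_diff m (bdry Q)"
  have S2: "admissible m2 Q K (\<not> s)" unfolding m2_def by (rule admissible_flip[OF S])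
  have pm2: "pm m2" and pk2: "packed m2 K" using S2 by (simp_all add: admissible_def)
  have ag: "agree Q m m2" unfolding m2_def by (rule agree_flip) simp
  have finK: "finite K" using KQ finQ finite_subset by blast
  have notK: "q \<notin> K" if "e \<in> m2" "e \<notin> sides q" "e \<in> star v"
     "v = q \<or> v = (fst q + 1, snd q) \<or> v = (fst q, snd q + 1) \<or> v = (fst q + 1, snd q + 1)" for q e v
    using altc_corner[OF pm2 _ that(1,3,4)] that(2) pk2 unfolding packed_def by blast
  have "augmentable m2 Q K"
  proof (cases "(a, b - 1) \<in> Q")
    case False
    have t2: "(True, a, b + 1) \<in> m2" using top topb by (simp add: m2_def)
    have "(True, a, b) \<in> m2" using bot aQ False by (simp add: m2_def bdry_def)
    then have al2: "altc m2 (a, b)" using t2 altc_horizontal[OF pm2] by blast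
    have "(a + 1, b) \<notin> K" by (rule notK[OF t2, of _ "(a + 1, b + 1)"]) auto
    then show ?thesis
      using augmentable_add[OF pm2 pk2 finK KQ aQ al2 XK] out KQ False by blast
  next
    case True
    have lb: "(False, a, b - 1) \<in> bdry Q" using True out' by (simp add: bdry_def)
    then have l2: "(False, a, b - 1) \<in> m2" using Bl by (simp add: m2_def)
    have "(a + 1, b - 1) \<in> Q" using alt_sides(2)[OF al True] D s' by auto
    then have "(False, a + 1, b - 1) \<in> m2" using D True by (simp add: m2_def bdry_def)
    then have al2: "altc m2 (a, b - 1)" using l2 altc_vertical[OF pm2] by blast
    have BK: "(a, b - 1) \<notin> K" using Kb[of "(a, b - 1)" "(False, a, b - 1)"] lb by auto
    have "(a, b - 1 - 1) \<notin> K" by (rule notK[OF l2, of _ "(a, b - 1)"]) auto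
    then show ?thesis
      using augmentable_add[OF pm2 pk2 finK KQ True al2 BK YK] out' XK KQ by auto
  qed
  then show ?thesis using augmentable_agree ag by blast
qed

lemma augmentable_upper:
  assumes S: "admissible m Q K s" and ex: "extreme Q (x, y)" and s: "s = even (x + y)"
    and top: "(x + 1, y + 1) \<notin> Q" and Y: "(x + 1, y - 1) \<notin> K"
  shows "augmentable m Q K"
proof -
  have pm: "pm m" and finQ: "finite Q" and QS: "Q \<subseteq> Sq" and al: "alt s m Q" and KQ: "K \<subseteq> Q"
    and pk: "packed m K" and Kb: "\<And>q e. q \<in> K \<Longrightarrow> e \<in> sides q \<Longrightarrow> e \<notin> bdry Q"
    using S unfolding admissible_def by blast+
  have finK: "finite K" using KQ finQ finite_subset by blast
  note out = extreme_outside[OF ex]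
  have left: "(False, x, y) \<in> m" using alt_sides(1)[OF al out(3,1)] s by simp
  have XK: "(x, y) \<notin> K" using Kb[of "(x, y)" "(False, x, y)"] out by (auto simp: bdry_def)
  have notK: "q \<notin> K" if "e \<in> m" "e \<notin> sides q" "e \<in> star v"
     "v = q \<or> v = (fst q + 1, snd q) \<or> v = (fst q, snd q + 1) \<or> v = (fst q + 1, snd q + 1)" for q e v
    using altc_corner[OF pm _ that(1,3,4)] that(2) pk unfolding packed_def by blast
  show ?thesis
  proof (cases "(x + 1, y) \<in> Q")
    case False
    have "(False, x + 1, y) \<in> m" using alt_sides(2)[OF al out(3) False] s by simp
    then have alX: "altc m (x, y)" using altc_vertical[OF pm left] by blast
    have "(x, y - 1) \<notin> K" by (rule notK[OF left, of _ "(x, y)"]) auto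
    then show ?thesis using augmentable_add[OF pm pk finK KQ out(3) alX XK] out False KQ by blast
  next
    case True
    have topZ: "(True, x + 1, y + 1) \<in> m" using alt_sides(4)[OF al True top] s by auto
    have topb: "(True, x + 1, y + 1) \<in> bdry Q" using True top by (simp add: bdry_def)
    have ZK: "(x + 1, y) \<notin> K" using Kb[of "(x + 1, y)" "(True, x + 1, y + 1)"] topb by auto
    show ?thesis
    proof (cases "(True, x + 1, y) \<in> m")
      case bot: True
      have alZ: "altc m (x + 1, y)" using altc_horizontal[OF pm bot topZ] .
      have "(x + 1 + 1, y) \<notin> K" by (rule notK[OF topZ, of _ "(x + 2, y + 1)"]) auto
      then show ?thesis
        using augmentable_add[OF pm pk finK KQ True alZ ZK] XK top KQ Y by auto
    next
      case bot: False
      \<comment> \<open>The vertex \<open>(x + 1, y)\<close> has only its lower edge left to be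
        matched by, which is the hypothesis of the previous lemma.\<close>
      have "(x + 1, y) \<in> Vt" using Sq_corners(2)[of x y] out(3) QS by blast
      moreover have "(True, x, y) \<notin> m" using pm_excl(2)[OF pm, of x y] left by auto
      moreover have "(False, x + 1, y) \<notin> m"
        using pm_excl(3)[OF pm, of "x + 1" "y + 1"] topZ by auto
      ultimately have "(False, x + 1, y - 1) \<in> m" using bot pm_cases[OF pm, of "x + 1" y] by auto
      then show ?thesis using augmentable_lower[OF S ex s] Y by blast
    qed
  qed
qed

lemma exists_extreme:
  assumes "finite Q" "Q \<noteq> {}"
  shows "\<exists>x y. extreme Q (x, y) \<and> (x + 1, y + 1) \<notin> Q"
proof -
  define d where "d = Max ((\<lambda>q. snd q - fst q) ` Q)"
  have d: "snd q - fst q \<le> d" if "q \<in> Q" for q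
    unfolding d_def using assms that by (intro Max_ge) auto
  have "d \<in> (\<lambda>q. snd q - fst q) ` Q" unfolding d_def using assms by (intro Max_in) auto
  then obtain q where q: "q \<in> Q" "d = snd q - fst q" by blast
  define A where "A = {a. (a, a + d) \<in> Q}"
  have "fst q \<in> A" using q by (simp add: A_def)
  moreover have finA: "finite A" by (rule finite_surj[OF assms(1), of _ fst]) (force simp: A_def)
  ultimately have A: "Max A \<in> A" by (auto intro: Max_in)
  have "Max A + 1 \<notin> A" using Max_ge[OF finA, of "Max A + 1"] by auto
  then have "extreme Q (Max A, Max A + d)" "(Max A + 1, Max A + d + 1) \<notin> Q"
    using A d by (auto simp: extreme_def A_def add_ac)
  then show ?thesis by blast
qed

text \<open>If the topmost extreme cell \<open>(x, y)\<close> has its lower right diagonal neighbour in \<open>K\<close> and none of the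
  previous constructions applies, then the block of four cells with these two as corners is removed
  from \<open>Q\<close> and the induction hypothesis is used.\<close>

theorem region_augmentable:
  "admissible m Q K s \<Longrightarrow> Q \<noteq> {} \<Longrightarrow> augmentable m Q K"
proof (induction "card Q" arbitrary: m Q K s rule: less_induct)
  case less
  have [simp]: "a + 1 + 1 = a + 2" "a + 2 - 1 = a + 1" "a - 1 - 1 = a - 2" "a - 2 + 1 = a - 1" "2 + a = a + 2" "1 + a = a + 1"
    for a :: int by simp_all
  obtain x y where ex: "extreme Q (x, y)" and top: "(x + 1, y + 1) \<notin> Q"
    using exists_extreme[of Q] less.prems unfolding admissible_def by blast
  \<comment> \<open>The phase may be prescribed, since switching along the boundary of
    \<open>Q\<close> reverses it.\<close>
  have main: "augmentable m Q K" if S: "admissible m Q K s" and s: "s = even (x + y)" for m s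
  proof (cases "(x + 1, y - 1) \<in> K")
    case False
    then show ?thesis by (rule augmentable_upper[OF S ex s top])
  next
    case YK: True
    have finQ: "finite Q" and QS: "Q \<subseteq> Sq" and KQ: "K \<subseteq> Q"
      using S unfolding admissible_def by blast+
    have Kb: "e \<notin> bdry Q" if "q \<in> K" "e \<in> sides q" for q e
      using S that unfolding admissible_def by blast
    have YQ: "(x + 1, y - 1) \<in> Q" using YK KQ by blast
    define flipY where "flipY m = sym_diff m (sides (x + 1, y - 1))" for m :: "ledge set"
    define vert where "vert m \<longleftrightarrow> (False, x + 1, y - 1) \<in> m" for m :: "ledge set"
    have flip: "vert (flipY m) \<longleftrightarrow> \<not> vert m" for m
      by (auto simp: vert_def flipY_def)
    \<comment> \<open>The cell \<open>(x + 1, y - 1)\<close> belongs to \<open>K\<close>, so either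
      pair of its opposite sides can be made the matched one.\<close>
    have phase: "\<exists>m'. admissible m' Q K s \<and> vert m' = v \<and> agree Q m m' \<and>
        (\<forall>e. e \<notin> sides (x + 1, y - 1) \<longrightarrow> (e \<in> m' \<longleftrightarrow> e \<in> m))" for v
    proof (cases "vert m = v")
      case True
      then show ?thesis using S by (intro exI[of _ m]) (simp add: agree_def)
    next
      case False
      then show ?thesis
        using admissible_flip_cell[OF S YK] agree_flip_cell[OF YQ, of m] flip[of m]
        by (intro exI[of _ "flipY m"]) (auto simp: flipY_def)
    qed
    show ?thesis
    proof (cases "(x - 1, y - 1) \<in> Q")
      case XQ: True
      \<comment> \<open>With the vertical sides matched, \<open>diagonal_step\<close> supplies the
        hypothesis of \<open>augmentable_lower\<close> at the next extreme cell down the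
        diagonal.\<close>
      obtain m3 where S3: "admissible m3 Q K s" and v3: "vert m3" and ag: "agree Q m m3"
        using phase[of True] by blast
      have pm: "pm m3" and al: "alt s m3 Q" and pk: "packed m3 K"
        using S3 unfolding admissible_def by blast+
      have ex': "extreme Q (x - 1, y - 1)" using ex XQ by (simp add: extreme_def)
      have s': "s = even (x - 1 + (y - 1))" using s by auto
      have l: "(False, x - 1, y - 1) \<in> m3" using alt_sides(1)[OF al XQ] extreme_outside(1)[OF ex'] s' by simp
      have l2: "(False, x, y) \<in> m3" using alt_sides(1)[OF al] extreme_outside[OF ex] s by simp
      have sq: "(x - 1, y - 1) \<in> Sq" using XQ QS by blast
      note st = diagonal_step[OF pm sq l l2 v3[unfolded vert_def]]
      have "(x, y - 2) \<notin> K" using st(2) pk unfolding packed_def by blast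
      then have "augmentable m3 Q K" using augmentable_lower[OF S3 ex' s'] st(1) by simp
      then show ?thesis using ag augmentable_agree by blast
    next
      case XQ: False
      obtain m4 where S4: "admissible m4 Q K s" and v4: "\<not> vert m4" and ag4: "agree Q m m4"
        using phase[of False] by blast
      have pm4: "pm m4" and al4: "alt s m4 Q" and pk4: "packed m4 K"
        using S4 unfolding admissible_def by blast+
      note out = extreme_outside[OF ex]
      have "(True, x + 1, y) \<notin> bdry Q" "(False, x + 1, y - 1) \<notin> bdry Q" "(False, x + 2, y - 1) \<notin> bdry Q"
        using Kb[OF YK] by auto
      then have ZQ: "(x + 1, y) \<in> Q" and BQ: "(x, y - 1) \<in> Q" and Y2Q: "(x + 2, y - 1) \<in> Q"
        using YQ by (auto simp: bdry_def)
      have "altc m4 (x + 1, y - 1)" using pk4 YK by (simp add: packed_def)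
      then have Y4: "(False, x + 1, y - 1) \<notin> m4" "(False, x + 2, y - 1) \<notin> m4"
         "(True, x + 1, y - 1) \<in> m4" "(True, x + 1, y) \<in> m4"
        using v4 by (auto simp: altc_iff vert_def)
      have left4: "(False, x, y) \<in> m4" using alt_sides(1)[OF al4 out(3,1)] s by simp
      have topZ: "(True, x + 1, y + 1) \<in> m4" using alt_sides(4)[OF al4 ZQ top] s by auto
      have topb: "(True, x + 1, y + 1) \<in> bdry Q" using ZQ top by (simp add: bdry_def)
      have XK: "(x, y) \<notin> K" using Kb[of "(x, y)" "(False, x, y)"] out by (auto simp: bdry_def)
      have ZK: "(x + 1, y) \<notin> K" using Kb[of "(x + 1, y)" "(True, x + 1, y + 1)"] topb by auto
      have leftB: "(False, x, y - 1) \<in> bdry Q" using BQ XQ by (simp add: bdry_def)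
      have BK: "(x, y - 1) \<notin> K" using Kb[of "(x, y - 1)" "(False, x, y - 1)"] leftB by auto
      \<comment> \<open>With the horizontal sides of \<open>(x + 1, y - 1)\<close> matched, the cell
        above shares a matched edge with it and has a matched upper side as well.\<close>
      have altZ: "altc m4 (x + 1, y)" using altc_horizontal[OF pm4 Y4(4) topZ] .
      then obtain sZ where sZ: "alt sZ m4 {(x + 1, y)}" by (auto simp: altc_def)
      have Z4: "(False, x + 1, y) \<notin> m4" "(False, x + 2, y) \<notin> m4"
        using altZ Y4(4) by (auto simp: altc_iff)
      \<comment> \<open>Switching this cell to its vertical sides serves two purposes: its right
        side fits the phase on the new boundary, and its left side later makes \<open>(x, y)\<close>
        alternate.\<close>
      define m5 where "m5 = sym_diff m4 (sides (x + 1, y))"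
      have pm5: "pm m5"
        using pm_flip[OF pm4 sZ] ZQ QS by (auto simp: m5_def bdry_single Sq_def)
      have same5: "e \<in> m5 \<longleftrightarrow> e \<in> m4" if "e \<notin> sides (x + 1, y)" for e
        using that unfolding m5_def by blast
      have R5: "(False, x + 2, y) \<in> m5" "(False, x + 1, y) \<in> m5"
        using Z4 by (auto simp: m5_def)
      define C where "C = {(x, y), (x + 1, y), (x, y - 1), (x + 1, y - 1)}"
      define Q' where "Q' = Q - C"
      define K' where "K' = K - {(x + 1, y - 1)}"
      have CQ: "C \<subseteq> Q" using out ZQ BQ YQ by (simp add: C_def)
      \<comment> \<open>New boundary edges arise only to the right of the block and below it,
        because the cells to its left and above are outside \<open>Q\<close>.\<close>
      have bdry': "e \<in> bdry Q \<and> e \<notin> sides (x + 1, y) \<and> upc e \<notin> C \<and> dnc e \<notin> C \<or>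
          e = (False, x + 2, y - 1) \<and> (x + 2, y - 1) \<in> Q' \<or> e = (True, x + 1, y - 1) \<and> (x + 1, y - 2) \<in> Q' \<or>
          e = (False, x + 2, y) \<and> (x + 2, y) \<in> Q' \<or> e = (True, x, y - 1) \<and> (x, y - 2) \<in> Q'"
        if "e \<in> bdry Q'" for e
      proof -
        obtain b i j where e: "e = (b, i, j)" by (cases e)
        consider "upc e \<in> Q'" "dnc e \<notin> Q'" | "upc e \<notin> Q'" "dnc e \<in> Q'"
          using \<open>e \<in> bdry Q'\<close> unfolding bdry_def by blast
        then show ?thesis
        proof cases
          case 1
          show ?thesis
          proof (cases "dnc e \<in> C")
            case True
            then show ?thesis using 1 out top XQ by (cases b) (auto simp: e C_def Q'_def)
          next
            case False
            then have "dnc e \<notin> Q" "upc e \<in> Q" "upc e \<notin> C" using 1 by (auto simp: Q'_def)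
            then show ?thesis using False by (cases b) (auto simp: e bdry_def C_def)
          qed
        next
          case 2
          show ?thesis
          proof (cases "upc e \<in> C")
            case True
            then show ?thesis using 2 out top XQ by (cases b) (auto simp: e C_def Q'_def)
          next
            case False
            then have "upc e \<notin> Q" "dnc e \<in> Q" "dnc e \<notin> C" using 2 by (auto simp: Q'_def)
            then show ?thesis using False by (cases b) (auto simp: e bdry_def C_def)
          qed
        qed
      qed
      have ev: "even (x + 2 + (y - 1)) \<longleftrightarrow> \<not> s" "even (x + 1 + (y - 1)) \<longleftrightarrow> s" "even (x + 2 + y) \<longleftrightarrow> s"
          "even (x + (y - 1)) \<longleftrightarrow> \<not> s"
        unfolding s by presburger+
      have B4: "(True, x, y - 1) \<notin> m4"
        using pm_excl(1)[OF pm4, of "x + 1" "y - 1"] Y4(3) by auto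
      have al5: "alt s m5 Q'"
        unfolding alt_def
      proof
        fix e assume "e \<in> bdry Q'"
        from bdry'[OF this] show "e \<in> m5 \<longleftrightarrow> (rgt e \<in> Q' \<longleftrightarrow> s)"
        proof (elim disjE conjE)
          assume e: "e \<in> bdry Q" "e \<notin> sides (x + 1, y)" "upc e \<notin> C" "dnc e \<notin> C"
          have "rgt e = upc e \<or> rgt e = dnc e" by (cases e) simp
          then have "rgt e \<in> Q' \<longleftrightarrow> rgt e \<in> Q" using e by (auto simp: Q'_def)
          then show ?thesis using al4 e same5[of e] by (simp add: alt_def)
        next
          assume e: "e = (False, x + 2, y - 1)" "(x + 2, y - 1) \<in> Q'"
          have "(x + 1, y - 1) \<notin> Q'" by (simp add: Q'_def C_def)
          then show ?thesis using e Y4 same5[of e] ev by simp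
        next
          assume e: "e = (True, x + 1, y - 1)" "(x + 1, y - 2) \<in> Q'"
          have "(x + 1, y - 1) \<notin> Q'" by (simp add: Q'_def C_def)
          then show ?thesis using e Y4 same5[of e] ev by simp
        next
          assume e: "e = (False, x + 2, y)" "(x + 2, y) \<in> Q'"
          have "(x + 1, y) \<notin> Q'" by (simp add: Q'_def C_def)
          then show ?thesis using e R5 ev by simp
        next
          assume e: "e = (True, x, y - 1)" "(x, y - 2) \<in> Q'"
          have "(x, y - 1) \<notin> Q'" by (simp add: Q'_def C_def)
          then show ?thesis using e B4 same5[of e] ev by simp
        qed
      qed
      have notK: "q \<notin> K" if "pm m'" "packed m' K" "e \<in> m'" "e \<notin> sides q" "e \<in> star v"
         "v = q \<or> v = (fst q + 1, snd q) \<or> v = (fst q, snd q + 1) \<or> v = (fst q + 1, snd q + 1)" for q e v m'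
        using altc_corner[OF that(1) _ that(3,5,6)] that(2,4) unfolding packed_def by blast
      have RK: "(x + 2, y) \<notin> K"
        by (rule notK[OF pm4 pk4 topZ, of _ "(x + 2, y + 1)"]) auto
      \<comment> \<open>\<open>K\<close> stays resonant when \<open>Q\<close> is switched. Then the
        left side of the cell \<open>(x, y - 1)\<close> is matched, and it leaves the corner
        \<open>(x, y - 1)\<close> of the cell in question.\<close>
      have B2K: "(x, y - 2) \<notin> K"
      proof -
        have S2: "admissible (sym_diff m4 (bdry Q)) Q K (\<not> s)" by (rule admissible_flip[OF S4])
        have "(False, x, y - 1) \<notin> m4" using pm_excl(6)[OF pm4, of x y] left4 by auto
        then have "(False, x, y - 1) \<in> sym_diff m4 (bdry Q)" using leftB by blast
        then show ?thesis
          using notK[of "sym_diff m4 (bdry Q)" "(False, x, y - 1)" "(x, y - 2)" "(x, y - 1)"] S2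
          unfolding admissible_def by auto
      qed
      have K'Z: "e \<notin> sides (x + 1, y)" if "q \<in> K'" "e \<in> sides q" for q e
      proof
        assume e: "e \<in> sides (x + 1, y)"
        have "q \<noteq> (x + 1, y)" using that ZK by (auto simp: K'_def)
        then have "q \<in> {(x + 1 + 1, y), (x + 1 - 1, y), (x + 1, y + 1), (x + 1, y - 1)}"
          using sides_neighbours[OF e] that(2) by blast
        then show False using that(1) RK XK top KQ by (auto simp: K'_def)
      qed
      have K'Y: "e \<notin> sides (x + 1, y - 1)" if "q \<in> K'" "e \<in> sides q" for q e
        using pk4 that YK unfolding packed_def K'_def by blast
      have pk5: "packed m5 K'"
      proof (rule packed_cong[of m4])
        show "packed m4 K'" using pk4 by (auto simp: packed_def K'_def)
        show "\<And>q e. q \<in> K' \<Longrightarrow> e \<in> sides q \<Longrightarrow> e \<in> m5 \<longleftrightarrow> e \<in> m4" using same5 K'Z by blast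
      qed
      have "sides q \<inter> bdry Q' = {}" if q: "q \<in> K'" for q
      proof (rule ccontr)
        assume "sides q \<inter> bdry Q' \<noteq> {}"
        then obtain e where e: "e \<in> sides q" "e \<in> bdry Q'" by blast
        from bdry'[OF e(2)] show False
        proof (elim disjE conjE)
          assume "e \<in> bdry Q" then show False using Kb[OF _ e(1)] q unfolding K'_def by blast
        next
          assume "e = (False, x + 2, y - 1)" then show False using K'Y[OF q e(1)] by simp
        next
          assume "e = (True, x + 1, y - 1)" then show False using K'Y[OF q e(1)] by simp
        next
          assume "e = (False, x + 2, y)" then show False using K'Z[OF q e(1)] by simp
        next
          assume "e = (True, x, y - 1)"
          then have "q = (x, y - 1) \<or> q = (x, y - 2)" using e(1) by (cases q) auto
          then show False using q BK B2K by (auto simp: K'_def)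
        qed
      qed
      moreover have "K' \<subseteq> Q'" using KQ XK ZK BK by (auto simp: K'_def Q'_def C_def)
      moreover have "finite Q'" "Q' \<subseteq> Sq" using finQ QS by (auto simp: Q'_def)
      ultimately have S5: "admissible m5 Q' K' s"
        using pm5 al5 pk5 unfolding admissible_def by blast
      have "Q' \<noteq> {}" using Y2Q by (auto simp: Q'_def C_def)
      moreover have "card Q' < card Q"
        using finQ CQ by (intro psubset_card_mono) (auto simp: Q'_def C_def)
      ultimately have "augmentable m5 Q' K'" using less.hyps S5 by blast
      then obtain m6 K6 where pm6: "pm m6" and K6: "K6 \<subseteq> Q'" "card K6 = card K' + 1" "packed m6 K6"
        and ag6: "agree Q' m5 m6" unfolding augmentable_def by blast
      have finK6: "finite K6" using K6 \<open>finite Q'\<close> finite_subset by blast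
      have "card K6 = card K"
        using K6(2) card_Suc_Diff1[OF finite_subset[OF KQ finQ] YK] unfolding K'_def by linarith
      \<comment> \<open>The induction hypothesis makes up for the cell removed from
        \<open>K\<close>. The additional cell is \<open>(x, y)\<close>: its vertical sides bound no
        cell of \<open>Q'\<close> and are still matched.\<close>
      moreover have "(False, x, y) \<in> m6 \<and> (False, x + 1, y) \<in> m6"
      proof -
        have "(False, x, y) \<in> m5" using left4 same5[of "(False, x, y)"] by auto
        then show ?thesis using ag6 R5(2) out(1) unfolding agree_def
          by (auto simp: Q'_def C_def)
      qed
      then have "altc m6 (x, y)" using altc_vertical[OF pm6] by blast
      moreover have "c \<notin> K6" if "c \<in> C \<or> c \<notin> Q" for c using that K6(1) by (auto simp: Q'_def)
      then have "(x, y) \<notin> K6" "(x + 1, y) \<notin> K6" "(x - 1, y) \<notin> K6" "(x, y + 1) \<notin> K6" "(x, y - 1) \<notin> K6"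
        using out by (auto simp: C_def)
      moreover have "K6 \<subseteq> Q" using K6(1) by (auto simp: Q'_def)
      ultimately have "augmentable m6 Q K6" and cK: "card K6 = card K"
        using augmentable_add[OF pm6 K6(3) finK6 _ out(3)] by blast+
      moreover have "agree Q m4 m5" unfolding m5_def by (rule agree_flip_cell[OF ZQ])
      moreover have "agree Q m5 m6" using agree_mono[OF ag6] by (auto simp: Q'_def)
      ultimately have "augmentable m Q K6" using ag4 augmentable_agree by blast
      then show ?thesis using cK by (simp add: augmentable_def)
    qed
  qed
  show ?case
  proof (cases "s = even (x + y)")
    case True
    then show ?thesis using main less.prems by blast
  next
    case False
    then have "augmentable (sym_diff m (bdry Q)) Q K"
      using main[OF admissible_flip[OF less.prems(1)]] by blast
    then show ?thesis using augmentable_agree agree_flip by blast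
  qed
qed

end

section \<open>Bounded faces and finite sets of cells\<close>

section \<open>Faces of polyomino graphs\<close>

fun ends :: "ledge \<Rightarrow> cell set" where
  "ends (b, x, y) = (if b then {(x, y), (x + 1, y)} else {(x, y), (x, y + 1)})"

lemma adjacent_imp_ends:
  assumes "grid_adjacent u v"
  shows "\<exists>e. {u, v} = ends e"
proof -
  obtain a b c d where uv: "u = (a, b)" "v = (c, d)" by (cases u, cases v)
  have "\<bar>a - c\<bar> + \<bar>b - d\<bar> = 1" using assms by (simp add: grid_adjacent_def uv)
  then consider "b = d" "c = a + 1" | "b = d" "a = c + 1" | "a = c" "d = b + 1" | "a = c" "b = d + 1"
    by linarith
  then show ?thesis
  proof cases
    case 1 then show ?thesis by (intro exI[of _ "(True, a, b)"]) (simp add: uv)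
  next
    case 2 then show ?thesis by (intro exI[of _ "(True, c, b)"]) (auto simp: uv)
  next
    case 3 then show ?thesis by (intro exI[of _ "(False, a, b)"]) (simp add: uv)
  next
    case 4 then show ?thesis by (intro exI[of _ "(False, a, d)"]) (auto simp: uv)
  qed
qed

lemma hull_edge:
  fixes x y :: int
  shows "convex hull (grid_point ` ends (True, x, y)) = {real_of_int x..real_of_int x + 1} \<times> {real_of_int y}"
    and "convex hull (grid_point ` ends (False, x, y)) = {real_of_int x} \<times> {real_of_int y..real_of_int y + 1}"
proof -
  have "convex hull (grid_point ` ends (True, x, y)) = closed_segment (real_of_int x, real_of_int y) (real_of_int x + 1, real_of_int y)"
    by (simp add: segment_convex_hull grid_point_def)
  also have "\<dots> = {real_of_int x..real_of_int x + 1} \<times> {real_of_int y}"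
  proof (intro equalityI subsetI)
    fix p assume "p \<in> {real_of_int x..real_of_int x + 1} \<times> {real_of_int y}"
    then obtain u where "p = (u, real_of_int y)" "real_of_int x \<le> u" "u \<le> real_of_int x + 1" by auto
    then show "p \<in> closed_segment (real_of_int x, real_of_int y) (real_of_int x + 1, real_of_int y)"
      by (auto simp: closed_segment_def algebra_simps intro!: exI[of _ "u - real_of_int x"])
  qed (auto simp: closed_segment_def algebra_simps)
  finally show "convex hull (grid_point ` ends (True, x, y)) = {real_of_int x..real_of_int x + 1} \<times> {real_of_int y}" .
  have "convex hull (grid_point ` ends (False, x, y)) = closed_segment (real_of_int x, real_of_int y) (real_of_int x, real_of_int y + 1)"
    by (simp add: segment_convex_hull grid_point_def)
  also have "\<dots> = {real_of_int x} \<times> {real_of_int y..real_of_int y + 1}"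
  proof (intro equalityI subsetI)
    fix p assume "p \<in> {real_of_int x} \<times> {real_of_int y..real_of_int y + 1}"
    then obtain u where "p = (real_of_int x, u)" "real_of_int y \<le> u" "u \<le> real_of_int y + 1" by auto
    then show "p \<in> closed_segment (real_of_int x, real_of_int y) (real_of_int x, real_of_int y + 1)"
      by (auto simp: closed_segment_def algebra_simps intro!: exI[of _ "u - real_of_int y"])
  qed (auto simp: closed_segment_def algebra_simps)
  finally show "convex hull (grid_point ` ends (False, x, y)) = {real_of_int x} \<times> {real_of_int y..real_of_int y + 1}" .
qed

fun closed_cell :: "cell \<Rightarrow> (real \<times> real) set" where
  "closed_cell (x, y) = {real_of_int x..real_of_int x + 1} \<times> {real_of_int y..real_of_int y + 1}"

fun open_cell :: "cell \<Rightarrow> (real \<times> real) set" where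
  "open_cell (x, y) = {real_of_int x<..<real_of_int x + 1} \<times> {real_of_int y<..<real_of_int y + 1}"

lemma closed_cell_cbox: "closed_cell (x, y) = cbox (real_of_int x, real_of_int y) (real_of_int x + 1, real_of_int y + 1)"
  by (auto simp: cbox_Pair_eq)

lemma open_cell_box: "open_cell (x, y) = box (real_of_int x, real_of_int y) (real_of_int x + 1, real_of_int y + 1)"
  by (simp add: box_prod)

lemma frontier_closed_cell: "frontier (closed_cell q) = closed_cell q - open_cell q"
  by (cases q) (simp only: closed_cell_cbox open_cell_box frontier_cbox)

lemma square_edges_ends: "square_edges q = ends ` sides q"
  by (cases q) (simp add: insert_commute)

lemma drawn_square: "drawn_edges (square_edges q) = closed_cell q - open_cell q"
proof -
  obtain x y where q: "q = (x, y)" by (cases q)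
  have "drawn_edges (square_edges q) = (\<Union>e\<in>sides q. convex hull (grid_point ` ends e))"
    by (simp add: drawn_edges_def square_edges_ends)
  also have "\<dots> = closed_cell q - open_cell q"
    unfolding q sides.simps by (simp only: UN_insert UN_empty hull_edge of_int_add of_int_1) auto
  finally show ?thesis .
qed

lemma half_not_int: "real_of_int i \<noteq> real_of_int j + 1/2"
proof
  assume "real_of_int i = real_of_int j + 1/2"
  then have "real_of_int (2 * i) = real_of_int (2 * j + 1)" by simp
  then have "2 * i = 2 * j + 1" by linarith
  then show False by presburger
qed

lemma half_between:
  assumes "real_of_int i \<le> real_of_int j + 1/2" "real_of_int j + 1/2 \<le> real_of_int i + 1"
  shows "i = j"
  using assms half_not_int[of i j] half_not_int[of "i + 1" j] by linarith

text \<open>One coordinate of the fact that a sufficiently small box around a point only meets cells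
  containing that point.\<close>

lemma floor_near:
  fixes u r :: real
  assumes "real_of_int (\<lceil>u\<rceil> - 1) < r" "r < real_of_int (\<lfloor>u\<rfloor> + 1)"
  shows "real_of_int \<lfloor>r\<rfloor> \<le> u \<and> u \<le> real_of_int \<lfloor>r\<rfloor> + 1"
proof -
  have "\<lfloor>r\<rfloor> < \<lfloor>u\<rfloor> + 1" using assms(2) by (simp only: floor_less_iff)
  then have 1: "real_of_int \<lfloor>r\<rfloor> \<le> real_of_int \<lfloor>u\<rfloor>" by simp
  have "\<lceil>u\<rceil> - 1 \<le> \<lfloor>r\<rfloor>" using assms(1) by (simp only: le_floor_iff less_imp_le)
  then have "\<lceil>u\<rceil> \<le> \<lfloor>r\<rfloor> + 1" by simp
  then have 2: "real_of_int \<lceil>u\<rceil> \<le> real_of_int \<lfloor>r\<rfloor> + 1" by (metis of_int_1 of_int_add of_int_le_iff)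
  show ?thesis using 1 2 floor_correct[of u] ceiling_correct[of u] by linarith
qed

text \<open>The midpoint of an edge lies on no other lattice edge. So the drawing, as a set of
  points, determines which edges have been drawn.\<close>

lemma midpoint_edge:
  assumes "convex hull (grid_point ` ends e) \<subseteq> D"
  shows "\<exists>p \<in> D. p \<notin> range grid_point \<and> (\<forall>e'. p \<in> convex hull (grid_point ` ends e') \<longrightarrow> e' = e)"
proof -
  obtain b x y where e: "e = (b, x, y)" by (cases e)
  show ?thesis
  proof (cases b)
    case True
    let ?p = "(real_of_int x + 1/2, real_of_int y)"
    have "?p \<in> D" using assms True unfolding e by (auto simp: hull_edge simp del: ends.simps)
    moreover have "?p \<notin> range grid_point" using half_not_int by (auto simp: grid_point_def) metis
    moreover have "e' = e" if "?p \<in> convex hull (grid_point ` ends e')" for e'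
    proof -
      obtain b' x' y' where e': "e' = (b', x', y')" by (cases e')
      show ?thesis using that True half_not_int[of x' x] half_between[of x' x]
        by (cases b') (auto simp: e e' hull_edge simp del: ends.simps)
    qed
    ultimately show ?thesis by blast
  next
    case False
    let ?p = "(real_of_int x, real_of_int y + 1/2)"
    have "?p \<in> D" using assms False unfolding e by (auto simp: hull_edge simp del: ends.simps)
    moreover have "?p \<notin> range grid_point" using half_not_int by (auto simp: grid_point_def) metis
    moreover have "e' = e" if "?p \<in> convex hull (grid_point ` ends e')" for e'
    proof -
      obtain b' x' y' where e': "e' = (b', x', y')" by (cases e')
      show ?thesis using that False half_not_int[of y' y] half_between[of y' y]
        by (cases b') (auto simp: e e' hull_edge simp del: ends.simps)
    qed
    ultimately show ?thesis by blast
  qed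
qed

text \<open>Going round \<open>p\<close> from cell to cell one never leaves \<open>Q\<close>, since
  no edge through \<open>p\<close> separates it. So all cells that contain \<open>p\<close> are in
  \<open>Q\<close>, and together they cover a neighbourhood of \<open>p\<close>.\<close>

lemma interior_cells:
  assumes p: "p \<in> closed_cell q" "q \<in> Q"
    and h: "\<And>e. p \<in> convex hull (grid_point ` ends e) \<Longrightarrow> upc e \<in> Q \<longleftrightarrow> dnc e \<in> Q"
  shows "p \<in> interior (\<Union>q\<in>Q. closed_cell q)"
proof -
  obtain u v where uv: "p = (u, v)" by (cases p)
  have hor: "(a, b) \<in> Q \<longleftrightarrow> (a', b) \<in> Q" if "p \<in> closed_cell (a, b)" "p \<in> closed_cell (a', b)" for a a' b
  proof -
    have step: "(a + 1, b) \<in> Q \<longleftrightarrow> (a, b) \<in> Q"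
      if "p \<in> closed_cell (a, b)" "p \<in> closed_cell (a + 1, b)" for a
    proof -
      have "p \<in> convex hull (grid_point ` ends (False, a + 1, b))"
        using that unfolding hull_edge by (auto simp: uv)
      then show ?thesis using h[of "(False, a + 1, b)"] by simp
    qed
    have "a = a' \<or> a' = a + 1 \<or> a = a' + 1" using that by (auto simp: uv)
    then show ?thesis using step[of a] step[of a'] that by auto
  qed
  have ver: "(a, b) \<in> Q \<longleftrightarrow> (a, b') \<in> Q" if "p \<in> closed_cell (a, b)" "p \<in> closed_cell (a, b')" for a b b'
  proof -
    have step: "(a, b + 1) \<in> Q \<longleftrightarrow> (a, b) \<in> Q"
      if "p \<in> closed_cell (a, b)" "p \<in> closed_cell (a, b + 1)" for b
    proof -
      have "p \<in> convex hull (grid_point ` ends (True, a, b + 1))"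
        using that unfolding hull_edge by (auto simp: uv)
      then show ?thesis using h[of "(True, a, b + 1)"] by simp
    qed
    have "b = b' \<or> b' = b + 1 \<or> b = b' + 1" using that by (auto simp: uv)
    then show ?thesis using step[of b] step[of b'] that by auto
  qed
  have all: "q' \<in> Q" if "p \<in> closed_cell q'" for q'
  proof -
    obtain a b a' b' where qq: "q = (a, b)" "q' = (a', b')" by (cases q, cases q')
    have "p \<in> closed_cell (a', b)" using that p(1) by (auto simp: qq uv)
    then show ?thesis using hor[of a b a'] ver[of a' b b'] p that by (simp add: qq)
  qed
  define N where "N = {real_of_int (\<lceil>u\<rceil> - 1)<..<real_of_int (\<lfloor>u\<rfloor> + 1)} \<times> {real_of_int (\<lceil>v\<rceil> - 1)<..<real_of_int (\<lfloor>v\<rfloor> + 1)}"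
  have "open N" unfolding N_def by (intro open_Times) auto
  moreover have "p \<in> N" unfolding N_def uv mem_Times_iff greaterThanLessThan_iff fst_conv snd_conv by linarith
  moreover have "N \<subseteq> (\<Union>q\<in>Q. closed_cell q)"
  proof
    fix z assume z: "z \<in> N"
    obtain r s where rs: "z = (r, s)" by (cases z)
    have c: "real_of_int \<lfloor>r\<rfloor> \<le> u \<and> u \<le> real_of_int \<lfloor>r\<rfloor> + 1 \<and> real_of_int \<lfloor>s\<rfloor> \<le> v \<and> v \<le> real_of_int \<lfloor>s\<rfloor> + 1"
    proof -
      have "real_of_int (\<lceil>u\<rceil> - 1) < r" "r < real_of_int (\<lfloor>u\<rfloor> + 1)"
        "real_of_int (\<lceil>v\<rceil> - 1) < s" "s < real_of_int (\<lfloor>v\<rfloor> + 1)"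
        using z unfolding N_def rs by auto
      then show ?thesis using floor_near[of u r] floor_near[of v s] by blast
    qed
    have "(\<lfloor>r\<rfloor>, \<lfloor>s\<rfloor>) \<in> Q" by (rule all) (use c in \<open>auto simp: uv\<close>)
    moreover have "z \<in> closed_cell (\<lfloor>r\<rfloor>, \<lfloor>s\<rfloor>)" using floor_correct[of r] floor_correct[of s] by (simp add: rs)
    ultimately show "z \<in> (\<Union>q\<in>Q. closed_cell q)" by blast
  qed
  ultimately show ?thesis by (meson interior_maximal subset_iff)
qed

text \<open>Let \<open>f\<close> be the face around the centre of \<open>q\<close>. It cannot leave
  the union of the cells of \<open>Q\<close>: at a point of the frontier some lattice edge separates
  \<open>Q\<close>, hence belongs to \<open>G\<close> and is drawn, while \<open>f\<close> avoids
  the drawing. So \<open>f\<close> is bounded, its frontier is the boundary of a unit square, and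
  this square must be \<open>q\<close>. Midpoints finally show that the sides of \<open>q\<close>
  are edges of \<open>G\<close>.\<close>

lemma polyomino_region:
  assumes G: "polyomino_graph G" and "finite Q"
    and Q: "\<And>e. ends e \<notin> edges G \<Longrightarrow> upc e \<in> Q \<longleftrightarrow> dnc e \<in> Q"
    and q: "q \<in> Q"
  shows "ends ` sides q \<subseteq> edges G"
proof -
  obtain x y where xy: "q = (x, y)" by (cases q)
  define D where "D = grid_point ` verts G \<union> drawn_edges (edges G)"
  define c where "c = (real_of_int x + 1/2, real_of_int y + 1/2)"
  define f where "f = connected_component_set (- D) c"
  have fin: "finite (verts G)" and sub: "grid_subgraph G"
    and faces: "\<And>f. f \<in> interior_faces G \<Longrightarrow> \<exists>q. bounded_by_square f q"
    using G by (auto simp: polyomino_graph_def)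
  have edge: "\<exists>e. E = ends e" "E \<subseteq> verts G" if E: "E \<in> edges G" for E
  proof -
    have "E \<in> {{u, v} | u v. u \<in> verts G \<and> v \<in> verts G \<and> grid_adjacent u v}"
      using sub E unfolding grid_subgraph_def by (rule subsetD)
    then obtain u v where uv: "E = {u, v}" "u \<in> verts G" "v \<in> verts G" "grid_adjacent u v"
      by blast
    then show "\<exists>e. E = ends e" "E \<subseteq> verts G" using adjacent_imp_ends[of u v] by auto
  qed
  have "finite (edges G)" using edge(2) fin by (meson finite_Pow_iff finite_subset Pow_iff subsetI)
  moreover have "closed (convex hull (grid_point ` E))" if E: "E \<in> edges G" for E
  proof -
    have "finite E" using edge(2)[OF E] fin finite_subset by blast
    then show ?thesis by (intro compact_imp_closed finite_imp_compact_convex_hull) simp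
  qed
  ultimately have "closed D"
    unfolding D_def drawn_edges_def using fin by (intro closed_Un closed_UN finite_imp_closed) auto
  have "c \<notin> convex hull (grid_point ` ends e)" for e
  proof -
    obtain b i j where "e = (b, i, j)" by (cases e)
    then show ?thesis using half_not_int[of i x] half_not_int[of j y]
      by (cases b) (auto simp: c_def hull_edge simp del: ends.simps)
  qed
  moreover have "c \<notin> range grid_point" using half_not_int[of _ x] by (auto simp: c_def grid_point_def) metis
  ultimately have cD: "c \<notin> D" using edge(1) unfolding D_def drawn_edges_def by blast
  then have f: "f \<in> components (- D)" and cf: "c \<in> f" unfolding f_def components_def by auto
  have opn: "open f" using f \<open>closed D\<close> open_components by blast
  have con: "connected f" using f in_components_connected by blast
  have fD: "f \<inter> D = {}" using f in_components_subset by blast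
  define \<Omega> where "\<Omega> = (\<Union>q\<in>Q. closed_cell q)"
  have ccl: "closed (closed_cell q)" "bounded (closed_cell q)" for q
    by (cases q; simp only: closed_cell_cbox closed_cbox bounded_cbox)+
  have "closed \<Omega>" "bounded \<Omega>" unfolding \<Omega>_def using \<open>finite Q\<close> ccl by (auto intro!: closed_UN)
  have "f \<subseteq> \<Omega>"
  proof (rule ccontr)
    assume "\<not> f \<subseteq> \<Omega>"
    moreover have "c \<in> \<Omega>" unfolding \<Omega>_def by (rule UN_I[OF q]) (simp add: xy c_def)
    ultimately obtain p where p: "p \<in> f" "p \<in> frontier \<Omega>"
      using connected_Int_frontier[OF con, of \<Omega>] cf by blast
    then have "p \<in> \<Omega>" using \<open>closed \<Omega>\<close> frontier_subset_closed by blast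
    then obtain q' where q': "q' \<in> Q" "p \<in> closed_cell q'" by (auto simp: \<Omega>_def)
    have "p \<in> interior \<Omega>" unfolding \<Omega>_def
    proof (rule interior_cells[OF q'(2,1)])
      fix e assume "p \<in> convex hull (grid_point ` ends e)"
      then have "ends e \<notin> edges G" using p(1) fD unfolding D_def drawn_edges_def by blast
      then show "upc e \<in> Q \<longleftrightarrow> dnc e \<in> Q" by (rule Q)
    qed
    then show False using p(2) by (simp add: frontier_def)
  qed
  then have bf: "bounded f" using \<open>bounded \<Omega>\<close> bounded_subset by blast
  then obtain q' where "bounded_by_square f q'"
    using faces[of f] f by (auto simp: interior_faces_def D_def)
  then have fr: "frontier f = closed_cell q' - open_cell q'"
    by (simp add: bounded_by_square_def drawn_square)
  have ffr: "f \<inter> frontier f = {}" using opn by (simp add: frontier_def interior_open)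
  \<comment> \<open>Otherwise the exterior of the cell \<open>q'\<close>, being connected and
    disjoint from the frontier of \<open>f\<close>, would be contained in the bounded set
    \<open>f\<close>.\<close>
  have "f \<inter> closed_cell q' \<noteq> {}"
  proof
    assume e: "f \<inter> closed_cell q' = {}"
    have "connected (- closed_cell q')"
    proof (rule connected_complement_bounded_convex)
      show "convex (closed_cell q')" by (cases q') (simp only: closed_cell_cbox convex_box)
    qed (use ccl in auto)
    moreover have "- closed_cell q' \<inter> frontier f = {}" using fr by blast
    ultimately have "- closed_cell q' \<subseteq> f"
      using connected_Int_frontier[of "- closed_cell q'" f] e cf by blast
    then have "bounded (- closed_cell q' \<union> closed_cell q')"
      using bf bounded_subset ccl(2) bounded_Un by blast
    then show False by simp
  qed
  then have "f \<subseteq> closed_cell q'"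
    using connected_Int_frontier[OF con, of "closed_cell q'"] ffr fr frontier_closed_cell[of q'] by auto
  then have "c \<in> closed_cell q'" using cf by blast
  then have "q' = q" using half_between by (cases q') (simp add: c_def xy)
  have "frontier f \<subseteq> D"
    using frontier_of_components_closed_complement[OF \<open>closed D\<close> f] by blast
  then have D: "drawn_edges (square_edges q) \<subseteq> D" using fr \<open>q' = q\<close> by (simp add: drawn_square)
  show ?thesis
  proof
    fix E assume "E \<in> ends ` sides q"
    then obtain e where e: "e \<in> sides q" "E = ends e" by blast
    then have "convex hull (grid_point ` ends e) \<subseteq> D"
      using D unfolding drawn_edges_def square_edges_ends by blast
    then obtain p where p: "p \<in> D" "p \<notin> range grid_point" and
      uniq: "\<And>e'. p \<in> convex hull (grid_point ` ends e') \<Longrightarrow> e' = e"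
      using midpoint_edge by metis
    then obtain E' where "E' \<in> edges G" "p \<in> convex hull (grid_point ` E')"
      unfolding D_def drawn_edges_def by blast
    then show "E \<in> edges G" using edge(1)[of E'] uniq e(2) by blast
  qed
qed

section \<open>Height functions, forcing sets and resonant sets\<close>

section \<open>Forcing sets and directed cuts\<close>

context lattice_graph
begin

lemma star_sum:
  assumes "pm m" "(x, y) \<in> Vt"
  shows "of_bool ((True, x, y) \<in> m) + of_bool ((True, x - 1, y) \<in> m) + of_bool ((False, x, y) \<in> m) +
    of_bool ((False, x, y - 1) \<in> m) = (1 :: int)"
  using pm_cases[OF assms] pm_excl[OF assms(1), of x y] by auto

lemma pm_subset: "pm m \<Longrightarrow> e \<in> m \<Longrightarrow> e \<in> E"
  unfolding pm_def by blast

text \<open>Both matchings cover each vertex once, so their difference sums to zero around it. With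
  signs alternating by colour this says that the difference is closed as a form on the cells, and it
  is integrated along the rows, from the left margin of a window that contains the graph.\<close>

lemma height_function:
  assumes "finite Vt" and m: "pm m" and m': "pm m'"
  shows "\<exists>h :: cell \<Rightarrow> int. finite {q. h q \<noteq> 0} \<and>
    (\<forall>e. of_bool (e \<in> m') - of_bool (e \<in> m) = h (lft e) - h (rgt e))"
proof -
  define \<delta> :: "ledge \<Rightarrow> int" where "\<delta> e = of_bool (e \<in> m') - of_bool (e \<in> m)" for e
  define B where "B = Max (insert 0 ((\<lambda>v. max \<bar>fst v\<bar> \<bar>snd v\<bar>) ` Vt)) + 1"
  have B: "\<bar>x\<bar> < B \<and> \<bar>y\<bar> < B" if "(x, y) \<in> Vt" for x y
  proof -
    have "max \<bar>x\<bar> \<bar>y\<bar> \<le> Max (insert 0 ((\<lambda>v. max \<bar>fst v\<bar> \<bar>snd v\<bar>) ` Vt))"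
      using that \<open>finite Vt\<close> by (intro Max_ge) force+
    then show ?thesis by (simp add: B_def)
  qed
  have \<delta>0: "\<delta> (b, x, y) = 0" if "\<not> (\<bar>x\<bar> < B \<and> \<bar>y\<bar> < B)" for b x y
  proof -
    have "(b, x, y) \<notin> E" using B[of x y] E_h[of x y] E_v[of x y] that by (cases b) auto
    then show ?thesis using pm_subset[OF m] pm_subset[OF m'] by (auto simp: \<delta>_def)
  qed
  have \<delta>x: "\<delta> (b, x, y) = 0" if "x \<le> - B \<or> x \<ge> B" for b x y using that by (intro \<delta>0) linarith
  have \<delta>y: "\<delta> (b, x, y) = 0" if "y \<le> - B \<or> y \<ge> B" for b x y using that by (intro \<delta>0) linarith
  have vsum: "\<delta> (True, x, y) + \<delta> (True, x - 1, y) + \<delta> (False, x, y) + \<delta> (False, x, y - 1) = 0" for x y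
  proof (cases "(x, y) \<in> Vt")
    case True
    then show ?thesis using star_sum[OF m True] star_sum[OF m' True] by (simp add: \<delta>_def)
  next
    case False
    have "e \<notin> m \<and> e \<notin> m'" if "e \<in> star (x, y)" for e
      using star_Vt[OF _ that] False pm_subset[OF m] pm_subset[OF m'] by blast
    then show ?thesis by (simp add: \<delta>_def)
  qed
  define sg :: "int \<Rightarrow> int \<Rightarrow> int" where "sg x y = (if even (x + y) then 1 else -1)" for x y
  have sg: "sg (x - 1) y = - sg x y" "sg x (y - 1) = - sg x y" for x y by (auto simp: sg_def)
  define h where "h q = - (\<Sum>i\<in>{-B..fst q}. sg i (snd q) * \<delta> (False, i, snd q))" for q
  have hx: "h (x, y) - h (x - 1, y) = - sg x y * \<delta> (False, x, y)" for x y
  proof (cases "-B \<le> x")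
    case True
    then have "{-B..x} = insert x {-B..x - 1}" by auto
    then show ?thesis by (simp add: h_def)
  next
    case False
    then have "\<delta> (False, x, y) = 0" by (intro \<delta>0) linarith
    then show ?thesis using False by (simp add: h_def)
  qed
  have hy: "h (x, y) - h (x, y - 1) = sg x y * \<delta> (True, x, y)" for x y
  proof (cases "- B - 1 \<le> x")
    case True
    then show ?thesis
    proof (induction x rule: int_ge_induct)
      case base
      then show ?case using \<delta>x[of "- B - 1" True y] by (simp add: h_def)
    next
      case (step x)
      have "h (x + 1, y) - h (x + 1, y - 1) =
          (h (x, y) - h (x, y - 1)) - sg (x + 1) y * (\<delta> (False, x + 1, y) + \<delta> (False, x + 1, y - 1))"
        using hx[of "x + 1" y] hx[of "x + 1" "y - 1"] sg(2)[of "x + 1" y] by (simp add: algebra_simps)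
      also have "\<delta> (False, x + 1, y) + \<delta> (False, x + 1, y - 1) = - (\<delta> (True, x + 1, y) + \<delta> (True, x, y))"
        using vsum[of "x + 1" y] by simp
      finally show ?case using step.IH sg(1)[of "x + 1" y] by (simp add: algebra_simps)
    qed
  next
    case False
    then have "\<delta> (True, x, y) = 0" by (intro \<delta>0) linarith
    then show ?thesis using False by (simp add: h_def)
  qed
  \<comment> \<open>To the right of the window the full row sums vanish too: they vanish in the
    lowest row and do not change from one row to the next, as there are no horizontal edges.\<close>
  have supp: "h (x, y) = 0" if "\<not> (\<bar>x\<bar> < B \<and> \<bar>y\<bar> < B)" for x y
  proof (cases "\<bar>y\<bar> < B")
    case False
    then have "\<delta> (False, i, y) = 0" for i by (intro \<delta>y) linarith
    then show ?thesis by (simp add: h_def)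
  next
    case True
    then have "\<not> \<bar>x\<bar> < B" using that by blast
    then have "x < - B \<or> x = - B \<or> x \<ge> B" by linarith
    then consider "x < - B" | "x = - B" | "x \<ge> B" by blast
    then show ?thesis
    proof cases
      case 1 then show ?thesis by (simp add: h_def)
    next
      case 2 then show ?thesis using \<delta>x[of "-B" False y] by (simp add: h_def)
    next
      case 3
      have "-B \<le> y" using True by simp
      then show ?thesis
      proof (induction y rule: int_ge_induct)
        case base
        show ?case using \<delta>y[of "-B"] by (simp add: h_def)
      next
        case (step y)
        then show ?case using hy[of x "y + 1"] \<delta>x[of x True "y + 1"] 3 by simp
      qed
    qed
  qed
  have "{q. h q \<noteq> 0} \<subseteq> {-B..B} \<times> {-B..B}"
  proof
    fix q assume "q \<in> {q. h q \<noteq> 0}"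
    moreover obtain a b where q: "q = (a, b)" by (cases q)
    ultimately have "\<bar>a\<bar> < B \<and> \<bar>b\<bar> < B" using supp[of a b] by blast
    then show "q \<in> {-B..B} \<times> {-B..B}" by (auto simp: q)
  qed
  then have "finite {q. h q \<noteq> 0}" by (rule finite_subset) simp
  moreover have "\<delta> e = h (lft e) - h (rgt e)" for e
  proof -
    obtain b x y where e: "e = (b, x, y)" by (cases e)
    show ?thesis using hx[of x y] hy[of x y] by (cases b; cases "even (x + y)") (simp_all add: e sg_def)
  qed
  ultimately show ?thesis unfolding \<delta>_def by blast
qed

text \<open>The left and upper sides of an extreme cell are both on the boundary, and exactly one of
  them is matched.\<close>

lemma bdry_meets_matching:
  assumes "alt s m Q" "finite Q" "Q \<noteq> {}"
  shows "bdry Q \<inter> m \<noteq> {}"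
proof -
  obtain x y where "extreme Q (x, y)" using exists_extreme[OF assms(2,3)] by blast
  note out = extreme_outside[OF this]
  have "(False, x, y) \<in> bdry Q" "(True, x, y + 1) \<in> bdry Q" using out by (simp_all add: bdry_def)
  moreover have "(False, x, y) \<in> m \<or> (True, x, y + 1) \<in> m"
    using alt_sides(1)[OF assms(1) out(3,1)] alt_sides(4)[OF assms(1) out(3,2)] by blast
  ultimately show ?thesis by blast
qed

text \<open>Otherwise \<open>e\<close> and \<open>e'\<close> would both be matched after switching
  along the boundary.\<close>

lemma bdry_matched_end:
  assumes "pm m" "Q \<subseteq> Sq" "alt s m Q" "e \<in> bdry Q" "e \<notin> m" "e' \<in> m" "e \<in> star v" "e' \<in> star v"
  shows "e' \<in> bdry Q"
proof (rule ccontr)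
  assume "e' \<notin> bdry Q"
  then have "e \<in> sym_diff m (bdry Q)" "e' \<in> sym_diff m (bdry Q)" using assms by blast+
  then have "e = e'"
    using pm_unique[OF pm_flip[OF assms(1,3) bdry_Sq[OF assms(2)]]] assms(7,8) by blast
  then show False using assms by blast
qed

text \<open>A packing of cuts only controls matched edges. A common unmatched edge, however, has an
  end whose matched edge lies on both boundaries.\<close>

lemma bdry_disjoint:
  assumes m: "pm m" and Q: "Q \<subseteq> Sq" "alt s m Q" and R: "R \<subseteq> Sq" "alt s' m R"
    and dj: "bdry Q \<inter> bdry R \<inter> m = {}"
  shows "bdry Q \<inter> bdry R = {}"
proof (rule ccontr)
  assume "bdry Q \<inter> bdry R \<noteq> {}"
  then obtain e where e: "e \<in> bdry Q" "e \<in> bdry R" by blast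
  then have "e \<notin> m" "e \<in> E" using dj bdry_Sq[OF Q(1)] by blast+
  define v where "v = upc e"
  have v: "e \<in> star v" by (cases e; cases "fst e") (auto simp: v_def)
  then have "v \<in> Vt" using star_Vt \<open>e \<in> E\<close> by blast
  then obtain e' where e': "e' \<in> m" "e' \<in> star v" using m unfolding pm_def by blast
  have "e' \<in> bdry Q" "e' \<in> bdry R"
    using bdry_matched_end[OF m Q e(1) \<open>e \<notin> m\<close> e'(1) v e'(2)]
      bdry_matched_end[OF m R e(2) \<open>e \<notin> m\<close> e'(1) v e'(2)] by blast+
  then show False using e'(1) dj by blast
qed

definition laminar_alternating :: "ledge set \<Rightarrow> cell set set \<Rightarrow> bool" where
  "laminar_alternating m \<Q> \<longleftrightarrow> pm m \<and> finite \<Q> \<and>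
     (\<forall>Q\<in>\<Q>. finite Q \<and> Q \<noteq> {} \<and> Q \<subseteq> Sq \<and> (\<exists>s. alt s m Q)) \<and>
     (\<forall>Q\<in>\<Q>. \<forall>R\<in>\<Q>. Q \<noteq> R \<longrightarrow> bdry Q \<inter> bdry R = {} \<and> (Q \<subseteq> R \<or> R \<subseteq> Q \<or> Q \<inter> R = {}))"

text \<open>A smallest region \<open>Q\<close> that is not a single cell contains only single cells
  of the family. It is traded, together with these, for a resonant set in \<open>Q\<close> with one
  more cell. The number of regions stays the same, while their total size drops since
  \<open>Q\<close> has at least two cells.\<close>

lemma laminar_imp_packed:
  "laminar_alternating m \<Q> \<Longrightarrow> \<exists>m' K. pm m' \<and> finite K \<and> K \<subseteq> Sq \<and> packed m' K \<and> card K = card \<Q>"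
proof (induction "\<Sum>Q\<in>\<Q>. card Q" arbitrary: m \<Q> rule: less_induct)
  case less
  have m: "pm m" and fin: "finite \<Q>" using less.prems unfolding laminar_alternating_def by blast+
  have reg: "finite Q" "Q \<noteq> {}" "Q \<subseteq> Sq" "\<exists>s. alt s m Q" if "Q \<in> \<Q>" for Q
    using less.prems that unfolding laminar_alternating_def by blast+
  have dj: "bdry Q \<inter> bdry R = {}" and lam: "Q \<subseteq> R \<or> R \<subseteq> Q \<or> Q \<inter> R = {}"
    if "Q \<in> \<Q>" "R \<in> \<Q>" "Q \<noteq> R" for Q R
    using less.prems that unfolding laminar_alternating_def by blast+
  show ?case
  proof (cases "\<forall>Q\<in>\<Q>. \<exists>q. Q = {q}")
    case True
    define K where "K = {q. {q} \<in> \<Q>}"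
    have \<Q>: "\<Q> = (\<lambda>q. {q}) ` K" using True unfolding K_def by fastforce
    have "card \<Q> = card K" unfolding \<Q> by (rule card_image) (simp add: inj_on_def)
    moreover have "finite K" using fin unfolding \<Q> by (rule finite_imageD) (simp add: inj_on_def)
    moreover have "K \<subseteq> Sq" using reg(3) unfolding K_def by blast
    moreover have "packed m K"
      unfolding packed_def altc_def
    proof (intro conjI ballI impI)
      show "\<exists>s. alt s m {q}" if "q \<in> K" for q using reg(4) that unfolding K_def by blast
      show "sides q \<inter> sides q' = {}" if "q \<in> K" "q' \<in> K" "q \<noteq> q'" for q q'
        using dj[of "{q}" "{q'}"] that unfolding K_def bdry_single by blast
    qed
    ultimately show ?thesis using m by (intro exI[of _ m] exI[of _ K]) simp
  next
    case False
    define \<B> where "\<B> = {Q \<in> \<Q>. \<nexists>q. Q = {q}}"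
    have "\<B> \<noteq> {}" "finite \<B>" using False fin by (auto simp: \<B>_def)
    then obtain Q where Q: "Q \<in> \<B>" and min: "\<And>R. R \<in> \<B> \<Longrightarrow> card Q \<le> card R"
      using ex_min_if_finite[of "card ` \<B>"] arg_min_if_finite[of \<B> card] by (metis not_le)
    have Q\<Q>: "Q \<in> \<Q>" and Qns: "\<And>q. Q \<noteq> {q}" using Q unfolding \<B>_def by blast+
    note regQ = reg[OF Q\<Q>]
    obtain s where s: "alt s m Q" using regQ(4) by blast
    have "card Q \<noteq> 1" using Qns card_1_singletonE by metis
    moreover have "card Q \<noteq> 0" using regQ by simp
    ultimately have cQ: "card Q \<ge> 2" by linarith
    define K where "K = {q. {q} \<in> \<Q> \<and> q \<in> Q}"
    have KQ: "K \<subseteq> Q" unfolding K_def by blast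
    have "packed m K"
      unfolding packed_def altc_def
    proof (intro conjI ballI impI)
      show "\<exists>s. alt s m {q}" if "q \<in> K" for q using reg(4) that unfolding K_def by blast
      show "sides q \<inter> sides q' = {}" if "q \<in> K" "q' \<in> K" "q \<noteq> q'" for q q'
        using dj[of "{q}" "{q'}"] that unfolding K_def bdry_single by blast
    qed
    moreover have "sides q \<inter> bdry Q = {}" if "q \<in> K" for q
      using dj[of "{q}" Q] that Q\<Q> Qns[of q] unfolding K_def bdry_single by blast
    ultimately have "admissible m Q K s"
      using m regQ s KQ unfolding admissible_def by blast
    then have "augmentable m Q K" using region_augmentable regQ(2) by blast
    then obtain m' K' where m': "pm m'" and K': "K' \<subseteq> Q" "card K' = card K + 1" "packed m' K'"
      and ag: "agree Q m m'" unfolding augmentable_def by blast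
    define \<R> where "\<R> = \<Q> - {Q} - (\<lambda>q. {q}) ` K"
    define \<N> where "\<N> = (\<lambda>q. {q}) ` K'"
    have finK: "finite K" "finite K'" using KQ K'(1) regQ(1) finite_subset by blast+
    have \<R>: "R \<in> \<Q>" "Q \<subset> R \<or> Q \<inter> R = {}" if R: "R \<in> \<R>" for R
    proof -
      show R\<Q>: "R \<in> \<Q>" using R unfolding \<R>_def by blast
      have "R \<noteq> Q" using R unfolding \<R>_def by blast
      moreover have "\<not> R \<subset> Q"
      proof
        assume sub: "R \<subset> Q"
        then have "card R < card Q" using regQ(1) psubset_card_mono by blast
        then have "R \<notin> \<B>" using min[of R] by linarith
        then obtain q where "R = {q}" using R\<Q> unfolding \<B>_def by blast
        then show False using R sub R\<Q> unfolding \<R>_def K_def by blast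
      qed
      ultimately show "Q \<subset> R \<or> Q \<inter> R = {}" using lam[OF Q\<Q> R\<Q>] by blast
    qed
    \<comment> \<open>The remaining regions contain \<open>Q\<close> or are disjoint from it and
      share no boundary edge with it. So changes of the matching within \<open>Q\<close> do not
      reach their boundaries.\<close>
    have away: "upc e \<notin> Q \<and> dnc e \<notin> Q" if "R \<in> \<R>" "e \<in> bdry R" for R e
    proof -
      have "R \<noteq> Q" using that unfolding \<R>_def by blast
      then have "e \<notin> bdry Q" using dj[OF Q\<Q> \<R>(1)[OF that(1)]] that(2) by blast
      then show ?thesis using \<R>(2)[OF that(1)] that(2) unfolding bdry_def by blast
    qed
    have RN: "bdry R \<inter> sides q = {}" if "R \<in> \<R>" "q \<in> K'" for R q
    proof -
      have "upc e = q \<or> dnc e = q" if "e \<in> sides q" for e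
        using that unfolding bdry_single[symmetric] bdry_def by blast
      then show ?thesis using away[OF that(1)] that(2) K'(1) by blast
    qed
    have RNl: "R \<subseteq> {q} \<or> {q} \<subseteq> R \<or> R \<inter> {q} = {}" for R and q :: cell by blast
    have "laminar_alternating m' (\<R> \<union> \<N>)"
      unfolding laminar_alternating_def
    proof (intro conjI ballI impI)
      show "pm m'" by (rule m')
      show "finite (\<R> \<union> \<N>)" using fin finK unfolding \<R>_def \<N>_def by blast
      fix R assume R: "R \<in> \<R> \<union> \<N>"
      show "finite R" "R \<noteq> {}" "R \<subseteq> Sq"
        using R reg(1-3)[OF \<R>(1)] K'(1) regQ(3) unfolding \<N>_def by auto
      show "\<exists>s. alt s m' R"
      proof (cases "R \<in> \<R>")
        case True
        obtain s where s: "alt s m R" using reg(4)[OF \<R>(1)[OF True]] by blast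
        have "alt s m' R"
        proof (rule alt_cong[OF s])
          fix e assume "e \<in> bdry R"
          then show "e \<in> m' \<longleftrightarrow> e \<in> m" using away[OF True] ag unfolding agree_def by blast
        qed
        then show ?thesis by blast
      next
        case False
        then obtain q where "R = {q}" "q \<in> K'" using R unfolding \<N>_def by blast
        then show ?thesis using K'(3) unfolding packed_def altc_def by blast
      qed
      fix S assume S: "S \<in> \<R> \<union> \<N>" and ne: "R \<noteq> S"
      consider "R \<in> \<R>" "S \<in> \<R>" | q where "R \<in> \<R>" "S = {q}" "q \<in> K'" | q where "S \<in> \<R>" "R = {q}" "q \<in> K'"
        | q q' where "R = {q}" "q \<in> K'" "S = {q'}" "q' \<in> K'"
        using R S unfolding \<N>_def by blast
      then have "bdry R \<inter> bdry S = {} \<and> (R \<subseteq> S \<or> S \<subseteq> R \<or> R \<inter> S = {})"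
      proof cases
        case 1
        show ?thesis using dj[OF \<R>(1)[OF 1(1)] \<R>(1)[OF 1(2)] ne] lam[OF \<R>(1)[OF 1(1)] \<R>(1)[OF 1(2)] ne] by blast
      next
        case 2
        show ?thesis using RN[OF 2(1,3)] RNl[of R q] unfolding 2(2) bdry_single by blast
      next
        case 3
        show ?thesis using RN[OF 3(1,3)] RNl[of S q] unfolding 3(2) bdry_single by blast
      next
        case 4
        have "sides q \<inter> sides q' = {}" using 4 ne K'(3) unfolding packed_def by blast
        then show ?thesis using ne unfolding 4(1) 4(3) bdry_single by blast
      qed
      then show "bdry R \<inter> bdry S = {}" "R \<subseteq> S \<or> S \<subseteq> R \<or> R \<inter> S = {}" by blast+
    qed
    moreover have RNd: "\<R> \<inter> \<N> = {}"
    proof -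
      have "{q} \<notin> \<R>" if "q \<in> K'" for q
        using \<R>(2)[of "{q}"] that K'(1) regQ(2) by blast
      then show ?thesis unfolding \<N>_def by blast
    qed
    have inj: "inj_on (\<lambda>q. {q}) X" for X :: "cell set" by (simp add: inj_on_def)
    have KQ': "(\<lambda>q. {q}) ` K \<subseteq> \<Q> - {Q}" using Qns unfolding K_def by blast
    have fR: "finite \<R>" using fin unfolding \<R>_def by blast
    have fN: "finite \<N>" using finK unfolding \<N>_def by blast
    have "card (\<R> \<union> \<N>) = card \<Q>"
    proof -
      have 1: "card (\<R> \<union> \<N>) = card \<R> + card \<N>" using card_Un_disjoint[OF fR fN RNd] .
      have 2: "card \<N> = card K + 1" unfolding \<N>_def using card_image[OF inj] K'(2) by metis
      have "card (\<Q> - {Q}) = card \<R> + card ((\<lambda>q. {q}) ` K)"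
        unfolding \<R>_def using card_Diff_subset[OF _ KQ'] finK(1) card_mono[OF _ KQ'] fin by simp
      then have 3: "card (\<Q> - {Q}) = card \<R> + card K" using card_image[OF inj[of K]] by simp
      have "card \<Q> = card (\<Q> - {Q}) + 1" using card_Suc_Diff1[OF fin Q\<Q>] by simp
      then show ?thesis using 1 2 3 by simp
    qed
    moreover have "(\<Sum>R\<in>\<R> \<union> \<N>. card R) < (\<Sum>R\<in>\<Q>. card R)"
    proof -
      have sing: "(\<Sum>R\<in>(\<lambda>q. {q}) ` X. card R) = card X" for X :: "cell set"
        by (subst sum.reindex[OF inj]) simp
      have "(\<Sum>R\<in>\<R> \<union> \<N>. card R) = (\<Sum>R\<in>\<R>. card R) + card K'"
        using sum.union_disjoint[OF fR fN RNd, of card] sing[of K', folded \<N>_def] by simp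
      moreover have "(\<Sum>R\<in>\<Q>. card R) = card Q + (\<Sum>R\<in>\<Q> - {Q}. card R)"
        using fin Q\<Q> by (rule sum.remove)
      moreover have "(\<Sum>R\<in>\<Q> - {Q}. card R) = (\<Sum>R\<in>\<R>. card R) + card K"
        using sum.subset_diff[OF KQ', of card] fin sing[of K] by (simp add: \<R>_def)
      ultimately show ?thesis using K'(2) cQ by linarith
    qed
    ultimately show ?thesis using less.hyps by metis
  qed
qed

end

text \<open>The assumption \<open>region\<close> is \<open>polyomino_region\<close> in terms of
  lattice edges. It replaces the condition on faces in all that follows.\<close>

locale lattice_region = lattice_graph +
  assumes finite_Vt: "finite Vt"
    and region: "finite Q \<Longrightarrow> (\<And>e. e \<notin> E \<Longrightarrow> upc e \<in> Q \<longleftrightarrow> dnc e \<in> Q) \<Longrightarrow> Q \<subseteq> Sq"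
begin

lemma finite_E: "finite E"
proof (rule finite_subset)
  show "E \<subseteq> UNIV \<times> Vt"
  proof
    fix e assume "e \<in> E"
    moreover obtain b x y where "e = (b, x, y)" by (cases e)
    ultimately show "e \<in> UNIV \<times> Vt" using E_h[of x y] E_v[of x y] by (cases b) auto
  qed
qed (simp add: finite_Vt)

lemma finite_Sq: "finite Sq"
  by (rule finite_subset[OF _ finite_Vt]) (use Sq_corners(1) in auto)

text \<open>The Lucchesi-Younger theorem is applied to the matched edges as arcs, with all cells
  outside \<open>Sq\<close> merged into the vertex \<open>out\<close>. Its hitting set is a forcing
  set, and its packing turns into a laminar family of regions.\<close>

lemma forcing_bound:
  assumes m: "pm m"
  shows "\<exists>S m' K. S \<subseteq> m \<and> (\<forall>m''. pm m'' \<longrightarrow> S \<subseteq> m'' \<longrightarrow> m'' = m) \<and>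
    pm m' \<and> finite K \<and> K \<subseteq> Sq \<and> packed m' K \<and> card S \<le> card K"
proof -
  have "infinite (UNIV :: cell set)" by (simp add: infinite_UNIV_int finite_prod)
  then obtain out where out: "out \<notin> Sq" using finite_Sq ex_new_if_finite by blast
  define \<rho> where "\<rho> q = (if q \<in> Sq then q else out)" for q
  define V where "V = insert out Sq"
  have \<rho>V: "\<rho> q \<in> V" for q by (simp add: \<rho>_def V_def)
  interpret cut_system V m "\<rho> \<circ> lft" "\<rho> \<circ> rgt"
  proof
    show "finite V" using finite_Sq by (simp add: V_def)
    show "finite m" using m finite_E finite_subset unfolding pm_def by blast
  qed (use \<rho>V in auto)
  \<comment> \<open>Passing to another matching, the difference across an edge can only drop if the
    edge is matched and only rise if it is not. So superlevel sets of height functions are closed in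
    this sense.\<close>
  define cl where "cl D \<longleftrightarrow> (\<forall>e\<in>m. \<rho> (lft e) \<in> D \<longrightarrow> \<rho> (rgt e) \<in> D) \<and>
      (\<forall>e\<in>E - m. \<rho> (rgt e) \<in> D \<longrightarrow> \<rho> (lft e) \<in> D)" for D
  define F where "F = {D. D \<subseteq> V \<and> D \<noteq> {} \<and> D \<noteq> V \<and> cl D}"
  \<comment> \<open>The side of the cut without \<open>out\<close>, which is a finite region of
    squares.\<close>
  define reg where "reg D = (if out \<in> D then V - D else D)" for D
  have F: "D \<subseteq> V" "D \<noteq> {}" "D \<noteq> V" "cl D" if "D \<in> F" for D using that by (auto simp: F_def)
  have reg_iff: "q \<in> reg D \<longleftrightarrow> (\<rho> q \<in> D) = (out \<notin> D)" if "D \<in> F" for D q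
    using F(1)[OF that] out by (auto simp: reg_def \<rho>_def V_def)
  have reg: "finite (reg D)" "reg D \<noteq> {}" "reg D \<subseteq> Sq" if "D \<in> F" for D
  proof -
    show "reg D \<subseteq> Sq" using F(1)[OF that] by (auto simp: reg_def V_def)
    then show "finite (reg D)" using finite_Sq finite_subset by blast
    show "reg D \<noteq> {}" using F(1-3)[OF that] by (auto simp: reg_def)
  qed
  have lr: "(lft e = upc e \<and> rgt e = dnc e) \<or> (lft e = dnc e \<and> rgt e = upc e)" for e
    by (cases e) auto
  have bd: "e \<in> bdry (reg D) \<longleftrightarrow> (\<rho> (lft e) \<in> D) \<noteq> (\<rho> (rgt e) \<in> D)" if "D \<in> F" for D e
    using lr[of e] by (auto simp: bdry_def reg_iff[OF that])
  have altreg: "alt (out \<notin> D) m (reg D)" if D: "D \<in> F" for D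
    unfolding alt_def
  proof
    fix e assume e: "e \<in> bdry (reg D)"
    then have "e \<in> E" using bdry_Sq[OF reg(3)[OF D]] by blast
    then have "e \<in> m \<longleftrightarrow> \<rho> (rgt e) \<in> D"
      using e F(4)[OF D] unfolding bd[OF D] cl_def by blast
    then show "e \<in> m \<longleftrightarrow> (rgt e \<in> reg D \<longleftrightarrow> (out \<notin> D))" using reg_iff[OF D] by blast
  qed
  have cut: "bdry (reg D) \<inter> m = cutset D" if D: "D \<in> F" for D
    using F(4)[OF D] unfolding cl_def cutset_def by (auto simp: bd[OF D])
  have "crossing_family F"
    unfolding crossing_family_def
  proof (intro conjI ballI impI)
    show "D \<subseteq> V" if "D \<in> F" for D using F(1)[OF that] .
    show "(\<rho> \<circ> rgt) a \<in> D" if "D \<in> F" "a \<in> m" "(\<rho> \<circ> lft) a \<in> D" for D a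
      using F(4)[OF that(1)] that(2,3) by (simp add: cl_def)
    show "cutset D \<noteq> {}" if "D \<in> F" for D
      using bdry_meets_matching[OF altreg[OF that] reg(1,2)[OF that]] cut[OF that] by simp
    fix D D' assume D: "D \<in> F" "D' \<in> F" and ne: "D \<inter> D' \<noteq> {}" "D \<union> D' \<noteq> V"
    have "cl (D \<inter> D')" "cl (D \<union> D')"
      using F(4)[OF D(1)] F(4)[OF D(2)] unfolding cl_def by blast+
    then show "D \<inter> D' \<in> F" "D \<union> D' \<in> F"
      using ne F(1-3)[OF D(1)] F(1-3)[OF D(2)] unfolding F_def by blast+
  qed
  from lucchesi_younger[OF this] obtain S n D where S: "S \<subseteq> m" "card S \<le> n" "\<And>D. D \<in> F \<Longrightarrow> cutset D \<inter> S \<noteq> {}"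
    and D: "packing F (\<lambda>_. 1) n D" "cross_free n D" by blast
  have DF: "D i \<in> F" if "i < n" for i using D(1) that by (simp add: packing_def)
  have "m'' = m" if m'': "pm m''" "S \<subseteq> m''" for m''
  proof -
    obtain h :: "cell \<Rightarrow> int" where fin: "finite {q. h q \<noteq> 0}"
      and h: "\<And>e. of_bool (e \<in> m'') - of_bool (e \<in> m) = h (lft e) - h (rgt e)"
      using height_function[OF finite_Vt m m''(1)] by blast
    have "{q. h q \<noteq> 0} \<subseteq> Sq"
    proof (rule region[OF fin])
      fix e assume "e \<notin> E"
      then have "e \<notin> m" "e \<notin> m''" using m m''(1) unfolding pm_def by blast+
      then show "upc e \<in> {q. h q \<noteq> 0} \<longleftrightarrow> dnc e \<in> {q. h q \<noteq> 0}" using h[of e] lr[of e] by auto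
    qed
    then have h0: "h q = 0" if "q \<notin> Sq" for q using that by blast
    have h\<rho>: "h (\<rho> q) = h q" for q using h0 out by (simp add: \<rho>_def)
    \<comment> \<open>A proper superlevel set is a member of \<open>F\<close>. The edge of
      \<open>S\<close> that hits it has the smaller height on its left, so it is missing in
      \<open>m''\<close>, which contradicts \<open>S \<subseteq> m''\<close>.\<close>
    have no_level: False if t: "c \<in> V" "c' \<in> V" "h c \<ge> t" "\<not> h c' \<ge> t"
      and ex: "(\<forall>q\<in>V. h q \<le> t) \<or> (\<forall>q\<in>V. h q \<ge> t - 1)" for t c c'
    proof -
      define D where "D = {q \<in> V. h q \<ge> t}"
      have mem: "\<rho> q \<in> D \<longleftrightarrow> h q \<ge> t" for q using \<rho>V h\<rho> by (simp add: D_def)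
      have "cl D"
        unfolding cl_def mem
      proof (intro conjI ballI impI)
        fix e assume "e \<in> m" "t \<le> h (lft e)"
        then have "h (lft e) \<le> h (rgt e)" using h[of e] by (cases "e \<in> m''") auto
        then show "t \<le> h (rgt e)" using \<open>t \<le> h (lft e)\<close> by linarith
      next
        fix e assume "e \<in> E - m" "t \<le> h (rgt e)"
        then have "h (lft e) \<ge> h (rgt e)" using h[of e] by (cases "e \<in> m''") auto
        then show "t \<le> h (lft e)" using \<open>t \<le> h (rgt e)\<close> by linarith
      qed
      then have "D \<in> F" using t unfolding F_def D_def by blast
      then obtain e where e: "e \<in> cutset D" "e \<in> S" using S(3) by blast
      then have "\<rho> (rgt e) \<in> D" "\<rho> (lft e) \<notin> D" and em: "e \<in> m" unfolding cutset_def by auto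
      then have "h (lft e) < h (rgt e)" unfolding mem by linarith
      then have "e \<notin> m''" using h[of e] em by (cases "e \<in> m''") auto
      then show False using e(2) m''(2) by blast
    qed
    \<comment> \<open>If some height is nonzero then the maximum or the minimum differs from the
      height 0 of \<open>out\<close>, and one of the two extreme levels gives a proper superlevel
      set.\<close>
    have "h q = 0" if "q \<in> V" for q
    proof (rule ccontr)
      assume "h q \<noteq> 0"
      have "finite V" by (rule finite_V)
      have o: "out \<in> V" "h out = 0" using h0 out by (auto simp: V_def)
      show False
      proof (cases "h q > 0")
        case True
        define t where "t = Max (h ` V)"
        have ub: "h p \<le> t" if "p \<in> V" for p using \<open>finite V\<close> that by (simp add: t_def)
        have "t \<in> h ` V" unfolding t_def using \<open>finite V\<close> that by (intro Max_in) auto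
        then obtain c where "c \<in> V" "h c \<ge> t" by force
        moreover have "\<not> h out \<ge> t" using ub[OF that] True o(2) by simp
        ultimately show False using no_level[of c out t] o(1) ub by blast
      next
        case False
        define t where "t = Min (h ` V)"
        have lb: "h p \<ge> t" if "p \<in> V" for p using \<open>finite V\<close> that by (simp add: t_def)
        have "t \<in> h ` V" unfolding t_def using \<open>finite V\<close> that by (intro Min_in) auto
        then obtain c where "c \<in> V" "\<not> h c \<ge> t + 1" by force
        moreover have "h out \<ge> t + 1" using lb[OF that] False \<open>h q \<noteq> 0\<close> o(2) by simp
        ultimately show False using no_level[of out c "t + 1"] o(1) lb by force
      qed
    qed
    then have "h q = 0" for q using h\<rho>[of q] \<rho>V by metis
    then have "e \<in> m'' \<longleftrightarrow> e \<in> m" for e using h[of e] by (cases "e \<in> m''"; cases "e \<in> m") auto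
    then show ?thesis by blast
  qed
  moreover have "\<exists>m' K. pm m' \<and> finite K \<and> K \<subseteq> Sq \<and> packed m' K \<and> card K = n"
  proof -
    define Q where "Q i = reg (D i)" for i
    have mdj: "bdry (Q i) \<inter> bdry (Q j) \<inter> m = {}" if ij: "i < n" "j < n" "i \<noteq> j" for i j
    proof (rule ccontr)
      assume "bdry (Q i) \<inter> bdry (Q j) \<inter> m \<noteq> {}"
      then obtain e where e: "e \<in> m" "e \<in> cutset (D i)" "e \<in> cutset (D j)"
        using cut[OF DF[OF ij(1)]] cut[OF DF[OF ij(2)]] unfolding Q_def by blast
      have "(\<Sum>k\<in>{i, j}. of_bool (e \<in> cutset (D k))) \<le> (\<Sum>k<n. of_bool (e \<in> cutset (D k)) :: nat)"
        using ij by (intro sum_mono2) auto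
      also have "\<dots> \<le> 1" using D(1) e(1) by (simp add: packing_def)
      finally show False using e ij by simp
    qed
    have dj: "bdry (Q i) \<inter> bdry (Q j) = {}" if "i < n" "j < n" "i \<noteq> j" for i j
      using bdry_disjoint[OF m reg(3)[OF DF[OF that(1)]] altreg[OF DF[OF that(1)]]
        reg(3)[OF DF[OF that(2)]] altreg[OF DF[OF that(2)]]] mdj[OF that] unfolding Q_def by blast
    have inj: "inj_on Q {..<n}"
    proof (rule inj_onI, rule ccontr)
      fix i j assume ij: "i \<in> {..<n}" "j \<in> {..<n}" "Q i = Q j" "i \<noteq> j"
      then have "bdry (Q i) = {}" using dj[of i j] by simp
      then show False
        using bdry_meets_matching[OF altreg reg(1,2)] DF[of i] ij(1) unfolding Q_def by blast
    qed
    have "laminar_alternating m (Q ` {..<n})"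
      unfolding laminar_alternating_def
    proof (intro conjI ballI impI)
      show "pm m" by (rule m)
      show "finite (Q ` {..<n})" by simp
      fix R assume "R \<in> Q ` {..<n}"
      then obtain i where i: "i < n" "R = Q i" by blast
      show "finite R" "R \<noteq> {}" "R \<subseteq> Sq" "\<exists>s. alt s m R"
        using reg[OF DF[OF i(1)]] altreg[OF DF[OF i(1)]] unfolding i(2) Q_def by blast+
      fix R' assume "R' \<in> Q ` {..<n}" and ne: "R \<noteq> R'"
      then obtain j where j: "j < n" "R' = Q j" by blast
      then show "bdry R \<inter> bdry R' = {}" using dj[OF i(1) j(1)] ne i(2) by blast
      \<comment> \<open>Two cuts that do not cross have sides without \<open>out\<close> that are
        nested or disjoint.\<close>
      show "R \<subseteq> R' \<or> R' \<subseteq> R \<or> R \<inter> R' = {}"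
        using D(2)[unfolded cross_free_def, rule_format, OF i(1) j(1)] F(1)[OF DF[OF i(1)]] F(1)[OF DF[OF j(1)]]
        unfolding i(2) j(2) Q_def reg_def V_def by (cases "out \<in> D i"; cases "out \<in> D j") (simp_all, blast+)
    qed
    then show ?thesis using laminar_imp_packed card_image[OF inj] by fastforce
  qed
  ultimately show ?thesis using S(1,2) by blast
qed

end

definition ledges :: "grid_graph \<Rightarrow> ledge set" where
  "ledges G = {e. ends e \<in> edges G}"

lemma ends_star: "v \<in> ends e \<longleftrightarrow> e \<in> star v"
  by (cases e; cases v) auto

lemma ends_inj: "ends e = ends e' \<Longrightarrow> e = e'"
proof -
  assume a: "ends e = ends e'"
  obtain b x y b' x' y' where e: "e = (b, x, y)" "e' = (b', x', y')" by (cases e, cases e')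
  show "e = e'" using a unfolding e by (cases b; cases b') (auto simp: doubleton_eq_iff)
qed

lemma inj_ends: "inj ends"
  by (rule injI) (rule ends_inj)

lemma ex1_image:
  assumes "inj f"
  shows "(\<exists>!y. y \<in> f ` A \<and> P y) \<longleftrightarrow> (\<exists>!x. x \<in> A \<and> P (f x))"
  using assms unfolding Ex1_def inj_def by blast

lemma grid_edges:
  assumes "grid_subgraph G" "E \<in> edges G"
  shows "\<exists>e. E = ends e \<and> e \<in> ledges G" and "E \<subseteq> verts G"
proof -
  have "E \<in> {{u, v} | u v. u \<in> verts G \<and> v \<in> verts G \<and> grid_adjacent u v}"
    using assms unfolding grid_subgraph_def by (rule subsetD)
  then obtain u v where uv: "E = {u, v}" "u \<in> verts G" "v \<in> verts G" "grid_adjacent u v"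
    by blast
  obtain e where "{u, v} = ends e" using adjacent_imp_ends[OF uv(4)] by (elim exE)
  then have "E = ends e \<and> e \<in> ledges G" using assms(2) uv(1) by (simp only: ledges_def mem_Collect_eq)
  then show "\<exists>e. E = ends e \<and> e \<in> ledges G" ..
  show "E \<subseteq> verts G" using uv by auto
qed

lemma ledges_image: "grid_subgraph G \<Longrightarrow> ends ` ledges G = edges G"
proof (intro equalityI subsetI)
  fix E assume "grid_subgraph G" "E \<in> edges G"
  from grid_edges(1)[OF this] show "E \<in> ends ` ledges G" by (elim exE conjE) (simp only: imageI)
qed (auto simp: ledges_def simp del: ends.simps)

lemma polyomino_lattice_region:
  assumes G: "polyomino_graph G"
  shows "lattice_region (verts G) (ledges G)"
proof
  have sub: "grid_subgraph G" using G by (simp add: polyomino_graph_def)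
  show "(x, y) \<in> verts G \<and> (x + 1, y) \<in> verts G" if "(True, x, y) \<in> ledges G" for x y
    using that grid_edges(2)[OF sub, of "ends (True, x, y)"] by (auto simp: ledges_def)
  show "(x, y) \<in> verts G \<and> (x, y + 1) \<in> verts G" if "(False, x, y) \<in> ledges G" for x y
    using that grid_edges(2)[OF sub, of "ends (False, x, y)"] by (auto simp: ledges_def)
  show "finite (verts G)" using G by (simp add: polyomino_graph_def)
  have lg: "lattice_graph (verts G) (ledges G)"
    by standard fact+
  show "Q \<subseteq> lattice_graph.Sq (ledges G)"
    if "finite Q" "\<And>e. e \<notin> ledges G \<Longrightarrow> (upc e \<in> Q) = (dnc e \<in> Q)" for Q
  proof
    fix q assume q: "q \<in> Q"
    have "ends ` sides q \<subseteq> edges G"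
      by (rule polyomino_region[OF G that(1) _ q]) (use that(2) in \<open>auto simp: ledges_def\<close>)
    then show "q \<in> lattice_graph.Sq (ledges G)"
      unfolding lattice_graph.Sq_def[OF lg] unfolding ledges_def
      by (simp only: mem_Collect_eq subset_eq ball_simps)
  qed
qed

definition resonant :: "grid_graph \<Rightarrow> ledge set \<Rightarrow> cell set \<Rightarrow> bool" where
  "resonant G m K \<longleftrightarrow> perfect_matching G (ends ` m) \<and> m \<subseteq> ledges G \<and>
     finite K \<and> (\<forall>q\<in>K. sides q \<subseteq> ledges G) \<and> packed m K"

context
  fixes G :: grid_graph
  assumes G: "polyomino_graph G"
begin

interpretation lattice_region "verts G" "ledges G"
  by (rule polyomino_lattice_region[OF G])

lemma sub: "grid_subgraph G"
  using G by (simp add: polyomino_graph_def)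

lemma pm_iff: "m \<subseteq> ledges G \<Longrightarrow> perfect_matching G (ends ` m) \<longleftrightarrow> pm m"
proof -
  assume m: "m \<subseteq> ledges G"
  have "(\<exists>!e. e \<in> ends ` m \<and> v \<in> e) \<longleftrightarrow> (\<exists>!e. e \<in> m \<and> e \<in> star v)" for v
    unfolding ends_star[symmetric] by (rule ex1_image[OF inj_ends])
  moreover have "ends ` m \<subseteq> edges G" using m by (auto simp: ledges_def)
  ultimately show ?thesis using m by (simp add: perfect_matching_def pm_def)
qed

lemma matching_ledges:
  assumes "perfect_matching G M"
  shows "\<exists>m. m \<subseteq> ledges G \<and> M = ends ` m \<and> pm m"
proof -
  define m where "m = {e. ends e \<in> M}"
  have "M \<subseteq> edges G" using assms unfolding perfect_matching_def by blast
  then have m: "m \<subseteq> ledges G" unfolding m_def ledges_def by blast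
  have M: "M = ends ` m"
  proof (intro equalityI subsetI)
    fix E assume "E \<in> M"
    then show "E \<in> ends ` m" using grid_edges(1)[OF sub, of E] \<open>M \<subseteq> edges G\<close> unfolding m_def
      by (metis (mono_tags, lifting) image_eqI mem_Collect_eq subsetD)
  qed (auto simp: m_def simp del: ends.simps)
  then show ?thesis using m assms pm_iff[OF m] by (intro exI[of _ m]) simp
qed

lemma finite_edges: "finite (edges G)"
  using ledges_image[OF sub] finite_E by (metis finite_imageI)

text \<open>The minimum in \<open>forcing_number\<close> is taken over a finite nonempty set: a
  perfect matching forces itself, because any further edge would have an end that is covered
  already.\<close>

lemma forcing_sets_finite:
  assumes "perfect_matching G M"
  shows "finite (card ` {S. forcing_set G M S})" "M \<in> {S. forcing_set G M S}"
proof -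
  have M: "M \<subseteq> edges G" using assms by (simp add: perfect_matching_def)
  then have "{S. forcing_set G M S} \<subseteq> Pow (edges G)" unfolding forcing_set_def by blast
  then show "finite (card ` {S. forcing_set G M S})"
    using finite_edges finite_subset finite_Pow_iff by blast
  have "M' = M" if M': "perfect_matching G M'" "M \<subseteq> M'" for M'
  proof
    show "M' \<subseteq> M"
    proof
      fix e assume e: "e \<in> M'"
      then have eG: "e \<in> edges G" using M'(1) unfolding perfect_matching_def by blast
      obtain b x y where "e = ends (b, x, y)" using grid_edges(1)[OF sub eG] by (metis prod.exhaust)
      then have "(x, y) \<in> e" by simp
      then obtain v where v: "v \<in> e" "v \<in> verts G" using grid_edges(2)[OF sub eG] by blast
      then obtain e' where "e' \<in> M" "v \<in> e'" using assms unfolding perfect_matching_def by blast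
      then have "e = e'" using e v M' unfolding perfect_matching_def by blast
      then show "e \<in> M" using \<open>e' \<in> M\<close> by simp
    qed
  qed (rule M'(2))
  then show "M \<in> {S. forcing_set G M S}" unfolding forcing_set_def by blast
qed

text \<open>The resonant set may belong to another matching than \<open>M\<close>, which is good
  enough for the maximum over all matchings.\<close>

lemma forcing_number_le:
  assumes M: "perfect_matching G M"
  shows "\<exists>m K. resonant G m K \<and> forcing_number G M \<le> card K"
proof -
  obtain m where m: "m \<subseteq> ledges G" "M = ends ` m" "pm m" using matching_ledges[OF M] by (elim exE conjE)
  obtain S m' K where S: "S \<subseteq> m" "\<And>m''. pm m'' \<Longrightarrow> S \<subseteq> m'' \<Longrightarrow> m'' = m"
    and K: "pm m'" "finite K" "K \<subseteq> Sq" "packed m' K" "card S \<le> card K"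
    using forcing_bound[OF m(3)] by blast
  have "forcing_set G M (ends ` S)"
    unfolding forcing_set_def
  proof (intro conjI allI impI)
    show "ends ` S \<subseteq> M" unfolding m(2) by (rule image_mono[OF S(1)])
    fix M' assume M': "perfect_matching G M' \<and> ends ` S \<subseteq> M'"
    obtain m'' where m'': "m'' \<subseteq> ledges G" "M' = ends ` m''" "pm m''"
      using matching_ledges[OF conjunct1[OF M']] by (elim exE conjE)
    have "S \<subseteq> m''" using M' m''(2) inj_image_subset_iff[OF inj_ends] by simp
    then show "M' = M" using S(2)[OF m''(3)] m''(2) m(2) by simp
  qed
  then have "forcing_number G M \<le> card (ends ` S)"
    unfolding forcing_number_def using forcing_sets_finite[OF M] by (intro Min_le) auto
  also have "\<dots> \<le> card S"
    using finite_subset[OF subset_trans[OF S(1) m(1)] finite_E] by (rule card_image_le)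
  finally have "forcing_number G M \<le> card K" using K(5) by simp
  moreover have "m' \<subseteq> ledges G" using K(1) by (simp add: pm_def)
  then have "resonant G m' K"
    using K(1,2,4) K(3)[unfolded Sq_def, THEN subsetD] pm_iff[of m'] unfolding resonant_def by simp
  ultimately show ?thesis by blast
qed

text \<open>A forcing set must meet every cell of \<open>K\<close>, since switching a cell that it
  misses gives another perfect matching containing it. The cells share no edges, so these meetings
  are distinct.\<close>

lemma forcing_number_ge:
  assumes r: "resonant G m K"
  shows "card K \<le> forcing_number G (ends ` m)"
proof -
  have m: "m \<subseteq> ledges G" "pm m" and M: "perfect_matching G (ends ` m)" and finK: "finite K"
    and Ks: "\<And>q. q \<in> K \<Longrightarrow> sides q \<subseteq> ledges G" and pk: "packed m K"
    using r pm_iff[of m] unfolding resonant_def by simp_all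
  have "card K \<le> card S" if S: "forcing_set G (ends ` m) S" for S
  proof -
    define s where "s = {e \<in> m. ends e \<in> S}"
    have Ss: "S = ends ` s" using S unfolding forcing_set_def s_def by blast
    have fin: "finite s" by (rule finite_subset[OF _ finite_E]) (use m(1) in \<open>unfold s_def, blast\<close>)
    have hit: "\<exists>e. e \<in> s \<and> e \<in> sides q" if q: "q \<in> K" for q
    proof (rule ccontr)
      assume n: "\<nexists>e. e \<in> s \<and> e \<in> sides q"
      obtain t where t: "alt t m {q}" using pk q by (auto simp: packed_def altc_def)
      define m' where "m' = sym_diff m (sides q)"
      have "pm m'" using pm_flip[OF m(2) t] Ks[OF q] by (simp add: bdry_single m'_def)
      moreover have m'E: "m' \<subseteq> ledges G" using m(1) Ks[OF q] unfolding m'_def by blast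
      ultimately have "perfect_matching G (ends ` m')" using pm_iff[OF m'E] by simp
      moreover have "S \<subseteq> ends ` m'"
      proof -
        have "s \<subseteq> m" "s \<inter> sides q = {}" using n by (simp_all only: s_def) blast+
        then show ?thesis unfolding Ss m'_def by (intro image_mono) blast
      qed
      ultimately have "ends ` m' = ends ` m" using S by (simp add: forcing_set_def)
      then have "m' = m" using inj_image_eq_iff[OF inj_ends] by simp
      moreover have "sides q \<noteq> {}" by (cases q) simp
      ultimately show False unfolding m'_def by blast
    qed
    then obtain f where f: "\<And>q. q \<in> K \<Longrightarrow> f q \<in> s \<and> f q \<in> sides q" by metis
    have "inj_on f K"
    proof (rule inj_onI, rule ccontr)
      fix q q' assume "q \<in> K" "q' \<in> K" "f q = f q'" "q \<noteq> q'"
      then show False using f[of q] f[of q'] pk unfolding packed_def by (metis disjoint_iff)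
    qed
    then have "card K \<le> card s" by (rule card_inj_on_le) (use f fin in blast)+
    also have "\<dots> = card S" unfolding Ss by (rule card_image[symmetric]) (rule inj_on_subset[OF inj_ends subset_UNIV])
    finally show ?thesis .
  qed
  then show ?thesis
    unfolding forcing_number_def using forcing_sets_finite[OF M] by (subst Min_ge_iff) auto
qed

theorem max_forcing_number_eq:
  assumes ex: "resonant G m0 K0" "card K0 = N"
    and le: "\<And>m K. resonant G m K \<Longrightarrow> card K \<le> N"
  shows "max_forcing_number G = N"
proof -
  have "{M. perfect_matching G M} \<subseteq> Pow (edges G)" unfolding perfect_matching_def by blast
  then have fin: "finite {M. perfect_matching G M}" using finite_edges finite_subset finite_Pow_iff by blast
  have ub: "forcing_number G M \<le> N" if "perfect_matching G M" for M
    using forcing_number_le[OF that] le order_trans by blast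
  have M0: "perfect_matching G (ends ` m0)" using ex(1) by (simp add: resonant_def)
  have "N \<le> forcing_number G (ends ` m0)" using forcing_number_ge[OF ex(1)] ex(2) by simp
  then have "forcing_number G (ends ` m0) = N" using ub[OF M0] by simp
  then show ?thesis
    unfolding max_forcing_number_def using fin ub M0 by (intro Max_eqI) auto
qed

end

section \<open>Negative cycles, potentials and linear programming duality\<close>

section \<open>Minimum cost flows\<close>

locale arcs =
  fixes t h :: "'a \<Rightarrow> 'v" and c :: "'a \<Rightarrow> int"
begin

fun walk :: "'v \<Rightarrow> 'a list \<Rightarrow> 'v \<Rightarrow> bool" where
  "walk u [] v \<longleftrightarrow> u = v"
| "walk u (a # w) v \<longleftrightarrow> t a = u \<and> walk (h a) w v"

definition weight :: "'a list \<Rightarrow> int" where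
  "weight w = sum_list (map c w)"

definition satisfies :: "('v \<Rightarrow> int) \<Rightarrow> 'a set \<Rightarrow> bool" where
  "satisfies \<phi> R \<longleftrightarrow> (\<forall>a\<in>R. \<phi> (h a) \<le> \<phi> (t a) + c a)"

text \<open>Distinct heads imply distinct arcs, so pushing flow along the cycle depends only on the
  set of its arcs.\<close>

definition negative_cycle :: "'a list \<Rightarrow> bool" where
  "negative_cycle w \<longleftrightarrow> (\<exists>x. walk x w x) \<and> distinct (map h w) \<and> weight w < 0"

lemma walk_append: "walk u (w1 @ w2) v \<longleftrightarrow> (\<exists>x. walk u w1 x \<and> walk x w2 v)"
  by (induction w1 arbitrary: u) auto

lemma walk_split:
  assumes "walk u w v" "x \<in> set (u # map h w)"
  shows "\<exists>w1 w2. w = w1 @ w2 \<and> walk u w1 x \<and> walk x w2 v"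
  using assms
proof (induction w arbitrary: u)
  case Nil
  then show ?case by auto
next
  case (Cons a w)
  show ?case
  proof (cases "x = u")
    case True
    then show ?thesis using Cons.prems by (intro exI[of _ "[]"] exI[of _ "a # w"]) auto
  next
    case False
    then obtain w1 w2 where "w = w1 @ w2" "walk (h a) w1 x" "walk x w2 v"
      using Cons.IH[of "h a"] Cons.prems by auto
    then show ?thesis using Cons.prems by (intro exI[of _ "a # w1"] exI[of _ w2]) auto
  qed
qed

lemma walk_last: "walk u w v \<Longrightarrow> v \<in> set (u # map h w)"
  by (induction w arbitrary: u) auto

lemma walk_telescope: "walk u w v \<Longrightarrow> sum_list (map (\<lambda>a. \<phi> (h a) - \<phi> (t a)) w) = \<phi> v - (\<phi> u :: int)"
  by (induction w arbitrary: u) auto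

lemma satisfies_weight:
  assumes "satisfies \<phi> R" "set w \<subseteq> R" "walk u w v"
  shows "\<phi> v - \<phi> u \<le> weight w"
proof -
  have "sum_list (map (\<lambda>a. \<phi> (h a) - \<phi> (t a)) w) \<le> sum_list (map c w)"
    using assms(1,2) by (intro sum_list_mono) (force simp: satisfies_def algebra_simps)
  then show ?thesis using walk_telescope[OF assms(3), of \<phi>] by (simp add: weight_def)
qed

text \<open>The least weight of a simple walk to \<open>v\<close> is a potential.\<close>

lemma bounded_potential:
  assumes "finite R" "finite V" "h ` R \<subseteq> V" and C: "\<And>a. a \<in> R \<Longrightarrow> \<bar>c a\<bar> \<le> C"
    and "0 \<le> C" and no: "\<And>w. set w \<subseteq> R \<Longrightarrow> \<not> negative_cycle w"
  shows "\<exists>\<phi>. satisfies \<phi> R \<and> (\<forall>v. - (int (card V) * C) \<le> \<phi> v \<and> \<phi> v \<le> 0)"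
proof -
  define P where "P v = {w. set w \<subseteq> R \<and> (\<exists>u. walk u w v \<and> distinct (u # map h w))}" for v
  have len: "length w \<le> card V" if "w \<in> P v" for w v
  proof -
    have "length w = card (set (map h w))" using that distinct_card[of "map h w"] by (auto simp: P_def)
    also have "\<dots> \<le> card V" using that assms(2,3) by (intro card_mono) (auto simp: P_def)
    finally show ?thesis .
  qed
  have fin: "finite (P v)" for v
    by (rule finite_subset[OF _ finite_lists_length_le[OF assms(1), of "card V"]]) (use len in \<open>auto simp: P_def\<close>)
  have nil: "[] \<in> P v" for v by (simp add: P_def)
  define \<phi> where "\<phi> v = Min (weight ` P v)" for v
  have le: "\<phi> v \<le> weight w" if "w \<in> P v" for v w
    using fin that by (simp add: \<phi>_def)
  have att: "\<exists>w\<in>P v. \<phi> v = weight w" for v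
  proof -
    have "Min (weight ` P v) \<in> weight ` P v" using fin nil by (intro Min_in) auto
    then show ?thesis by (auto simp: \<phi>_def)
  qed
  have "satisfies \<phi> R"
    unfolding satisfies_def
  proof
    fix a assume a: "a \<in> R"
    obtain w where w: "w \<in> P (t a)" "\<phi> (t a) = weight w" using att by blast
    then obtain u where u: "set w \<subseteq> R" "walk u w (t a)" "distinct (u # map h w)" by (auto simp: P_def)
    show "\<phi> (h a) \<le> \<phi> (t a) + c a"
    proof (cases "h a \<in> set (u # map h w)")
      case False
      then have "w @ [a] \<in> P (h a)" using a u by (auto simp: P_def walk_append intro!: exI[of _ u])
      then have "\<phi> (h a) \<le> weight (w @ [a])" by (rule le)
      then show ?thesis using w(2) by (simp add: weight_def)
    next
      \<comment> \<open>The walk \<open>w\<close> visits \<open>h a\<close> already. Its final part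
        \<open>w2\<close> followed by \<open>a\<close> is a cycle of nonnegative weight, and its
        initial part \<open>w1\<close> competes for the minimum at \<open>h a\<close>.\<close>
      case True
      then obtain w1 w2 where s: "w = w1 @ w2" "walk u w1 (h a)" "walk (h a) w2 (t a)"
        using walk_split[OF u(2)] by blast
      have "w1 \<in> P (h a)" using u s by (auto simp: P_def intro!: exI[of _ u])
      then have 1: "\<phi> (h a) \<le> weight w1" by (rule le)
      have "h a \<notin> set (map h w2)" using walk_last[OF s(2)] u(3) s(1) by auto
      then have "distinct (map h (w2 @ [a]))" using u(3) s(1) by auto
      moreover have "walk (h a) (w2 @ [a]) (h a)" using s(3) by (simp add: walk_append)
      ultimately have "weight (w2 @ [a]) \<ge> 0"
        using no[of "w2 @ [a]"] a u(1) s(1) by (auto simp: negative_cycle_def not_less)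
      then show ?thesis using 1 w(2) s(1) by (simp add: weight_def)
    qed
  qed
  moreover have "- (int (card V) * C) \<le> \<phi> v \<and> \<phi> v \<le> 0" for v
  proof
    show "\<phi> v \<le> 0" using le[OF nil, of v] by (simp add: weight_def)
    obtain w where w: "w \<in> P v" "\<phi> v = weight w" using att by blast
    have b: "- (int (length w) * C) \<le> weight w" if "set w \<subseteq> R" for w
      using that
    proof (induction w)
      case (Cons a w)
      then have "- C \<le> c a" using C[of a] by auto
      then show ?case using Cons by (simp add: weight_def algebra_simps)
    qed (simp add: weight_def)
    have "int (length w) * C \<le> int (card V) * C"
      using len[OF w(1)] \<open>0 \<le> C\<close> by (intro mult_right_mono) auto
    moreover have "set w \<subseteq> R" using w(1) by (simp add: P_def)
    ultimately show "- (int (card V) * C) \<le> \<phi> v" using b[of w] w(2) by linarith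
  qed
  ultimately show ?thesis by blast
qed

text \<open>Without a negative cycle, the potential of \<open>bounded_potential\<close> shifted by
  \<open>B\<close> would be a solution in the range. An arc off the cycle could be removed without
  destroying the cycle, so what remains would have no potential, contrary to minimality.\<close>

lemma minimal_infeasible:
  assumes "finite R" "finite V" "h ` R \<subseteq> V" and C: "\<And>a. a \<in> R \<Longrightarrow> \<bar>c a\<bar> \<le> C"
    and "0 \<le> C" and B: "int (card V) * C \<le> B"
    and inf: "\<And>\<phi>. \<lbrakk>satisfies \<phi> R; \<And>v. 0 \<le> \<phi> v \<and> \<phi> v \<le> B\<rbrakk> \<Longrightarrow> False"
    and min: "\<And>a. a \<in> R \<Longrightarrow> \<exists>\<phi>. satisfies \<phi> (R - {a})"
  shows "\<exists>w. negative_cycle w \<and> set w = R"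
proof -
  have "\<exists>w. set w \<subseteq> R \<and> negative_cycle w"
  proof (rule ccontr)
    assume "\<nexists>w. set w \<subseteq> R \<and> negative_cycle w"
    then obtain \<phi> where \<phi>: "satisfies \<phi> R" "\<And>v. - (int (card V) * C) \<le> \<phi> v \<and> \<phi> v \<le> 0"
      using bounded_potential[of R V C] assms(1-5) by blast
    show False
    proof (rule inf[of "\<lambda>v. \<phi> v + B"])
      show "satisfies (\<lambda>v. \<phi> v + B) R" using \<phi>(1) by (simp add: satisfies_def)
      show "0 \<le> \<phi> v + B \<and> \<phi> v + B \<le> B" for v using \<phi>(2)[of v] B by linarith
    qed
  qed
  then obtain w where w: "set w \<subseteq> R" "negative_cycle w" by blast
  have "a \<in> set w" if a: "a \<in> R" for a
  proof (rule ccontr)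
    assume "a \<notin> set w"
    obtain \<phi> where "satisfies \<phi> (R - {a})" using min[OF a] by blast
    moreover have "set w \<subseteq> R - {a}" using w(1) \<open>a \<notin> set w\<close> by blast
    moreover obtain x where "walk x w x" "weight w < 0" using w(2) by (auto simp: negative_cycle_def)
    ultimately show False using satisfies_weight[of \<phi> "R - {a}" w x x] by simp
  qed
  then show ?thesis using w by blast
qed

end

text \<open>Constraints \<open>\<psi> (H i) - \<psi> (T i) \<le> C i\<close>, with equality if \<open>fr i\<close>, and the dual problem of
  finding a cheapest flow. The arcs \<open>j < n\<close> of the residual graph are the constraints, the arc
  \<open>j + n\<close> is the reverse of \<open>j\<close>.\<close>

locale flow_problem =
  fixes n :: nat and T H :: "nat \<Rightarrow> nat" and C :: "nat \<Rightarrow> int" and fr :: "nat \<Rightarrow> bool"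
    and \<beta> :: "(nat \<Rightarrow> int) \<Rightarrow> int"
begin

definition rt :: "nat \<Rightarrow> nat" where "rt j = (if j < n then T j else H (j - n))"
definition rh :: "nat \<Rightarrow> nat" where "rh j = (if j < n then H j else T (j - n))"
definition rc :: "nat \<Rightarrow> int" where "rc j = (if j < n then C j else - C (j - n))"

sublocale arcs rt rh rc .

definition feasible :: "(nat \<Rightarrow> int) \<Rightarrow> bool" where
  "feasible \<psi> \<longleftrightarrow> (\<forall>i<n. \<psi> (H i) - \<psi> (T i) \<le> C i \<and> (fr i \<longrightarrow> \<psi> (H i) - \<psi> (T i) = C i))"

text \<open>Conservation is stated by duality: paired with the differences of any potential, the
  flow yields the objective. No balances at nodes have to be written out.\<close>

definition flow :: "(nat \<Rightarrow> int) \<Rightarrow> bool" where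
  "flow u \<longleftrightarrow> (\<forall>i<n. \<not> fr i \<longrightarrow> 0 \<le> u i) \<and> (\<forall>\<phi>. (\<Sum>i<n. u i * (\<phi> (H i) - \<phi> (T i))) = \<beta> \<phi>)"

definition flow_cost :: "(nat \<Rightarrow> int) \<Rightarrow> int" where
  "flow_cost u = (\<Sum>i<n. C i * u i)"

definition residual :: "(nat \<Rightarrow> int) \<Rightarrow> nat set" where
  "residual u = {j. j < n \<or> n \<le> j \<and> j < 2 * n \<and> (fr (j - n) \<or> 0 < u (j - n))}"

lemma weak_duality:
  assumes "flow u" "feasible \<psi>"
  shows "\<beta> \<psi> \<le> flow_cost u"
proof -
  have "\<beta> \<psi> = (\<Sum>i<n. u i * (\<psi> (H i) - \<psi> (T i)))" using assms(1) by (simp add: flow_def)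
  also have "\<dots> \<le> (\<Sum>i<n. C i * u i)"
  proof (rule sum_mono)
    fix i assume i: "i \<in> {..<n}"
    show "u i * (\<psi> (H i) - \<psi> (T i)) \<le> C i * u i"
    proof (cases "fr i")
      case True
      then show ?thesis using i assms(2) by (simp add: feasible_def)
    next
      case False
      then have "0 \<le> u i" using i assms(1) by (simp add: flow_def)
      moreover have "\<psi> (H i) - \<psi> (T i) \<le> C i" using i assms(2) by (simp add: feasible_def)
      ultimately show ?thesis unfolding mult.commute[of "C i"] by (intro mult_left_mono)
    qed
  qed
  finally show ?thesis by (simp add: flow_cost_def)
qed

lemma residual_feasible:
  assumes \<phi>: "satisfies \<phi> (residual u)"
  shows "feasible \<phi>"
  unfolding feasible_def
proof (intro allI impI conjI)
  fix i assume i: "i < n"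
  have "i \<in> residual u" using i by (simp add: residual_def)
  then show 1: "\<phi> (H i) - \<phi> (T i) \<le> C i" using \<phi> i by (auto simp: satisfies_def rh_def rt_def rc_def)
  assume "fr i"
  then have "i + n \<in> residual u" using i by (simp add: residual_def)
  then have "\<phi> (rh (i + n)) \<le> \<phi> (rt (i + n)) + rc (i + n)" using \<phi> by (simp add: satisfies_def)
  then show "\<phi> (H i) - \<phi> (T i) = C i" using 1 by (simp add: rh_def rt_def rc_def)
qed

text \<open>Complementary slackness: free arcs and arcs with positive flow are residual in both
  directions, which forces equality in their constraints.\<close>

lemma residual_optimal:
  assumes u: "flow u" and \<phi>: "satisfies \<phi> (residual u)"
  shows "flow_cost u = \<beta> \<phi>"
proof -
  have "u i * (\<phi> (H i) - \<phi> (T i)) = C i * u i" if i: "i < n" for i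
  proof (cases "fr i \<or> 0 < u i")
    case True
    have "\<phi> (rh i) \<le> \<phi> (rt i) + rc i" "\<phi> (rh (i + n)) \<le> \<phi> (rt (i + n)) + rc (i + n)"
      using \<phi> i True by (simp_all add: satisfies_def residual_def)
    then have "\<phi> (H i) - \<phi> (T i) = C i" using i by (simp add: rh_def rt_def rc_def)
    then show ?thesis by simp
  next
    case False
    then have "u i = 0" using u i by (force simp: flow_def)
    then show ?thesis by simp
  qed
  then have "flow_cost u = (\<Sum>i<n. u i * (\<phi> (H i) - \<phi> (T i)))" unfolding flow_cost_def
    by (intro sum.cong) (simp_all only: lessThan_iff)
  then show ?thesis using u by (simp add: flow_def)
qed

definition augment :: "(nat \<Rightarrow> int) \<Rightarrow> nat set \<Rightarrow> nat \<Rightarrow> int" where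
  "augment u R i = u i + of_bool (i \<in> R) - of_bool (i + n \<in> R)"

lemma augment_sum:
  assumes "R \<subseteq> {..<2 * n}"
  shows "(\<Sum>i<n. (of_bool (i \<in> R) - of_bool (i + n \<in> R)) * (g i :: int)) =
    (\<Sum>j\<in>R. if j < n then g j else - g (j - n))"
proof -
  let ?f = "\<lambda>j. if j < n then g j else - g (j - n)"
  have "(\<Sum>j\<in>R. ?f j) = (\<Sum>j<2 * n. of_bool (j \<in> R) * ?f j)"
    using assms by (intro sum.mono_neutral_cong_left) auto
  also have "\<dots> = (\<Sum>j<n. of_bool (j \<in> R) * ?f j) + (\<Sum>j=n..<2 * n. of_bool (j \<in> R) * ?f j)"
    by (subst sum.union_disjoint[symmetric]) (auto intro!: sum.cong)
  also have "(\<Sum>j=n..<2 * n. of_bool (j \<in> R) * ?f j) = (\<Sum>i<n. of_bool (i + n \<in> R) * ?f (i + n))"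
    using sum.shift_bounds_nat_ivl[of "\<lambda>j. of_bool (j \<in> R) * ?f j" 0 n n]
    by (simp add: atLeast0LessThan mult_2)
  finally have "(\<Sum>j\<in>R. ?f j) = (\<Sum>i<n. of_bool (i \<in> R) * ?f i + of_bool (i + n \<in> R) * ?f (i + n))"
    by (simp only: sum.distrib)
  also have "\<dots> = (\<Sum>i<n. (of_bool (i \<in> R) - of_bool (i + n \<in> R)) * g i)"
    by (intro sum.cong) (auto simp: algebra_simps)
  finally show ?thesis ..
qed

text \<open>Along a closed walk the pairing with any potential telescopes to zero, and the cost
  changes by the weight of the walk. A reversed arc that is not free carries positive integral flow,
  so one unit can be taken away.\<close>

lemma augment_flow:
  assumes u: "flow u" and w: "negative_cycle w" "set w \<subseteq> residual u"
  shows "flow (augment u (set w))" and "flow_cost (augment u (set w)) < flow_cost u"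
proof -
  let ?R = "set w"
  have R: "?R \<subseteq> {..<2 * n}" using w(2) by (auto simp: residual_def)
  obtain x where x: "walk x w x" "weight w < 0" and d: "distinct w"
    using w(1) distinct_map by (auto simp: negative_cycle_def)
  have split: "(\<Sum>i<n. augment u ?R i * g i) = (\<Sum>i<n. u i * g i) + (\<Sum>j\<in>?R. if j < n then g j else - g (j - n))" for g
    unfolding augment_sum[OF R, symmetric] by (simp add: augment_def sum.distrib[symmetric] algebra_simps)
  have "(\<Sum>j\<in>?R. if j < n then \<phi> (H j) - \<phi> (T j) else - (\<phi> (H (j - n)) - \<phi> (T (j - n)))) = 0" for \<phi> :: "nat \<Rightarrow> int"
  proof -
    have "(\<Sum>j\<in>?R. if j < n then \<phi> (H j) - \<phi> (T j) else - (\<phi> (H (j - n)) - \<phi> (T (j - n)))) =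
        (\<Sum>j\<in>?R. \<phi> (rh j) - \<phi> (rt j))"
      by (intro sum.cong) (auto simp: rh_def rt_def)
    also have "\<dots> = sum_list (map (\<lambda>j. \<phi> (rh j) - \<phi> (rt j)) w)" using d by (rule sum.distinct_set_conv_list)
    also have "\<dots> = 0" using walk_telescope[OF x(1), of \<phi>] by simp
    finally show ?thesis .
  qed
  moreover have "0 \<le> augment u ?R i" if "i < n" "\<not> fr i" for i
  proof -
    have "0 \<le> u i" using u that by (simp add: flow_def)
    moreover have "i + n \<in> ?R \<Longrightarrow> 0 < u i" using w(2) that by (auto simp: residual_def)
    ultimately show ?thesis by (auto simp: augment_def)
  qed
  ultimately show "flow (augment u ?R)" using u unfolding flow_def split by simp
  have "flow_cost (augment u ?R) = flow_cost u + (\<Sum>j\<in>?R. if j < n then C j else - C (j - n))"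
    using split[of C] by (simp add: flow_cost_def mult.commute)
  also have "(\<Sum>j\<in>?R. if j < n then C j else - C (j - n)) = (\<Sum>j\<in>?R. rc j)"
    by (intro sum.cong) (auto simp: rc_def)
  also have "\<dots> = weight w" unfolding weight_def using d by (rule sum.distinct_set_conv_list)
  finally show "flow_cost (augment u ?R) < flow_cost u" using x(2) by simp
qed

end

section \<open>Resonant sets as solutions of difference constraints\<close>

section \<open>Resonant sets as potentials\<close>

text \<open>The lattice points of a square window around the region, numbered row by row. Since the row
  length \<open>W\<close> is odd, the colour of a lattice point is the parity of its number, and the neighbours
  of \<open>p\<close> are \<open>p \<plusminus> 1\<close> and \<open>p \<plusminus> W\<close>.\<close>

locale indexed_region = lattice_region +
  fixes x0 y0 :: int and n :: nat
  assumes window: "(x, y) \<in> Vt \<Longrightarrow> \<bar>x - x0\<bar> < int n \<and> \<bar>y - y0\<bar> < int n"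
begin

text \<open>Coordinates relative to the first vertex are shifted by \<open>n + 1\<close>, so
  vertices have row and column numbers from 2 to \<open>2 * n\<close> out of
  \<open>0..2 * n + 2\<close>. This leaves a margin of two on every side.\<close>

definition W :: nat where "W = 2 * n + 3"
definition P :: nat where "P = W * W"

definition cell_of :: "nat \<Rightarrow> cell" where
  "cell_of p = (int (p mod W) + x0 - int n - 1, int (p div W) + y0 - int n - 1)"

definition idx :: "cell \<Rightarrow> nat" where
  "idx q = nat (fst q - x0 + int n + 1) + W * nat (snd q - y0 + int n + 1)"

definition vx :: "nat \<Rightarrow> bool" where "vx p \<longleftrightarrow> cell_of p \<in> Vt"
definition eh :: "nat \<Rightarrow> bool" where "eh p \<longleftrightarrow> (True, cell_of p) \<in> E"
definition ev :: "nat \<Rightarrow> bool" where "ev p \<longleftrightarrow> (False, cell_of p) \<in> E"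
definition sq :: "nat \<Rightarrow> bool" where "sq p \<longleftrightarrow> cell_of p \<in> Sq"

lemma W_pos: "0 < W" "odd W" "1 < W" by (simp_all add: W_def)

lemma cell_of_idx:
  assumes "\<bar>x - x0\<bar> < int n + 2" "\<bar>y - y0\<bar> < int n + 2"
  shows "cell_of (idx (x, y)) = (x, y)"
proof -
  have nn: "0 \<le> x - x0 + int n + 1" "0 \<le> y - y0 + int n + 1" "x - x0 + int n + 1 < int W"
    using assms by (simp_all add: W_def abs_less_iff)
  then have "nat (x - x0 + int n + 1) < W" by linarith
  then have "idx (x, y) mod W = nat (x - x0 + int n + 1)" "idx (x, y) div W = nat (y - y0 + int n + 1)"
    using W_pos(1) by (simp_all add: idx_def)
  then show ?thesis using nn by (simp add: cell_of_def)
qed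

lemma idx_cell_of: "idx (cell_of p) = p"
  by (simp add: cell_of_def idx_def)

lemma cell_of_inj: "cell_of p = cell_of q \<Longrightarrow> p = q"
  by (metis idx_cell_of)

lemma cell_of_W: "cell_of (p + W) = (fst (cell_of p), snd (cell_of p) + 1)"
  using W_pos by (simp add: cell_of_def)

lemma cell_of_Suc: "p mod W < W - 1 \<Longrightarrow> cell_of (p + 1) = (fst (cell_of p) + 1, snd (cell_of p))"
proof -
  assume "p mod W < W - 1"
  then have "(p + 1) mod W = p mod W + 1" using W_pos by (simp add: mod_Suc)
  moreover have "(p + 1) div W = p div W" using \<open>p mod W < W - 1\<close> W_pos by (simp add: div_Suc mod_Suc)
  ultimately show ?thesis by (simp add: cell_of_def)
qed

lemma vx_window:
  assumes "vx p"
  shows "2 \<le> p mod W" "p mod W \<le> 2 * n" "2 \<le> p div W" "p div W \<le> 2 * n"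
proof -
  have "\<bar>int (p mod W) - int n - 1\<bar> < int n \<and> \<bar>int (p div W) - int n - 1\<bar> < int n"
    using assms window[of "fst (cell_of p)" "snd (cell_of p)"]
    by (simp add: vx_def cell_of_def algebra_simps)
  then show "2 \<le> p mod W" "p mod W \<le> 2 * n" "2 \<le> p div W" "p div W \<le> 2 * n"
    by linarith+
qed

lemma vx_bounds:
  assumes "vx p"
  shows "2 * W + 2 \<le> p" "p + W + 1 < P"
proof -
  have p: "p = W * (p div W) + p mod W" by simp
  have "W * 2 \<le> W * (p div W)" using vx_window[OF assms] by (intro mult_le_mono2)
  then show "2 * W + 2 \<le> p" using p vx_window(1)[OF assms] by linarith
  have "W * (p div W) \<le> W * (2 * n)" using vx_window[OF assms] by (intro mult_le_mono2)
  then have "p \<le> W * (2 * n) + 2 * n" using p vx_window(2)[OF assms] by linarith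
  moreover have "P = W * (2 * n) + W * 3" by (simp add: P_def W_def algebra_simps)
  moreover have "2 * n + 1 < W" by (simp add: W_def)
  ultimately show "p + W + 1 < P" by linarith
qed

text \<open>The margin excludes a wrap-around at the ends of the rows.\<close>

lemma vx_neighbours:
  assumes "vx p"
  shows "cell_of (p + 1) = (fst (cell_of p) + 1, snd (cell_of p))"
    "cell_of (p - 1) = (fst (cell_of p) - 1, snd (cell_of p))"
    "cell_of (p + W) = (fst (cell_of p), snd (cell_of p) + 1)"
    "cell_of (p - W) = (fst (cell_of p), snd (cell_of p) - 1)"
    "cell_of (p - 1 - W) = (fst (cell_of p) - 1, snd (cell_of p) - 1)"
    "cell_of (p + W + 1) = (fst (cell_of p) + 1, snd (cell_of p) + 1)"
proof -
  have m: "p mod W < W - 1" using vx_window(2)[OF assms] by (simp add: W_def)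
  then show "cell_of (p + 1) = (fst (cell_of p) + 1, snd (cell_of p))" by (rule cell_of_Suc)
  show "cell_of (p + W) = (fst (cell_of p), snd (cell_of p) + 1)" by (rule cell_of_W)
  then show "cell_of (p + W + 1) = (fst (cell_of p) + 1, snd (cell_of p) + 1)"
    using cell_of_Suc[of "p + W"] m by simp
  have pd: "p - 1 = W * (p div W) + (p mod W - 1)"
    using vx_window(1)[OF assms] mult_div_mod_eq[of W p] by linarith
  moreover have lt: "p mod W - 1 < W" using m by linarith
  ultimately have "(p - 1) mod W = p mod W - 1" "(p - 1) div W = p div W"
    by (metis mod_mult_self4 mod_less, metis lt W_pos(1) add_0_right div_less div_mult_self4 less_irrefl)
  then show left: "cell_of (p - 1) = (fst (cell_of p) - 1, snd (cell_of p))"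
    using vx_window(1)[OF assms] by (simp add: cell_of_def)
  show "cell_of (p - W) = (fst (cell_of p), snd (cell_of p) - 1)"
    using cell_of_W[of "p - W"] vx_bounds(1)[OF assms] by (simp add: prod_eq_iff)
  show "cell_of (p - 1 - W) = (fst (cell_of p) - 1, snd (cell_of p) - 1)"
    using cell_of_W[of "p - 1 - W"] vx_bounds(1)[OF assms] left by (simp add: prod_eq_iff)
qed

lemma vx_eh: "eh p \<Longrightarrow> vx p \<and> vx (p + 1)"
proof -
  assume e: "eh p"
  obtain x y where xy: "cell_of p = (x, y)" by (cases "cell_of p")
  have v: "(x, y) \<in> Vt \<and> (x + 1, y) \<in> Vt" using e E_h[of x y] by (simp add: eh_def xy)
  then have "vx p" by (simp add: vx_def xy)
  then show ?thesis using v vx_neighbours(1)[of p] by (simp add: vx_def xy)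
qed

lemma vx_ev: "ev p \<Longrightarrow> vx p \<and> vx (p + W)"
proof -
  assume e: "ev p"
  obtain x y where xy: "cell_of p = (x, y)" by (cases "cell_of p")
  have v: "(x, y) \<in> Vt \<and> (x, y + 1) \<in> Vt" using e E_v[of x y] by (simp add: ev_def xy)
  then have "vx p" by (simp add: vx_def xy)
  then show ?thesis using v vx_neighbours(3)[of p] by (simp add: vx_def xy)
qed

lemma sq_iff: "sq p \<longleftrightarrow> eh p \<and> eh (p + W) \<and> ev p \<and> ev (p + 1)"
proof -
  obtain x y where xy: "cell_of p = (x, y)" by (cases "cell_of p")
  show ?thesis
  proof (cases "vx p")
    case True
    then show ?thesis using vx_neighbours[OF True] by (auto simp: sq_def Sq_def eh_def ev_def xy)
  next
    case False
    then have "\<not> eh p" using vx_eh by blast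
    then show ?thesis by (simp add: sq_def Sq_def eh_def xy)
  qed
qed

lemma sq_corners: "sq p \<Longrightarrow> vx p \<and> vx (p + 1) \<and> vx (p + W) \<and> vx (p + W + 1)"
  using vx_eh[of p] vx_eh[of "p + W"] by (auto simp: sq_iff)

text \<open>Together with cost 0 on vertical edges, the costs of the edges at any vertex add up to 1 as for a
  perfect matching. So a perfect matching minus the costs is the difference of a height function.\<close>

primrec cst :: "nat \<Rightarrow> int" where
  "cst 0 = of_bool (vx 0)"
| "cst (Suc p) = of_bool (vx (Suc p)) - cst p"

text \<open>The node \<open>p\<close> carries the height on cell \<open>p\<close>, or the lower one of two heights if the cell is a
  square that may be alternating. Then \<open>p + P\<close> carries the upper one. The constraints require that all
  choices between the two give edges with values \<open>\<ge> 0\<close>, and value 0 on edges that are not in \<open>E\<close>.\<close>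

definition nb :: "nat \<Rightarrow> nat" where "nb p = (if sq p then p + P else p)"
definition lH :: "nat \<Rightarrow> nat" where "lH p = (if even p then p else p - W)"
definition rH :: "nat \<Rightarrow> nat" where "rH p = (if even p then p - W else p)"
definition lV :: "nat \<Rightarrow> nat" where "lV p = (if even p then p - 1 else p)"
definition rV :: "nat \<Rightarrow> nat" where "rV p = (if even p then p else p - 1)"

text \<open>Three blocks of \<open>P\<close> constraints: horizontal edges, vertical edges, and
  lower height at most upper height. An edge takes the lower height on its left and the upper one on
  its right, which is the choice with the least value. For a cell that is no square the third
  constraint is trivial.\<close>

definition tail :: "nat \<Rightarrow> nat" where
  "tail i = (if i < P then lH i else if i < 2 * P then lV (i - P) else nb (i - 2 * P))"
definition head :: "nat \<Rightarrow> nat" where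
  "head i = (if i < P then nb (rH i) else if i < 2 * P then nb (rV (i - P)) else i - 2 * P)"
definition acost :: "nat \<Rightarrow> int" where
  "acost i = (if i < P then cst i else 0)"
definition free :: "nat \<Rightarrow> bool" where
  "free i \<longleftrightarrow> (if i < P then \<not> eh i else i < 2 * P \<and> \<not> ev (i - P))"
definition gain :: "(nat \<Rightarrow> int) \<Rightarrow> int" where
  "gain \<phi> = (\<Sum>p<P. \<phi> (nb p) - \<phi> p)"

sublocale flow_problem "3 * P" tail head acost free gain .

lemma cst_bound: "\<bar>cst p\<bar> \<le> int p + 1"
  by (induction p) auto

lemma cst_zero: "p < 2 * W \<Longrightarrow> cst p = 0"
proof (induction p)
  case 0
  then show ?case using vx_bounds(1)[of 0] by auto
next
  case (Suc p)
  then show ?case using vx_bounds(1)[of "Suc p"] by auto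
qed

lemma cst_vertex: "0 < p \<Longrightarrow> cst p + cst (p - 1) = of_bool (vx p)"
  by (cases p) simp_all

lemma split3:
  fixes f :: "nat \<Rightarrow> int"
  shows "(\<Sum>i<3 * P. f i) = (\<Sum>p<P. f p) + (\<Sum>p<P. f (p + P)) + (\<Sum>p<P. f (p + 2 * P))"
proof -
  have "(\<Sum>i<3 * P. f i) = (\<Sum>i<P. f i) + (\<Sum>i=P..<2 * P. f i) + (\<Sum>i=2 * P..<3 * P. f i)"
    by (subst sum.union_disjoint[symmetric]; (subst sum.union_disjoint[symmetric])?) (auto intro!: sum.cong)
  also have "(\<Sum>i=P..<2 * P. f i) = (\<Sum>p<P. f (p + P))"
    using sum.shift_bounds_nat_ivl[of f 0 P P] by (simp add: atLeast0LessThan mult_2)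
  also have "(\<Sum>i=2 * P..<3 * P. f i) = (\<Sum>p<P. f (p + 2 * P))"
    using sum.shift_bounds_nat_ivl[of f 0 "2 * P" P] by (simp add: atLeast0LessThan)
  finally show ?thesis .
qed

text \<open>Adding the edge constraints around each vertex yields the height gap of every square
  four times, once for each corner. The gain counts it once, so the third block of constraints is
  used with multiplicity 3.\<close>

definition flow0 :: "nat \<Rightarrow> int" where
  "flow0 i = (if i < P then of_bool (vx i) + of_bool (vx (i + 1))
     else if i < 2 * P then of_bool (vx (i - P)) + of_bool (vx (i - P + W)) else 3)"

lemma shift_sum:
  fixes v g :: "nat \<Rightarrow> int"
  assumes "\<And>p. p < k \<Longrightarrow> v p = 0" "\<And>p. P \<le> p \<Longrightarrow> v p = 0"
  shows "(\<Sum>p<P. v (p + k) * g p) = (\<Sum>p<P. v p * g (p - k))"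
proof -
  have "(\<Sum>p<P. v (p + k) * g p) = (\<Sum>p=k..<P + k. v p * g (p - k))"
    using sum.shift_bounds_nat_ivl[of "\<lambda>p. v p * g (p - k)" 0 k P] by (simp add: atLeast0LessThan)
  also have "\<dots> = (\<Sum>p<P + k. v p * g (p - k))"
    by (rule sum.mono_neutral_left) (auto simp: assms(1))
  also have "\<dots> = (\<Sum>p<P. v p * g (p - k))"
    by (rule sum.mono_neutral_right) (auto simp: assms(2) not_less)
  finally show ?thesis .
qed

text \<open>Each of the four cells around a vertex lies to the right of one edge at the vertex and
  to the left of another, so upper and lower heights pair up.\<close>

lemma star_gain:
  fixes \<phi> :: "nat \<Rightarrow> int"
  assumes "W < p"
  shows "(\<phi> (nb (rH p)) - \<phi> (lH p)) + (\<phi> (nb (rH (p - 1))) - \<phi> (lH (p - 1))) +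
      (\<phi> (nb (rV p)) - \<phi> (lV p)) + (\<phi> (nb (rV (p - W))) - \<phi> (lV (p - W))) =
    (\<phi> (nb p) - \<phi> p) + (\<phi> (nb (p - 1)) - \<phi> (p - 1)) + (\<phi> (nb (p - W)) - \<phi> (p - W)) +
      (\<phi> (nb (p - 1 - W)) - \<phi> (p - 1 - W))"
proof -
  have "even (p - 1) \<longleftrightarrow> odd p" "even (p - W) \<longleftrightarrow> odd p" "p - W - 1 = p - 1 - W"
    using assms W_pos by auto
  then show ?thesis by (auto simp: lH_def rH_def lV_def rV_def)
qed

lemma flow0: "flow flow0"
proof -
  let ?v = "\<lambda>p. of_bool (vx p) :: int"
  have lo: "?v p = 0" if "p < 2 * W + 2" for p using vx_bounds(1)[of p] that by auto
  have hi: "?v p = 0" if "P \<le> p" for p using vx_bounds(2)[of p] that by auto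
  have "(\<Sum>i<3 * P. flow0 i * (\<phi> (head i) - \<phi> (tail i))) = gain \<phi>" for \<phi> :: "nat \<Rightarrow> int"
  proof -
    define fH where "fH p = \<phi> (nb (rH p)) - \<phi> (lH p)" for p
    define fV where "fV p = \<phi> (nb (rV p)) - \<phi> (lV p)" for p
    define D where "D p = \<phi> (nb p) - \<phi> p" for p
    have "(\<Sum>i<3 * P. flow0 i * (\<phi> (head i) - \<phi> (tail i))) =
      (\<Sum>p<P. (?v p + ?v (p + 1)) * fH p) + (\<Sum>p<P. (?v p + ?v (p + W)) * fV p) + (\<Sum>p<P. 3 * (- D p))"
      unfolding split3
      by (intro arg_cong2[where f = "(+)"] sum.cong refl) (simp_all add: flow0_def head_def tail_def fH_def fV_def D_def)
    also have "(\<Sum>p<P. (?v p + ?v (p + 1)) * fH p) = (\<Sum>p<P. ?v p * fH p) + (\<Sum>p<P. ?v p * fH (p - 1))"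
      using shift_sum[of 1 ?v fH] lo hi by (simp add: distrib_right sum.distrib)
    also have "(\<Sum>p<P. (?v p + ?v (p + W)) * fV p) = (\<Sum>p<P. ?v p * fV p) + (\<Sum>p<P. ?v p * fV (p - W))"
      using shift_sum[of W ?v fV] lo hi by (simp add: distrib_right sum.distrib)
    also have "(\<Sum>p<P. ?v p * fH p) + (\<Sum>p<P. ?v p * fH (p - 1)) + ((\<Sum>p<P. ?v p * fV p) + (\<Sum>p<P. ?v p * fV (p - W)))
      = (\<Sum>p<P. ?v p * (D p + D (p - 1) + D (p - W) + D (p - 1 - W)))"
    proof -
      have "?v p * fH p + ?v p * fH (p - 1) + (?v p * fV p + ?v p * fV (p - W)) =
          ?v p * (D p + D (p - 1) + D (p - W) + D (p - 1 - W))" for p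
      proof (cases "W < p")
        case True
        show ?thesis using star_gain[OF True, of \<phi>] by (simp add: fH_def fV_def D_def algebra_simps)
      next
        case False
        then show ?thesis using lo[of p] by simp
      qed
      then show ?thesis by (simp only: sum.distrib[symmetric])
    qed
    also have "\<dots> = (\<Sum>p<P. ?v p * D p) + (\<Sum>p<P. ?v (p + 1) * D p) + (\<Sum>p<P. ?v (p + W) * D p) + (\<Sum>p<P. ?v (p + (W + 1)) * D p)"
      using shift_sum[of 1 ?v D] shift_sum[of W ?v D] shift_sum[of "W + 1" ?v D] lo hi
      by (simp add: distrib_left sum.distrib)
    also have "\<dots> = (\<Sum>p<P. 4 * D p)"
    proof -
      have "?v p * D p + ?v (p + 1) * D p + ?v (p + W) * D p + ?v (p + (W + 1)) * D p = 4 * D p" for p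
        using sq_corners[of p] by (cases "sq p") (simp_all add: D_def nb_def add.assoc)
      then show ?thesis by (simp only: sum.distrib[symmetric])
    qed
    finally have "(\<Sum>i<3 * P. flow0 i * (\<phi> (head i) - \<phi> (tail i))) = (\<Sum>p<P. 4 * D p + 3 * (- D p))"
      by (simp only: sum.distrib)
    then show ?thesis by (simp add: gain_def D_def)
  qed
  then show ?thesis by (simp add: flow_def flow0_def)
qed

lemma Sq_idx:
  assumes "q \<in> Sq"
  shows "cell_of (idx q) = q" "sq (idx q)" "idx q < P"
proof -
  obtain x y where q: "q = (x, y)" by (cases q)
  show 1: "cell_of (idx q) = q"
    using Sq_corners(1)[of x y] assms window[of x y] cell_of_idx[of x y] by (auto simp: q)
  then show 2: "sq (idx q)" using assms by (simp add: sq_def)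
  show "idx q < P" using sq_corners[OF 2] vx_bounds(2)[of "idx q"] by simp
qed

lemma Vt_idx:
  assumes "v \<in> Vt"
  shows "cell_of (idx v) = v" "vx (idx v)"
proof -
  obtain x y where v: "v = (x, y)" by (cases v)
  show 1: "cell_of (idx v) = v" using assms window[of x y] cell_of_idx[of x y] by (auto simp: v)
  then show "vx (idx v)" using assms by (simp add: vx_def)
qed

lemma vertex_sum:
  assumes m: "pm m" and "0 < p" "W \<le> p"
  shows "of_bool ((True, cell_of p) \<in> m) + of_bool ((True, cell_of (p - 1)) \<in> m) +
    of_bool ((False, cell_of p) \<in> m) + of_bool ((False, cell_of (p - W)) \<in> m) = (of_bool (vx p) :: int)"
proof (cases "vx p")
  case True
  obtain x y where xy: "cell_of p = (x, y)" by (cases "cell_of p")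
  have "(x, y) \<in> Vt" using True by (simp add: vx_def xy)
  from star_sum[OF m this] show ?thesis
    unfolding vx_neighbours[OF True] xy fst_conv snd_conv using True by simp
next
  case False
  have "(True, cell_of p) \<notin> m" using False vx_eh[of p] pm_subset[OF m] unfolding eh_def by blast
  moreover have "(False, cell_of p) \<notin> m" using False vx_ev[of p] pm_subset[OF m] unfolding ev_def by blast
  moreover have "(True, cell_of (p - 1)) \<notin> m"
  proof -
    have "\<not> eh (p - 1)" using False vx_eh[of "p - 1"] \<open>0 < p\<close> by auto
    then show ?thesis using pm_subset[OF m] unfolding eh_def by blast
  qed
  moreover have "(False, cell_of (p - W)) \<notin> m"
  proof -
    have "\<not> ev (p - W)" using False vx_ev[of "p - W"] \<open>W \<le> p\<close> by auto
    then show ?thesis using pm_subset[OF m] unfolding ev_def by blast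
  qed
  ultimately show ?thesis using False by simp
qed

text \<open>The analogue of \<open>height_function\<close> with the costs in place of a second
  matching, integrated up the columns, that is, along residue classes modulo
  \<open>W\<close>.\<close>

lemma matching_height:
  assumes m: "pm m"
  shows "\<exists>\<eta> :: nat \<Rightarrow> int. \<forall>p.
    of_bool ((True, cell_of p) \<in> m) - cst p = \<eta> (lH p) - \<eta> (rH p) \<and>
    of_bool ((False, cell_of p) \<in> m) = \<eta> (lV p) - \<eta> (rV p)"
proof -
  define sg :: "nat \<Rightarrow> int" where "sg p = (if even p then 1 else -1)" for p
  define mH where "mH p \<longleftrightarrow> (True, cell_of p) \<in> m" for p
  define mV where "mV p \<longleftrightarrow> (False, cell_of p) \<in> m" for p
  define g where "g p = sg p * (of_bool (mH p) - cst p)" for p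
  define R where "R p = {j. j \<le> p \<and> j mod W = p mod W}" for p
  define \<eta> where "\<eta> p = (\<Sum>j\<in>R p. g j)" for p
  have mH: "vx p" if "mH p" for p using that vx_eh[of p] pm_subset[OF m] unfolding eh_def mH_def by blast
  have mV: "vx p" if "mV p" for p using that vx_ev[of p] pm_subset[OF m] unfolding ev_def mV_def by blast
  have low: "\<not> mH p" "\<not> mV p" if "p < 2 * W" for p
    using mH[of p] mV[of p] vx_bounds(1)[of p] that by auto
  have sgW: "sg (p - W) = - sg p" if "W \<le> p" for p using that W_pos by (simp add: sg_def)
  have sg1: "sg (p - 1) = - sg p" if "0 < p" for p using that by (simp add: sg_def)
  have step: "\<eta> p = \<eta> (p - W) + g p" if p: "W \<le> p" for p
  proof -
    have "R p = insert p (R (p - W))"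
    proof (intro equalityI subsetI)
      fix j assume "j \<in> R p"
      then have j: "j \<le> p" "j mod W = p mod W" by (auto simp: R_def)
      show "j \<in> insert p (R (p - W))"
      proof (cases "j = p")
        case False
        have "W dvd p - j" using j mod_eq_dvd_iff_nat[of j p W] by simp
        then have "W \<le> p - j" using False j(1) by (intro dvd_imp_le) auto
        then show ?thesis using j p by (auto simp: R_def le_mod_geq)
      qed simp
    next
      fix j assume "j \<in> insert p (R (p - W))"
      then show "j \<in> R p" using p by (auto simp: R_def le_mod_geq)
    qed
    moreover have "p \<notin> R (p - W)" using p W_pos by (auto simp: R_def)
    moreover have "finite (R (p - W))" by (simp add: R_def)
    ultimately show ?thesis by (simp add: \<eta>_def)
  qed
  \<comment> \<open>The first two rows carry neither edges nor costs, so truncation in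
    \<open>p - W\<close> and \<open>p - 1\<close> does no harm there.\<close>
  have zero: "\<eta> p = 0" if "p < 2 * W" for p
    unfolding \<eta>_def
  proof (rule sum.neutral, rule ballI)
    fix j assume "j \<in> R p"
    then have "j < 2 * W" using that by (simp add: R_def)
    then show "g j = 0" using low[of j] cst_zero[of j] by (simp add: g_def)
  qed
  have V: "\<eta> p - \<eta> (p - 1) = - sg p * of_bool (mV p)" for p
  proof (induction p rule: less_induct)
    case (less p)
    show ?case
    proof (cases "p < 2 * W")
      case True
      then show ?thesis using zero[of p] zero[of "p - 1"] low[of p] by simp
    next
      case False
      then have p: "W \<le> p" "0 < p" "W \<le> p - 1" using W_pos by linarith+
      have "\<eta> p - \<eta> (p - 1) = (\<eta> (p - W) - \<eta> (p - W - 1)) + g p - g (p - 1)"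
        using step[OF p(1)] step[OF p(3)] by (simp add: diff_right_commute)
      also have "\<eta> (p - W) - \<eta> (p - W - 1) = sg p * of_bool (mV (p - W))"
        using less[of "p - W"] p W_pos sgW[OF p(1)] by simp
      also have "sg p * of_bool (mV (p - W)) + g p - g (p - 1) =
          sg p * (of_bool (mV (p - W)) + of_bool (mH p) + of_bool (mH (p - 1)) - (cst p + cst (p - 1)))"
        unfolding g_def sg1[OF p(2)] by (simp only: algebra_simps) 
      also have "of_bool (mV (p - W)) + of_bool (mH p) + of_bool (mH (p - 1)) - (cst p + cst (p - 1)) = - of_bool (mV p)"
        using vertex_sum[OF m p(2,1)] cst_vertex[OF p(2)] unfolding mH_def mV_def by linarith
      finally show ?thesis by simp
    qed
  qed
  have H: "\<eta> p - \<eta> (p - W) = sg p * (of_bool (mH p) - cst p)" for p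
  proof (cases "W \<le> p")
    case True
    then show ?thesis using step by (simp add: g_def)
  next
    case False
    then show ?thesis using zero[of p] zero[of "p - W"] low[of p] cst_zero[of p] by simp
  qed
  have "of_bool (mH p) - cst p = \<eta> (lH p) - \<eta> (rH p) \<and> of_bool (mV p) = \<eta> (lV p) - \<eta> (rV p)" for p
    using H[of p] V[of p] by (cases "even p") (simp_all add: sg_def lH_def rH_def lV_def rV_def)
  then show ?thesis unfolding mH_def mV_def by blast
qed

lemma index_le: "p < P \<Longrightarrow> lH p < P \<and> rH p < P \<and> lV p < P \<and> rV p < P"
  by (auto simp: lH_def rH_def lV_def rV_def)

text \<open>Switching a cell changes its height by 1, upwards or downwards according to
  \<open>up\<close>. The two heights of a cell of \<open>K\<close> are those before and after the
  switch.\<close>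

lemma resonant_feasible:
  assumes m: "pm m" and K: "finite K" "K \<subseteq> Sq" "packed m K"
  shows "\<exists>\<psi>. feasible \<psi> \<and> gain \<psi> = int (card K)"
proof -
  obtain \<eta> :: "nat \<Rightarrow> int" where
    H: "\<And>p. of_bool ((True, cell_of p) \<in> m) - cst p = \<eta> (lH p) - \<eta> (rH p)" and
    V: "\<And>p. of_bool ((False, cell_of p) \<in> m) = \<eta> (lV p) - \<eta> (rV p)"
    using matching_height[OF m] by blast
  define k where "k p \<longleftrightarrow> cell_of p \<in> K" for p
  define up where "up p \<longleftrightarrow> (even p \<longleftrightarrow> (False, cell_of p) \<in> m)" for p
  define \<psi> where "\<psi> i = (if i < P then \<eta> i - of_bool (k i \<and> \<not> up i)
      else \<eta> (i - P) + of_bool (k (i - P) \<and> up (i - P)))" for i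
  have ksq: "sq p" if "k p" for p using that K(2) by (auto simp: k_def sq_def)
  have \<psi>1: "\<psi> p = \<eta> p - of_bool (k p \<and> \<not> up p)" if "p < P" for p using that by (simp add: \<psi>_def)
  have \<psi>2: "\<psi> (nb p) = \<eta> p + of_bool (k p \<and> up p)" if "p < P" for p
    using that ksq[of p] by (auto simp: \<psi>_def nb_def)
  have kalt: "((False, cell_of (p + 1)) \<in> m) = ((False, cell_of p) \<in> m)"
      "((True, cell_of p) \<in> m) = ((False, cell_of p) \<notin> m)"
      "((True, cell_of (p + W)) \<in> m) = ((False, cell_of p) \<notin> m)" if "k p" for p
  proof -
    obtain x y where xy: "cell_of p = (x, y)" by (cases "cell_of p")
    have v: "vx p" using ksq[OF that] sq_corners by blast
    have "altc m (x, y)" using that K(3) by (simp add: k_def packed_def xy)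
    then show "((False, cell_of (p + 1)) \<in> m) = ((False, cell_of p) \<in> m)"
      "((True, cell_of p) \<in> m) = ((False, cell_of p) \<notin> m)"
      "((True, cell_of (p + W)) \<in> m) = ((False, cell_of p) \<notin> m)"
      unfolding altc_iff vx_neighbours[OF v] xy by simp_all
  qed
  have k0: "\<not> k p" if "p < W" for p
    using ksq[of p] sq_corners[of p] vx_bounds(1)[of p] that by auto
  have ends: "cell_of p = (fst (cell_of q), snd (cell_of q) + 1) \<and> p = q + W" if "k q" "q = p - W" for p q
    using that k0[of 0] cell_of_W[of q] by (cases "W \<le> p") auto
  have ends1: "cell_of p = (fst (cell_of q) + 1, snd (cell_of q)) \<and> p = q + 1" if "k q" "q = p - 1" for p q
    using that k0[of 0] W_pos vx_neighbours(1)[of q] ksq[of q] sq_corners[of q] by (cases p) auto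
  have sideH: "(True, cell_of p) \<in> sides (cell_of q)" if "k q" "q = p \<or> q = p - W" for p q
    using that ends[of q p] by (cases "cell_of q") auto
  have sideV: "(False, cell_of p) \<in> sides (cell_of q)" if "k q" "q = p \<or> q = p - 1" for p q
    using that ends1[of q p] by (cases "cell_of q") auto
  have disj: "\<not> (k q \<and> k q')" if "e \<in> sides (cell_of q)" "e \<in> sides (cell_of q')" "q \<noteq> q'" for e q q'
    using that K(3) cell_of_inj unfolding packed_def k_def by blast
  \<comment> \<open>The second height of a cell in \<open>K\<close> affects only its matched sides.
    As cells of \<open>K\<close> share no side, at most one of the two cells at an edge
    contributes.\<close>
  have lrH: "of_bool (k (rH p) \<and> up (rH p)) + of_bool (k (lH p) \<and> \<not> up (lH p)) \<le>
      (of_bool ((True, cell_of p) \<in> m) :: int)" for p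
  proof -
    have "(True, cell_of p) \<in> m" if "k (rH p)" "up (rH p)"
    proof (cases "even p")
      case True
      then have r: "rH p = p - W" by (simp add: rH_def)
      have "p = rH p + W" using ends[OF that(1) r] by blast
      moreover have "odd (rH p)" using True \<open>p = rH p + W\<close> W_pos by (metis even_add)
      ultimately show ?thesis using kalt(3)[OF that(1)] that(2) by (simp add: up_def)
    next
      case False
      then show ?thesis using kalt(2)[OF that(1)] that(2) by (simp add: up_def rH_def)
    qed
    moreover have "(True, cell_of p) \<in> m" if "k (lH p)" "\<not> up (lH p)"
    proof (cases "even p")
      case False
      then have r: "lH p = p - W" by (simp add: lH_def)
      have "p = lH p + W" using ends[OF that(1) r] by blast
      moreover have "even (lH p)" using False \<open>p = lH p + W\<close> W_pos by (metis even_add)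
      ultimately show ?thesis using kalt(3)[OF that(1)] that(2) by (simp add: up_def)
    next
      case True
      then show ?thesis using kalt(2)[OF that(1)] that(2) by (simp add: up_def lH_def)
    qed
    moreover have "\<not> (k (rH p) \<and> k (lH p))"
    proof
      assume kk: "k (rH p) \<and> k (lH p)"
      have "rH p = p \<or> rH p = p - W" "lH p = p \<or> lH p = p - W" by (auto simp: rH_def lH_def)
      moreover have "rH p \<noteq> lH p"
      proof
        assume eq: "rH p = lH p"
        then have "p - W = p" by (auto simp: rH_def lH_def split: if_splits)
        then have "p < W" using W_pos by auto
        moreover have "rH p = p" using \<open>p - W = p\<close> by (cases "even p") (simp_all add: rH_def)
        ultimately show False using kk k0 by auto
      qed
      ultimately show False using disj[OF sideH[of "rH p" p] sideH[of "lH p" p]] kk by blast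
    qed
    ultimately show ?thesis by auto
  qed
  have lrV: "of_bool (k (rV p) \<and> up (rV p)) + of_bool (k (lV p) \<and> \<not> up (lV p)) \<le>
      (of_bool ((False, cell_of p) \<in> m) :: int)" for p
  proof -
    have "(False, cell_of p) \<in> m" if "k (rV p)" "up (rV p)"
    proof (cases "even p")
      case False
      then have r: "rV p = p - 1" by (simp add: rV_def)
      have "p = rV p + 1" using ends1[OF that(1) r] by blast
      moreover have "even (rV p)" using False \<open>p = rV p + 1\<close> by (metis even_add odd_one)
      ultimately show ?thesis using kalt(1)[OF that(1)] that(2) by (simp add: up_def)
    next
      case True
      then show ?thesis using that(2) by (simp add: up_def rV_def)
    qed
    moreover have "(False, cell_of p) \<in> m" if "k (lV p)" "\<not> up (lV p)"
    proof (cases "even p")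
      case True
      then have r: "lV p = p - 1" by (simp add: lV_def)
      have "p = lV p + 1" using ends1[OF that(1) r] by blast
      moreover have "odd (lV p)" using True \<open>p = lV p + 1\<close> by (metis even_add odd_one)
      ultimately show ?thesis using kalt(1)[OF that(1)] that(2) by (simp add: up_def)
    next
      case False
      then show ?thesis using that(2) by (simp add: up_def lV_def)
    qed
    moreover have "\<not> (k (rV p) \<and> k (lV p))"
    proof
      assume kk: "k (rV p) \<and> k (lV p)"
      have "rV p = p \<or> rV p = p - 1" "lV p = p \<or> lV p = p - 1" by (auto simp: rV_def lV_def)
      moreover have "rV p \<noteq> lV p"
      proof
        assume eq: "rV p = lV p"
        then have "p = 0" by (auto simp: rV_def lV_def split: if_splits)
        then show False using kk k0[of 0] W_pos by (simp add: rV_def)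
      qed
      ultimately show False using disj[OF sideV[of "rV p" p] sideV[of "lV p" p]] kk by blast
    qed
    ultimately show ?thesis by auto
  qed
  have nofree: "\<not> k q" if "e \<notin> E" "e \<in> sides (cell_of q)" for e q
    using that K(2) unfolding k_def Sq_def by blast
  have "feasible \<psi>"
    unfolding feasible_def
  proof (intro allI impI)
    fix i assume i: "i < 3 * P"
    show "\<psi> (head i) - \<psi> (tail i) \<le> acost i \<and> (free i \<longrightarrow> \<psi> (head i) - \<psi> (tail i) = acost i)"
    proof -
      consider "i < P" | "P \<le> i" "i < 2 * P" | "2 * P \<le> i" by linarith
      then show ?thesis
      proof cases
        case 1
        have "\<psi> (nb (rH i)) - \<psi> (lH i) = cst i - of_bool ((True, cell_of i) \<in> m) +
            (of_bool (k (rH i) \<and> up (rH i)) + of_bool (k (lH i) \<and> \<not> up (lH i)))"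
          using index_le[OF 1] \<psi>1[of "lH i"] \<psi>2[of "rH i"] H[of i] by simp
        moreover have "\<not> k (rH i) \<and> \<not> k (lH i) \<and> (True, cell_of i) \<notin> m" if "\<not> eh i"
        proof -
          have "\<not> k q" if "q = i \<or> q = i - W" for q
            using nofree[of "(True, cell_of i)" q] sideH[of q i] that \<open>\<not> eh i\<close> unfolding eh_def by blast
          moreover have "(True, cell_of i) \<notin> m" using that pm_subset[OF m, of "(True, cell_of i)"] by (auto simp: eh_def)
          ultimately show ?thesis by (simp add: rH_def lH_def)
        qed
        ultimately show ?thesis using 1 lrH[of i] by (auto simp: head_def tail_def acost_def free_def)
      next
        case 2
        define p where "p = i - P"
        have p: "p < P" using 2 by (simp add: p_def)
        have "\<psi> (nb (rV p)) - \<psi> (lV p) = - of_bool ((False, cell_of p) \<in> m) +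
            (of_bool (k (rV p) \<and> up (rV p)) + of_bool (k (lV p) \<and> \<not> up (lV p)))"
          using index_le[OF p] \<psi>1[of "lV p"] \<psi>2[of "rV p"] V[of p] by simp
        moreover have "\<not> k (rV p) \<and> \<not> k (lV p) \<and> (False, cell_of p) \<notin> m" if "\<not> ev p"
        proof -
          have "\<not> k q" if "q = p \<or> q = p - 1" for q
            using nofree[of "(False, cell_of p)" q] sideV[of q p] that \<open>\<not> ev p\<close> unfolding ev_def by blast
          moreover have "(False, cell_of p) \<notin> m" using that pm_subset[OF m, of "(False, cell_of p)"] by (auto simp: ev_def)
          ultimately show ?thesis by (simp add: rV_def lV_def)
        qed
        ultimately show ?thesis using 2 lrV[of p] by (auto simp: head_def tail_def acost_def free_def p_def)
      next
        case 3
        then show ?thesis using i \<psi>1[of "i - 2 * P"] \<psi>2[of "i - 2 * P"]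
          by (simp add: head_def tail_def acost_def free_def)
      qed
    qed
  qed
  moreover have "gain \<psi> = int (card K)"
  proof -
    have "gain \<psi> = (\<Sum>p<P. of_bool (k p))"
      unfolding gain_def by (intro sum.cong refl) (simp add: \<psi>1 \<psi>2)
    also have "\<dots> = int (card {p. p < P \<and> k p})" by (simp add: Int_def)
    also have "card {p. p < P \<and> k p} = card (cell_of ` {p. p < P \<and> k p})"
      by (rule card_image[symmetric]) (use cell_of_inj in \<open>auto simp: inj_on_def\<close>)
    also have "cell_of ` {p. p < P \<and> k p} = K"
    proof (intro equalityI subsetI)
      fix q assume "q \<in> K"
      moreover have "q \<in> Sq" using \<open>q \<in> K\<close> K(2) by blast
      ultimately show "q \<in> cell_of ` {p. p < P \<and> k p}"
        using Sq_idx[of q] by (intro image_eqI[of _ _ "idx q"]) (simp_all add: k_def)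
    qed (auto simp: k_def)
    finally show ?thesis .
  qed
  ultimately show ?thesis by blast
qed

text \<open>At each vertex the slacks of its four edges and the gaps of the four cells around it are
  nonnegative integers with sum 1, so exactly one of them is 1. Edges with slack 1, together with
  the two horizontal sides of each cell with gap 1, form the matching.\<close>

lemma feasible_resonant:
  assumes \<phi>: "feasible \<phi>"
  shows "\<exists>m K. pm m \<and> finite K \<and> K \<subseteq> Sq \<and> packed m K \<and> int (card K) = gain \<phi>"
proof -
  define xH where "xH p = cst p - (\<phi> (nb (rH p)) - \<phi> (lH p))" for p
  define xV where "xV p = - (\<phi> (nb (rV p)) - \<phi> (lV p))" for p
  define y where "y p = \<phi> (nb p) - \<phi> p" for p
  have cH: "0 \<le> xH p" "\<not> eh p \<Longrightarrow> xH p = 0" if "p < P" for p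
    using \<phi>[unfolded feasible_def, rule_format, of p] that
    by (simp_all add: head_def tail_def acost_def free_def xH_def)
  have cV: "0 \<le> xV p" "\<not> ev p \<Longrightarrow> xV p = 0" if "p < P" for p
    using \<phi>[unfolded feasible_def, rule_format, of "p + P"] that
    by (simp_all add: head_def tail_def acost_def free_def xV_def)
  have y0: "0 \<le> y p" if "p < P" for p
    using \<phi>[unfolded feasible_def, rule_format, of "p + 2 * P"] that
    by (simp add: head_def tail_def acost_def free_def y_def)
  have ysq: "sq p" if "y p \<noteq> 0" for p using that by (auto simp: y_def nb_def split: if_splits)
  have vs: "xH p + xH (p - 1) + xV p + xV (p - W) + y p + y (p - 1) + y (p - W) + y (p - 1 - W) = 1"
    and nn: "0 \<le> xH p" "0 \<le> xH (p - 1)" "0 \<le> xV p" "0 \<le> xV (p - W)" "0 \<le> y p" "0 \<le> y (p - 1)"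
      "0 \<le> y (p - W)" "0 \<le> y (p - 1 - W)" if v: "vx p" for p
  proof -
    have p: "W < p" "0 < p" "p < P" using vx_bounds[OF v] W_pos by linarith+
    show "xH p + xH (p - 1) + xV p + xV (p - W) + y p + y (p - 1) + y (p - W) + y (p - 1 - W) = 1"
      using star_gain[OF p(1), of \<phi>] cst_vertex[OF p(2)] v unfolding xH_def xV_def y_def by simp
    show "0 \<le> xH p" "0 \<le> xH (p - 1)" "0 \<le> xV p" "0 \<le> xV (p - W)" "0 \<le> y p" "0 \<le> y (p - 1)"
      "0 \<le> y (p - W)" "0 \<le> y (p - 1 - W)" using p cH(1) cV(1) y0 by simp_all
  qed
  define m where "m = {e \<in> E. let p = idx (snd e) in
      if fst e then xH p = 1 \<or> y p = 1 \<or> y (p - W) = 1 else xV p = 1}"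
  have mV: "(False, cell_of p) \<in> m \<longleftrightarrow> ev p \<and> xV p = 1" for p
    by (simp add: m_def idx_cell_of ev_def)
  have mH: "(True, cell_of p) \<in> m \<longleftrightarrow> eh p \<and> (xH p = 1 \<or> y p = 1 \<or> y (p - W) = 1)" for p
    by (simp add: m_def idx_cell_of eh_def)
  have ye: "eh p" if "y p = 1 \<or> y (p - W) = 1" "W \<le> p" for p
  proof -
    have "sq p \<or> sq (p - W)" using that(1) ysq[of p] ysq[of "p - W"] by auto
    then show ?thesis using that(2) by (auto simp: sq_iff)
  qed
  have mH': "(True, cell_of p) \<in> m \<longleftrightarrow> xH p = 1 \<or> y p = 1 \<or> y (p - W) = 1" if "W \<le> p" "p < P" for p
    using mH[of p] ye[OF _ that(1)] cH(2)[OF that(2)] by auto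
  have mV': "(False, cell_of p) \<in> m \<longleftrightarrow> xV p = 1" if "p < P" for p
    using mV[of p] cV(2)[OF that] by auto
  have pm: "pm m"
    unfolding pm_def
  proof (intro conjI ballI)
    show "m \<subseteq> E" by (auto simp: m_def)
    fix v assume "v \<in> Vt"
    define p where "p = idx v"
    have v: "cell_of p = v" "vx p" using Vt_idx[OF \<open>v \<in> Vt\<close>] by (simp_all add: p_def)
    have p: "W \<le> p" "W \<le> p - 1" "p < P" "p - 1 < P" "p - W < P" using vx_bounds[OF v(2)] by linarith+
    have st: "star v = {(True, cell_of p), (True, cell_of (p - 1)), (False, cell_of p), (False, cell_of (p - W))}"
      unfolding vx_neighbours[OF v(2)] unfolding v(1) by (cases v) simp
    have d: "distinct [(True, cell_of p), (True, cell_of (p - 1)), (False, cell_of p), (False, cell_of (p - W))]"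
      unfolding vx_neighbours[OF v(2)] by (cases "cell_of p") simp
    show "\<exists>!e. e \<in> m \<and> e \<in> star v"
      unfolding st ex1_four[OF d] mH'[OF p(1,3)] mH'[OF p(2,4)] mV'[OF p(3)] mV'[OF p(5)]
      using vs[OF v(2)] nn[OF v(2)] by (smt (verit))
  qed
  define Y where "Y = {p. p < P \<and> y p \<noteq> 0}"
  have y1: "y p = 1" if "p \<in> Y" for p
  proof -
    have "y p \<noteq> 0" "vx p" using that ysq sq_corners by (auto simp: Y_def)
    then show ?thesis using vs[of p] nn[of p] by (smt (verit))
  qed
  define K where "K = cell_of ` Y"
  have finY: "finite Y" by (simp add: Y_def)
  have inj: "inj_on cell_of Y" using cell_of_inj by (auto simp: inj_on_def)
  have Ysq: "sq p" if "p \<in> Y" for p using that ysq by (auto simp: Y_def)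
  have "K \<subseteq> Sq" using Ysq by (auto simp: K_def sq_def)
  moreover have "packed m K"
    unfolding packed_def
  proof (intro conjI ballI impI)
    fix q assume "q \<in> K"
    then obtain p where p: "p \<in> Y" "q = cell_of p" by (auto simp: K_def)
    note sqp = Ysq[OF p(1)]
    have v: "vx p" using sqp sq_corners by blast
    obtain a b where ab: "cell_of p = (a, b)" by (cases "cell_of p")
    have "(True, cell_of p) \<in> m" using mH[of p] sqp y1[OF p(1)] by (simp add: sq_iff)
    moreover have "(True, cell_of (p + W)) \<in> m" using mH[of "p + W"] sqp y1[OF p(1)] by (simp add: sq_iff)
    ultimately show "altc m q"
      using altc_horizontal[OF pm, of a b] unfolding vx_neighbours[OF v] p(2) ab by simp
    fix q' assume "q' \<in> K" and ne: "q \<noteq> q'"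
    then obtain p' where p': "p' \<in> Y" "q' = cell_of p'" by (auto simp: K_def)
    \<comment> \<open>The lower or left end of a side is a vertex around which the cell lies. Two
      cells with a common side would both contribute their gap 1 to the sum at that vertex.\<close>
    have near: "\<exists>r. vx r \<and> cell_of r = snd e \<and> (p = r \<or> p = r - W \<or> p = r - 1)"
      if "p \<in> Y" "e \<in> sides (cell_of p)" for e p
    proof -
      have sqp: "sq p" using Ysq that(1) by blast
      then have v: "vx p" "vx (p + 1)" "vx (p + W)" using sq_corners by blast+
      obtain a b where ab: "cell_of p = (a, b)" by (cases "cell_of p")
      have "snd e \<in> {cell_of p, cell_of (p + W), cell_of (p + 1)}"
        using that(2) unfolding vx_neighbours[OF v(1)] ab by auto
      then show ?thesis
      proof (elim insertE)
        assume "snd e = cell_of p" then show ?thesis using v by (intro exI[of _ p]) simp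
      next
        assume "snd e = cell_of (p + W)" then show ?thesis using v by (intro exI[of _ "p + W"]) simp
      next
        assume "snd e = cell_of (p + 1)" then show ?thesis using v by (intro exI[of _ "p + 1"]) simp
      qed simp
    qed
    show "sides q \<inter> sides q' = {}"
    proof (rule ccontr)
      assume "sides q \<inter> sides q' \<noteq> {}"
      then obtain e where e: "e \<in> sides (cell_of p)" "e \<in> sides (cell_of p')" using p(2) p'(2) by blast
      obtain r where r: "vx r" "cell_of r = snd e" "p = r \<or> p = r - W \<or> p = r - 1"
        using near[OF p(1) e(1)] by blast
      obtain r' where r': "vx r'" "cell_of r' = snd e" "p' = r' \<or> p' = r' - W \<or> p' = r' - 1"
        using near[OF p'(1) e(2)] by blast
      have "r' = r" using cell_of_inj r(2) r'(2) by metis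
      moreover have "p \<noteq> p'" using ne p(2) p'(2) by blast
      moreover note y1[OF p(1)] y1[OF p'(1)]
      ultimately show False
        using vs[OF r(1)] nn[OF r(1)] r(3) r'(3) by (elim disjE; simp)
    qed
  qed
  moreover have "finite K" using finY by (simp add: K_def)
  moreover have "int (card K) = gain \<phi>"
  proof -
    have "gain \<phi> = (\<Sum>p<P. y p)" by (simp add: gain_def y_def)
    also have "\<dots> = (\<Sum>p\<in>Y. y p)" by (rule sum.mono_neutral_right) (auto simp: Y_def)
    also have "\<dots> = (\<Sum>p\<in>Y. 1)" using y1 by (intro sum.cong) auto
    also have "\<dots> = int (card K)" using card_image[OF inj] by (simp add: K_def)
    finally show ?thesis ..
  qed
  ultimately show ?thesis using pm by blast
qed

text \<open>Bounds the number of rounds of cycle cancelling, each of which lowers the integral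
  cost.\<close>

lemma flow_cost_flow0: "flow_cost flow0 \<le> 2 * int P * int P"
proof -
  have "flow_cost flow0 = (\<Sum>p<P. cst p * flow0 p)"
    unfolding flow_cost_def split3 by (simp add: acost_def)
  also have "\<dots> \<le> (\<Sum>p<P. 2 * int P)"
  proof (rule sum_mono)
    fix p assume "p \<in> {..<P}"
    then have "cst p \<le> int P" "0 \<le> flow0 p" "flow0 p \<le> 2" using cst_bound[of p] by (auto simp: flow0_def)
    then have "cst p * flow0 p \<le> int P * flow0 p" "int P * flow0 p \<le> int P * 2"
      by (simp_all add: mult_right_mono mult_left_mono)
    then show "cst p * flow0 p \<le> 2 * int P" by simp
  qed
  finally show ?thesis by simp
qed

end

section \<open>A calculus for running times\<close>

section \<open>Time bounds for programs\<close>

definition runs :: "com \<Rightarrow> memory \<Rightarrow> nat \<Rightarrow> (memory \<Rightarrow> bool) \<Rightarrow> bool" where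
  "runs c s t Q \<longleftrightarrow> (\<exists>t' s'. exec c s t' s' \<and> t' \<le> t \<and> Q s')"

primrec mods :: "com \<Rightarrow> nat set" where
  "mods Skip = {}"
| "mods (Store a i e) = {a}"
| "mods (Seq c c') = mods c \<union> mods c'"
| "mods (If b c c') = mods c \<union> mods c'"
| "mods (While b c) = mods c"

primrec loop_free :: "com \<Rightarrow> bool" where
  "loop_free Skip \<longleftrightarrow> True"
| "loop_free (Store a i e) \<longleftrightarrow> True"
| "loop_free (Seq c c') \<longleftrightarrow> loop_free c \<and> loop_free c'"
| "loop_free (If b c c') \<longleftrightarrow> loop_free c \<and> loop_free c'"
| "loop_free (While b c) \<longleftrightarrow> False"

text \<open>Straight-line programs are verified by evaluation. The values at loops are
  dummies.\<close>

primrec sem :: "com \<Rightarrow> memory \<Rightarrow> memory" where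
  "sem Skip s = s"
| "sem (Store a i e) s = s(a := (s a)(val i s := val e s))"
| "sem (Seq c c') s = sem c' (sem c s)"
| "sem (If b c c') s = (if val b s \<noteq> 0 then sem c s else sem c' s)"
| "sem (While b c) s = s"

text \<open>A conditional is charged for both branches, an upper bound that needs no
  maximum.\<close>

primrec duration :: "com \<Rightarrow> nat" where
  "duration Skip = 1"
| "duration (Store a i e) = 1 + cost i + cost e"
| "duration (Seq c c') = duration c + duration c'"
| "duration (If b c c') = 1 + cost b + (duration c + duration c')"
| "duration (While b c) = 0"

lemma exec_mods: "exec c s t s' \<Longrightarrow> a \<notin> mods c \<Longrightarrow> s' a = s a"
  by (induction rule: exec.induct) auto

lemma runs_frame: "runs c s t Q \<Longrightarrow> runs c s t (\<lambda>s'. Q s' \<and> (\<forall>a. a \<notin> mods c \<longrightarrow> s' a = s a))"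
  using exec_mods unfolding runs_def by blast

lemma runs_weaken: "runs c s t Q \<Longrightarrow> t \<le> t' \<Longrightarrow> (\<And>s'. Q s' \<Longrightarrow> Q' s') \<Longrightarrow> runs c s t' Q'"
  unfolding runs_def by (meson order_trans)

lemma runs_loop_free:
  assumes "loop_free c" "Q (sem c s)" "duration c \<le> t"
  shows "runs c s t Q"
proof -
  have "\<exists>t. exec c s t (sem c s) \<and> t \<le> duration c" if "loop_free c" for c s
    using that
  proof (induction c arbitrary: s)
    case Skip
    then show ?case using exec.Skip by auto
  next
    case (Store a i e)
    show ?case unfolding sem.simps duration.simps using exec.Store by blast
  next
    case (Seq c1 c2)
    obtain t1 where "exec c1 s t1 (sem c1 s)" "t1 \<le> duration c1" using Seq by auto
    moreover obtain t2 where "exec c2 (sem c1 s) t2 (sem c2 (sem c1 s))" "t2 \<le> duration c2"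
      using Seq by fastforce
    ultimately show ?case using exec.Seq by (metis add_mono duration.simps(3) sem.simps(3))
  next
    case (If b c1 c2)
    obtain t1 where 1: "exec c1 s t1 (sem c1 s)" "t1 \<le> duration c1" using If by auto
    obtain t2 where 2: "exec c2 s t2 (sem c2 s)" "t2 \<le> duration c2" using If by auto
    show ?case
    proof (cases "val b s = 0")
      case True
      then show ?thesis using exec.IfFalse[OF True 2(1), of c1] 2(2)
        by (intro exI[of _ "1 + cost b + t2"]) simp
    next
      case False
      then show ?thesis using exec.IfTrue[OF False 1(1), of c2] 1(2)
        by (intro exI[of _ "1 + cost b + t1"]) simp
    qed
  next
    case (While b c)
    then show ?case by simp
  qed
  from this[OF assms(1)] show ?thesis
    using assms(2,3) unfolding runs_def by (meson order_trans)
qed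

lemma runs_Seq:
  assumes "runs c s t1 Q1"
    and "\<And>s'. Q1 s' \<Longrightarrow> (\<And>a. a \<notin> mods c \<Longrightarrow> s' a = s a) \<Longrightarrow> runs c' s' t2 Q"
    and "t1 + t2 \<le> t"
  shows "runs (Seq c c') s t Q"
proof -
  obtain u1 s1 where 1: "exec c s u1 s1" "u1 \<le> t1" "Q1 s1" using assms(1) by (auto simp: runs_def)
  then obtain u2 s2 where 2: "exec c' s1 u2 s2" "u2 \<le> t2" "Q s2"
    using assms(2)[OF 1(3)] exec_mods[OF 1(1)] by (auto simp: runs_def)
  have "exec (Seq c c') s (u1 + u2) s2" using 1 2 exec.Seq by blast
  then show ?thesis using 1 2 assms(3) unfolding runs_def by (intro exI[of _ "u1 + u2"] exI[of _ s2]) simp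
qed

lemma runs_If:
  assumes "val b s \<noteq> 0 \<Longrightarrow> runs c s t1 Q" "val b s = 0 \<Longrightarrow> runs c' s t1 Q" "1 + cost b + t1 \<le> t"
  shows "runs (If b c c') s t Q"
proof (cases "val b s = 0")
  case True
  then obtain u s' where u: "exec c' s u s'" "u \<le> t1" "Q s'" using assms(2) by (auto simp: runs_def)
  then show ?thesis
    unfolding runs_def using exec.IfFalse[OF True u(1), of c] assms(3)
    by (intro exI[of _ "1 + cost b + u"] exI[of _ s']) simp
next
  case False
  then obtain u s' where u: "exec c s u s'" "u \<le> t1" "Q s'" using assms(1) by (auto simp: runs_def)
  then show ?thesis
    unfolding runs_def using exec.IfTrue[OF False u(1), of c'] assms(3)
    by (intro exI[of _ "1 + cost b + u"] exI[of _ s']) simp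
qed

text \<open>\<open>I k s\<close> combines the invariant with a variant: \<open>k\<close> bounds the
  number of rounds still to come.\<close>

lemma runs_While:
  assumes body: "\<And>k s. I k s \<Longrightarrow> val b s \<noteq> 0 \<Longrightarrow> runs c s tb (\<lambda>s'. \<exists>k'<k. I k' s')"
    and "I k s" and post: "\<And>k s. I k s \<Longrightarrow> val b s = 0 \<Longrightarrow> Q s"
    and "(k + 1) * (1 + cost b + tb) \<le> t"
  shows "runs (While b c) s t Q"
proof -
  have "runs (While b c) s ((k + 1) * (1 + cost b + tb)) Q" if "I k s" for k s
    using that
  proof (induction k arbitrary: s rule: less_induct)
    case (less k)
    show ?case
    proof (cases "val b s = 0")
      case True
      then show ?thesis
        unfolding runs_def using exec.WhileFalse[OF True, of c] post[OF less.prems True]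
        by (intro exI[of _ "1 + cost b"] exI[of _ s]) simp
    next
      case False
      then obtain u s1 k' where 1: "exec c s u s1" "u \<le> tb" "k' < k" "I k' s1"
        using body[OF less.prems False] by (auto simp: runs_def)
      then obtain u' s2 where 2: "exec (While b c) s1 u' s2" "u' \<le> (k' + 1) * (1 + cost b + tb)" "Q s2"
        using less.IH[OF 1(3,4)] by (auto simp: runs_def)
      have "(k' + 1) * (1 + cost b + tb) \<le> k * (1 + cost b + tb)" using 1(3) by (intro mult_right_mono) auto
      then have "1 + cost b + u + u' \<le> (k + 1) * (1 + cost b + tb)" using 1(2) 2(2) by (simp add: algebra_simps)
      then show ?thesis
        unfolding runs_def using exec.WhileTrue[OF False 1(1) 2(1)] 2(3) by blast
    qed
  qed
  then show ?thesis using assms(2,4) runs_weaken by blast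
qed

abbreviation Var :: "nat \<Rightarrow> exp" where "Var a \<equiv> Cell a (Num 0)"
abbreviation Assign :: "nat \<Rightarrow> exp \<Rightarrow> com" where "Assign a e \<equiv> Store a (Num 0) e"

definition For :: "nat \<Rightarrow> exp \<Rightarrow> com \<Rightarrow> com" where
  "For i e c = Seq (Assign i (Num 0)) (While (Sub e (Var i)) (Seq c (Assign i (Add (Var i) (Num 1)))))"

lemma mods_For: "mods (For i e c) = insert i (mods c)"
  by (auto simp: For_def)

text \<open>Beyond the body and the evaluation of \<open>e\<close>, a round takes 10 steps, 4 for
  the test and 6 for the increment; resetting the counter takes 3.\<close>

lemma runs_For:
  assumes i: "i \<notin> mods c"
    and e: "\<And>s. (\<And>a. a \<noteq> i \<Longrightarrow> a \<notin> mods c \<Longrightarrow> s a = s0 a) \<Longrightarrow> val e s = b"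
    and start: "I 0 (s0(i := (s0 i)(0 := 0)))"
    and body: "\<And>k s. k < b \<Longrightarrow> I k s \<Longrightarrow> s i 0 = k \<Longrightarrow> (\<And>a. a \<noteq> i \<Longrightarrow> a \<notin> mods c \<Longrightarrow> s a = s0 a) \<Longrightarrow>
      runs c s tb (\<lambda>s'. I (Suc k) (s'(i := (s' i)(0 := Suc k))))"
    and post: "\<And>s. I b s \<Longrightarrow> (\<And>a. a \<noteq> i \<Longrightarrow> a \<notin> mods c \<Longrightarrow> s a = s0 a) \<Longrightarrow> Q s"
    and t: "3 + (b + 1) * (cost e + tb + 10) \<le> t"
  shows "runs (For i e c) s0 t Q"
proof -
  let ?s = "s0(i := (s0 i)(0 := 0))"
  define J where "J k s \<longleftrightarrow> k \<le> b \<and> I (b - k) s \<and> s i 0 = b - k \<and> (\<forall>a. a \<noteq> i \<longrightarrow> a \<notin> mods c \<longrightarrow> s a = s0 a)" for k s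
  have "runs (Assign i (Num 0)) s0 3 (\<lambda>s'. s' = ?s)"
    by (rule runs_loop_free) simp_all
  moreover have "runs (While (Sub e (Var i)) (Seq c (Assign i (Add (Var i) (Num 1))))) ?s
      ((b + 1) * (1 + cost (Sub e (Var i)) + (tb + 6))) Q"
  proof (rule runs_While[where I = J])
    show "J b ?s" using start by (simp add: J_def)
    fix k s assume J: "J k s" 
    then have ve: "val e s = b" using e by (simp add: J_def)
    {
      assume "val (Sub e (Var i)) s = 0"
      then have "b - (b - k) = 0" "k \<le> b" using J ve by (simp_all add: J_def)
      then have "k = 0" by linarith
      then show "Q s" using J post by (simp add: J_def)
    }
    assume "val (Sub e (Var i)) s \<noteq> 0"
    then have k: "0 < k" "b - k < b" using J ve by (auto simp: J_def)
    show "runs (Seq c (Assign i (Add (Var i) (Num 1)))) s (tb + 6) (\<lambda>s'. \<exists>k'<k. J k' s')"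
    proof (rule runs_Seq[OF body[OF k(2)], of s])
      show "I (b - k) s" "s i 0 = b - k" "\<And>a. a \<noteq> i \<Longrightarrow> a \<notin> mods c \<Longrightarrow> s a = s0 a"
        using J by (simp_all add: J_def)
      fix s' assume s': "I (Suc (b - k)) (s'(i := (s' i)(0 := Suc (b - k))))" "\<And>a. a \<notin> mods c \<Longrightarrow> s' a = s a"
      have "s' i 0 = b - k" using s'(2)[OF i] J by (simp add: J_def)
      then have "J (k - 1) (s'(i := (s' i)(0 := Suc (b - k))))"
        using J k s' by (auto simp: J_def Suc_diff_le)
      then show "runs (Assign i (Add (Var i) (Num 1))) s' 6 (\<lambda>s'. \<exists>k'<k. J k' s')"
        using k(1) \<open>s' i 0 = b - k\<close> by (intro runs_loop_free) (auto intro!: exI[of _ "k - 1"])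
    qed simp
  qed simp
  ultimately show ?thesis
    unfolding For_def by (intro runs_Seq[of _ _ 3 "\<lambda>s'. s' = ?s"]) (use t in \<open>auto simp: algebra_simps\<close>)
qed

lemma runs_fill:
  assumes i: "i \<noteq> a" "mods c \<subseteq> {a}"
    and e: "\<And>s. (\<And>a'. a' \<noteq> i \<Longrightarrow> a' \<noteq> a \<Longrightarrow> s a' = s0 a') \<Longrightarrow> val e s = b"
    and body: "\<And>k s. k < b \<Longrightarrow> s i 0 = k \<Longrightarrow> (\<And>a'. a' \<noteq> i \<Longrightarrow> a' \<noteq> a \<Longrightarrow> s a' = s0 a') \<Longrightarrow>
      s a = (\<lambda>j. if off \<le> j \<and> j < off + k then f (j - off) else s0 a j) \<Longrightarrow>
      runs c s tb (\<lambda>s'. s' a = (s a)(off + k := f k))"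
    and t: "3 + (b + 1) * (cost e + tb + 10) \<le> t"
  shows "runs (For i e c) s0 t (\<lambda>s'. s' a = (\<lambda>j. if off \<le> j \<and> j < off + b then f (j - off) else s0 a j) \<and>
    (\<forall>a'. a' \<noteq> i \<longrightarrow> a' \<noteq> a \<longrightarrow> s' a' = s0 a'))"
proof (rule runs_For[where b = b and tb = tb and
      I = "\<lambda>k s. s a = (\<lambda>j. if off \<le> j \<and> j < off + k then f (j - off) else s0 a j) \<and> (\<forall>a'. a' \<noteq> i \<longrightarrow> a' \<noteq> a \<longrightarrow> s a' = s0 a')"])
  show "i \<notin> mods c" using i by blast
  show "val e s = b" if "\<And>a'. a' \<noteq> i \<Longrightarrow> a' \<notin> mods c \<Longrightarrow> s a' = s0 a'" for s
    by (rule e) (use that i(2) in auto)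
next
  fix k s assume k: "k < b" and I: "s a = (\<lambda>j. if off \<le> j \<and> j < off + k then f (j - off) else s0 a j) \<and> (\<forall>a'. a' \<noteq> i \<longrightarrow> a' \<noteq> a \<longrightarrow> s a' = s0 a')"
    and si: "s i 0 = k"
  have "runs c s tb (\<lambda>s'. s' a = (s a)(off + k := f k))" using body[of k s] k si I by blast
  from runs_frame[OF this] show "runs c s tb (\<lambda>s'. (s'(i := (s' i)(0 := Suc k))) a = (\<lambda>j. if off \<le> j \<and> j < off + Suc k then f (j - off) else s0 a j) \<and>
      (\<forall>a'. a' \<noteq> i \<longrightarrow> a' \<noteq> a \<longrightarrow> (s'(i := (s' i)(0 := Suc k))) a' = s0 a'))"
  proof (rule runs_weaken)
    fix s' assume s': "s' a = (s a)(off + k := f k) \<and> (\<forall>a. a \<notin> mods c \<longrightarrow> s' a = s a)"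
    have "s' a = (\<lambda>j. if off \<le> j \<and> j < off + Suc k then f (j - off) else s0 a j)"
      using s' I by (auto simp: fun_eq_iff)
    moreover have "s' a' = s0 a'" if "a' \<noteq> i" "a' \<noteq> a" for a' using s' I that i(2) by auto
    ultimately show "(s'(i := (s' i)(0 := Suc k))) a = (\<lambda>j. if off \<le> j \<and> j < off + Suc k then f (j - off) else s0 a j) \<and>
      (\<forall>a'. a' \<noteq> i \<longrightarrow> a' \<noteq> a \<longrightarrow> (s'(i := (s' i)(0 := Suc k))) a' = s0 a')"
      using i(1) by simp
  qed simp
qed (use i t in auto)

section \<open>Correctness and running time of cycle cancelling\<close>

section \<open>Cycle cancelling\<close>

text \<open>Arrays 0 to 6 hold the input. A name with \<open>v\<close> denotes a variable kept in
  entry 0 of its array, a name with \<open>a\<close> a proper array.\<close>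

abbreviation (input) "vI \<equiv> 7 :: nat"
abbreviation (input) "vJ \<equiv> 8 :: nat"
abbreviation (input) "vK \<equiv> 9 :: nat"
abbreviation (input) "vN \<equiv> 10 :: nat"
abbreviation (input) "vE \<equiv> 11 :: nat"
abbreviation (input) "vW \<equiv> 12 :: nat"
abbreviation (input) "aRow \<equiv> 13 :: nat"
abbreviation (input) "vP \<equiv> 14 :: nat"
abbreviation (input) "aMul \<equiv> 15 :: nat"
abbreviation (input) "vB \<equiv> 16 :: nat"
abbreviation (input) "aIdx \<equiv> 17 :: nat"
abbreviation (input) "aVx \<equiv> 18 :: nat"
abbreviation (input) "aEh \<equiv> 19 :: nat"
abbreviation (input) "aEv \<equiv> 20 :: nat"
abbreviation (input) "aPar \<equiv> 21 :: nat"
abbreviation (input) "aNb \<equiv> 22 :: nat"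
abbreviation (input) "aT0 \<equiv> 23 :: nat"
abbreviation (input) "aH0 \<equiv> 24 :: nat"
abbreviation (input) "aP0 \<equiv> 25 :: nat"
abbreviation (input) "aM0 \<equiv> 26 :: nat"
abbreviation (input) "aT \<equiv> 27 :: nat"
abbreviation (input) "aH \<equiv> 28 :: nat"
abbreviation (input) "aP \<equiv> 29 :: nat"
abbreviation (input) "aM \<equiv> 30 :: nat"
abbreviation (input) "aF \<equiv> 31 :: nat"
abbreviation (input) "aU \<equiv> 32 :: nat"
abbreviation (input) "aA \<equiv> 33 :: nat"
abbreviation (input) "aD \<equiv> 34 :: nat"
abbreviation (input) "vFail \<equiv> 35 :: nat"
abbreviation (input) "vViol \<equiv> 36 :: nat"
abbreviation (input) "vOk \<equiv> 37 :: nat"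
abbreviation (input) "vSum \<equiv> 38 :: nat"

definition M2 :: exp where "M2 = Add (Var vP) (Var vP)"
definition M3 :: exp where "M3 = Add M2 (Var vP)"
definition M6 :: exp where "M6 = Add M3 M3"

lemma M_simps [simp]:
  "val M2 s = 2 * s vP 0" "val M3 s = 3 * s vP 0" "val M6 s = 6 * s vP 0"
  "cost M2 = 5" "cost M3 = 8" "cost M6 = 17"
  by (simp_all add: M2_def M3_def M6_def)

text \<open>The cost of an arc is the difference of its entries in \<open>aP\<close> and
  \<open>aM\<close>, as memory holds natural numbers only. A violated constraint lowers the value at
  the head by 1; if that value is 0 already, there is no solution in the range.\<close>

definition relax :: com where
  "relax = If (Cell aA (Var vK))
     (If (Sub (Add (Cell aD (Cell aH (Var vK))) (Cell aM (Var vK)))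
              (Add (Cell aD (Cell aT (Var vK))) (Cell aP (Var vK))))
        (If (Cell aD (Cell aH (Var vK)))
           (Seq (Store aD (Cell aH (Var vK)) (Sub (Cell aD (Cell aH (Var vK))) (Num 1)))
                (Assign vViol (Num 1)))
           (Assign vFail (Num 1)))
        Skip)
     Skip"

text \<open>Decides whether the constraints of the arcs that are active in the array \<open>aA\<close> have a solution
  with values in \<open>{0..B}\<close>. Every such solution stays below the values stored in \<open>aD\<close>.\<close>

definition potentials :: com where
  "potentials = Seq (For vK M2 (Store aD (Var vK) (Var vB)))
     (Seq (Assign vFail (Num 0))
     (Seq (Assign vViol (Num 1))
     (While (Var vViol) (Seq (Assign vViol (Num 0)) (For vK M6 relax)))))"

text \<open>Deletes arcs until the active ones are a minimal infeasible system, that is, a negative cycle.\<close>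

definition minimize :: com where
  "minimize = For vJ M6 (If (Cell aA (Var vJ))
     (Seq (Store aA (Var vJ) (Num 0))
     (Seq potentials
     (If (Var vFail) Skip (Store aA (Var vJ) (Num 1))))) Skip)"

definition residual_arcs :: com where
  "residual_arcs = Seq (For vJ M3 (Store aA (Var vJ) (Num 1)))
     (For vJ M3 (If (Add (Cell aF (Var vJ)) (Cell aU (Var vJ)))
       (Store aA (Add M3 (Var vJ)) (Num 1)) (Store aA (Add M3 (Var vJ)) (Num 0))))"

definition push :: com where
  "push = For vJ M3 (Store aU (Var vJ)
     (Sub (Add (Cell aU (Var vJ)) (Cell aA (Var vJ))) (Cell aA (Add M3 (Var vJ)))))"

definition solve :: com where
  "solve = Seq (Assign vOk (Num 0))
     (While (Sub (Num 1) (Var vOk))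
       (Seq residual_arcs
       (Seq potentials
       (If (Var vFail) (Seq minimize push) (Assign vOk (Num 1))))))"

lemma mods_potentials: "mods potentials = {vK, aD, vFail, vViol}"
  by (auto simp: potentials_def mods_For relax_def)

lemma mods_minimize: "mods minimize = {vJ, aA, vK, aD, vFail, vViol}"
  by (auto simp: minimize_def mods_For mods_potentials)

lemma mods_residual_arcs: "mods residual_arcs = {vJ, aA}"
  by (auto simp: residual_arcs_def mods_For)

lemma mods_push: "mods push = {vJ, aU}"
  by (auto simp: push_def mods_For)

text \<open>There are \<open>2 * P\<close> nodes and costs up to \<open>C\<close>, so by
  \<open>bounded_potential\<close> and a shift the range \<open>{0..B}\<close> contains a solution
  whenever there is no negative cycle.\<close>

locale network = flow_problem "3 * P" T H "\<lambda>i. int (ap i) - int (am i)" fr \<beta>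
  for P :: nat and T H ap am :: "nat \<Rightarrow> nat" and fr :: "nat \<Rightarrow> bool" and \<beta> :: "(nat \<Rightarrow> int) \<Rightarrow> int" +
  fixes B C :: nat
  assumes nodes: "i < 3 * P \<Longrightarrow> T i < 2 * P \<and> H i < 2 * P"
    and costs: "i < 3 * P \<Longrightarrow> ap i \<le> C \<and> am i \<le> C"
    and bound: "2 * P * C \<le> B"
begin

definition rp :: "nat \<Rightarrow> nat" where "rp j = (if j < 3 * P then ap j else am (j - 3 * P))"
definition rm :: "nat \<Rightarrow> nat" where "rm j = (if j < 3 * P then am j else ap (j - 3 * P))"

lemma rc_eq: "rc j = int (rp j) - int (rm j)"
  by (simp add: rc_def rp_def rm_def)

lemma rnodes: "j < 6 * P \<Longrightarrow> rt j < 2 * P \<and> rh j < 2 * P"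
  using nodes[of j] nodes[of "j - 3 * P"] by (auto simp: rt_def rh_def)

lemma rcosts: "j < 6 * P \<Longrightarrow> \<bar>rc j\<bar> \<le> int C"
proof -
  assume "j < 6 * P"
  then have "\<not> j < 3 * P \<Longrightarrow> j - 3 * P < 3 * P" by linarith
  then show ?thesis using costs[of j] costs[of "j - 3 * P"] by (auto simp: rc_def)
qed

definition env :: "memory \<Rightarrow> bool" where
  "env s \<longleftrightarrow> s vP 0 = P \<and> s vB 0 = B \<and>
     (\<forall>j<6 * P. s aT j = rt j \<and> s aH j = rh j \<and> s aP j = rp j \<and> s aM j = rm j)"

definition active :: "memory \<Rightarrow> nat set" where
  "active s = {j. j < 6 * P \<and> s aA j \<noteq> 0}"

definition in_range :: "(nat \<Rightarrow> int) \<Rightarrow> bool" where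
  "in_range \<phi> \<longleftrightarrow> (\<forall>v<2 * P. 0 \<le> \<phi> v \<and> \<phi> v \<le> int B)"

definition total :: "memory \<Rightarrow> nat" where
  "total s = (\<Sum>v<2 * P. s aD v)"

definition sound :: "nat set \<Rightarrow> memory \<Rightarrow> bool" where
  "sound R s \<longleftrightarrow> (\<forall>v<2 * P. s aD v \<le> B) \<and> s vViol 0 \<le> 1 \<and>
     (\<forall>\<phi>. satisfies \<phi> R \<longrightarrow> in_range \<phi> \<longrightarrow> s vFail 0 = 0 \<and> (\<forall>v<2 * P. \<phi> v \<le> int (s aD v)))"

definition tight :: "nat set \<Rightarrow> memory \<Rightarrow> bool" where
  "tight R s \<longleftrightarrow> (s vViol 0 = 0 \<longrightarrow> s vFail 0 = 0 \<longrightarrow>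
     (\<forall>j\<in>R. int (s aD (rh j)) \<le> int (s aD (rt j)) + rc j))"

text \<open>Raising the flag is paid for by lowering an entry of \<open>aD\<close>, so the sum of
  the total and the flag never grows. This is the variant of the outer loop.\<close>

lemma relax_step:
  assumes env: "env s" and k: "s vK 0 = k" "k < 6 * P"
    and so: "sound (active s) s" and ti: "tight (active s \<inter> {..<k}) s" and tot: "total s + s vViol 0 \<le> S"
  shows "runs relax s 80 (\<lambda>s'. sound (active s) s' \<and> tight (active s \<inter> {..<Suc k}) s' \<and> total s' + s' vViol 0 \<le> S)"
proof (rule runs_loop_free)
  show "loop_free relax" by (simp add: relax_def)
  show "duration relax \<le> 80" by (simp add: relax_def)
  have a: "s aT k = rt k" "s aH k = rh k" "s aP k = rp k" "s aM k = rm k"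
    using env k by (auto simp: env_def)
  have hk: "rh k < 2 * P" "rt k < 2 * P" using rnodes[OF k(2)] by auto
  have ins: "active s \<inter> {..<Suc k} = (if s aA k \<noteq> 0 then insert k (active s \<inter> {..<k}) else active s \<inter> {..<k})"
    using k(2) by (auto simp: active_def less_Suc_eq)
  let ?G = "\<lambda>s'. sound (active s) s' \<and> tight (active s \<inter> {..<Suc k}) s' \<and> total s' + s' vViol 0 \<le> S"
  show "?G (sem relax s)"
  proof (cases "s aA k = 0")
    case True
    then have "sem relax s = s" using k(1) by (simp add: relax_def)
    then show ?thesis using so ti tot True ins by simp
  next
    case act: False
    then have kR: "k \<in> active s" using k(2) by (simp add: active_def)
    show ?thesis
    proof (cases "s aD (rh k) + rm k \<le> s aD (rt k) + rp k")
      case True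
      then have "sem relax s = s" using k(1) a act by (simp add: relax_def)
      moreover have "int (s aD (rh k)) \<le> int (s aD (rt k)) + rc k"
        using True by (simp add: rc_eq)
      ultimately show ?thesis using so ti tot act ins by (simp add: tight_def)
    next
      case viol: False
      have below: "\<phi> (rh k) < int (s aD (rh k))" "0 \<le> \<phi> (rh k)" if "satisfies \<phi> (active s)" "in_range \<phi>" for \<phi>
      proof -
        have "\<phi> (rh k) \<le> \<phi> (rt k) + rc k" using that(1) kR by (simp add: satisfies_def)
        moreover have "\<phi> (rt k) \<le> int (s aD (rt k))" using so that hk by (simp add: sound_def)
        ultimately show "\<phi> (rh k) < int (s aD (rh k))" using viol by (simp add: rc_eq)
        show "0 \<le> \<phi> (rh k)" using that(2) hk by (simp add: in_range_def)
      qed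
      show ?thesis
      proof (cases "s aD (rh k) = 0")
        case True
        then have e: "sem relax s = s(vFail := (s vFail)(0 := 1))"
          using k(1) a act viol by (simp add: relax_def)
        have "\<not> (satisfies \<phi> (active s) \<and> in_range \<phi>)" for \<phi> using below[of \<phi>] True by auto
        then show ?thesis
          using so tot unfolding e by (auto simp: sound_def tight_def total_def)
      next
        case False
        define d where "d = (s aD)(rh k := s aD (rh k) - 1)"
        have e: "sem relax s = s(aD := d, vViol := (s vViol)(0 := 1))"
          using k(1) a act viol False by (simp add: relax_def d_def)
        have "(\<Sum>v<2 * P. d v) + 1 = (\<Sum>v<2 * P. s aD v)"
        proof -
          have "(\<Sum>v<2 * P. s aD v) = s aD (rh k) + (\<Sum>v\<in>{..<2 * P} - {rh k}. s aD v)"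
            using hk by (intro sum.remove) auto
          moreover have "(\<Sum>v<2 * P. d v) = d (rh k) + (\<Sum>v\<in>{..<2 * P} - {rh k}. d v)"
            using hk by (intro sum.remove) auto
          moreover have "(\<Sum>v\<in>{..<2 * P} - {rh k}. d v) = (\<Sum>v\<in>{..<2 * P} - {rh k}. s aD v)"
            by (intro sum.cong) (auto simp: d_def)
          moreover have "d (rh k) + 1 = s aD (rh k)" using False by (simp add: d_def)
          ultimately show ?thesis by linarith
        qed
        then have "total (sem relax s) + sem relax s vViol 0 \<le> S"
          using tot unfolding e by (simp add: total_def)
        moreover have "sound (active s) (sem relax s)"
          unfolding sound_def
        proof (intro conjI allI impI)
          show "sem relax s aD v \<le> B" if "v < 2 * P" for v
          proof -
            have "d v \<le> s aD v" by (simp add: d_def)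
            also have "\<dots> \<le> B" using so that by (simp add: sound_def)
            finally show ?thesis by (simp add: e)
          qed
          show "sem relax s vViol 0 \<le> 1" by (simp add: e)
          fix \<phi> assume \<phi>: "satisfies \<phi> (active s)" "in_range \<phi>"
          then show "sem relax s vFail 0 = 0" using so by (simp add: e sound_def)
          show "\<phi> v \<le> int (sem relax s aD v)" if "v < 2 * P" for v
          proof (cases "v = rh k")
            case True
            then show ?thesis using below[OF \<phi>] False by (simp add: e d_def)
          next
            case False
            then show ?thesis using so \<phi> that by (simp add: e d_def sound_def)
          qed
        qed
        moreover have "tight (active s \<inter> {..<Suc k}) (sem relax s)" by (simp add: tight_def e)
        ultimately show ?thesis by blast
      qed
    qed
  qed
qed

lemma env_cong:
  assumes "env s" "\<And>a. a \<in> {vP, vB, aT, aH, aP, aM} \<Longrightarrow> s' a = s a"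
  shows "env s'"
  using assms by (simp add: env_def)

lemma relax_pass:
  assumes env: "env s0" and so: "sound (active s0) s0" and v: "s0 vViol 0 = 0"
  shows "runs (For vK M6 relax) s0 (3 + (6 * P + 1) * 110)
    (\<lambda>s'. sound (active s0) s' \<and> tight (active s0) s' \<and> total s' + s' vViol 0 \<le> total s0)"
proof (rule runs_For[where b = "6 * P" and tb = 80 and
      I = "\<lambda>k s. sound (active s0) s \<and> tight (active s0 \<inter> {..<k}) s \<and> total s + s vViol 0 \<le> total s0"])
  have P: "s0 vP 0 = P" using env by (simp add: env_def)
  show "vK \<notin> mods relax" by (simp add: relax_def)
  show "val M6 s = 6 * P" if "\<And>a. a \<noteq> vK \<Longrightarrow> a \<notin> mods relax \<Longrightarrow> s a = s0 a" for s
    using that[of vP] P by (simp add: relax_def)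
  show "sound (active s0) (s0(vK := (s0 vK)(0 := 0))) \<and> tight (active s0 \<inter> {..<0}) (s0(vK := (s0 vK)(0 := 0))) \<and>
    total (s0(vK := (s0 vK)(0 := 0))) + (s0(vK := (s0 vK)(0 := 0))) vViol 0 \<le> total s0"
    using so v by (simp add: sound_def tight_def total_def)
next
  fix k s assume k: "k < 6 * P" "s vK 0 = k" and fr: "\<And>a. a \<noteq> vK \<Longrightarrow> a \<notin> mods relax \<Longrightarrow> s a = s0 a"
    and I: "sound (active s0) s \<and> tight (active s0 \<inter> {..<k}) s \<and> total s + s vViol 0 \<le> total s0"
  have act: "active s = active s0" using fr[of aA] by (simp add: active_def relax_def)
  have "env s" by (rule env_cong[OF env]) (use fr in \<open>auto simp: relax_def\<close>)
  then have "runs relax s 80 (\<lambda>s'. sound (active s) s' \<and> tight (active s \<inter> {..<Suc k}) s' \<and> total s' + s' vViol 0 \<le> total s0)"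
    using relax_step[of s k "total s0"] k I act by simp
  then show "runs relax s 80 (\<lambda>s'. sound (active s0) (s'(vK := (s' vK)(0 := Suc k))) \<and>
      tight (active s0 \<inter> {..<Suc k}) (s'(vK := (s' vK)(0 := Suc k))) \<and>
      total (s'(vK := (s' vK)(0 := Suc k))) + (s'(vK := (s' vK)(0 := Suc k))) vViol 0 \<le> total s0)"
    by (rule runs_weaken) (auto simp: act sound_def tight_def total_def)
next
  fix s assume "sound (active s0) s \<and> tight (active s0 \<inter> {..<6 * P}) s \<and> total s + s vViol 0 \<le> total s0"
  moreover have "active s0 \<inter> {..<6 * P} = active s0" by (auto simp: active_def)
  ultimately show "sound (active s0) s \<and> tight (active s0) s \<and> total s + s vViol 0 \<le> total s0" by simp
qed simp

text \<open>Initially the total is \<open>2 * P * B\<close> and the flag is 1, which bounds the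
  number of passes over the arcs.\<close>

definition pot_time :: nat where
  "pot_time = 20 + (2 * P + 1) * 30 + (2 * P * B + 2) * (10 + (6 * P + 1) * 110)"

lemma runs_potentials:
  assumes env: "env s0"
  shows "runs potentials s0 pot_time (\<lambda>s. (\<forall>v<2 * P. s aD v \<le> B) \<and>
    (s vFail 0 = 0 \<longrightarrow> satisfies (\<lambda>v. int (s aD v)) (active s0)) \<and>
    (s vFail 0 \<noteq> 0 \<longrightarrow> (\<forall>\<phi>. satisfies \<phi> (active s0) \<longrightarrow> \<not> in_range \<phi>)))"
    (is "runs _ _ _ ?Q")
proof -
  define R where "R = active s0"
  have P: "s0 vP 0 = P" and B: "s0 vB 0 = B" using env by (simp_all add: env_def)
  have 1: "runs (For vK M2 (Store aD (Var vK) (Var vB))) s0 (3 + (2 * P + 1) * 30)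
      (\<lambda>s'. s' aD = (\<lambda>j. if 0 \<le> j \<and> j < 0 + 2 * P then B else s0 aD j) \<and> (\<forall>a'. a' \<noteq> vK \<longrightarrow> a' \<noteq> aD \<longrightarrow> s' a' = s0 a'))"
  proof (rule runs_fill[where tb = 8])
    show "runs (Store aD (Var vK) (Var vB)) s 8 (\<lambda>s'. s' aD = (s aD)(0 + k := B))"
      if "s vK 0 = k" "\<And>a'. a' \<noteq> vK \<Longrightarrow> a' \<noteq> aD \<Longrightarrow> s a' = s0 a'" for k s
      using that B by (intro runs_loop_free) simp_all
  qed (use P in simp_all)
  define J where "J k s \<longleftrightarrow> (\<forall>a. a \<notin> mods potentials \<longrightarrow> s a = s0 a) \<and> sound R s \<and> tight R s \<and> total s + s vViol 0 \<le> k" for k s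
  have loop: "runs (While (Var vViol) (Seq (Assign vViol (Num 0)) (For vK M6 relax))) s
      ((2 * P * B + 2) * (10 + (6 * P + 1) * 110)) ?Q" if J: "J (2 * P * B + 1) s" for s
  proof (rule runs_While[where I = J, OF _ J])
    fix k s assume J: "J k s"
    have act: "active s = R" using J unfolding J_def mods_potentials R_def active_def by simp
    have env: "env s" by (rule env_cong[OF env]) (use J in \<open>auto simp: J_def mods_potentials\<close>)
    {
      assume "val (Var vViol) s = 0"
      then have "s vViol 0 = 0" by simp
      then show "?Q s" using J unfolding J_def sound_def tight_def satisfies_def R_def by auto
    }
    assume "val (Var vViol) s \<noteq> 0"
    then have v1: "s vViol 0 = 1" using J by (auto simp: J_def sound_def)
    show "runs (Seq (Assign vViol (Num 0)) (For vK M6 relax)) s (6 + (6 * P + 1) * 110) (\<lambda>s'. \<exists>k'<k. J k' s')"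
    proof (rule runs_Seq)
      let ?s = "s(vViol := (s vViol)(0 := 0))"
      show "runs (Assign vViol (Num 0)) s 3 (\<lambda>s'. s' = ?s)" by (rule runs_loop_free) simp_all
      fix s1 assume s1: "s1 = ?s"
      have "env s1" by (rule env_cong[OF env]) (auto simp: s1)
      moreover have "active s1 = R" using act by (simp add: s1 active_def)
      moreover have "sound R s1" using J by (simp add: J_def s1 sound_def)
      ultimately have "runs (For vK M6 relax) s1 (3 + (6 * P + 1) * 110)
          (\<lambda>s'. sound R s' \<and> tight R s' \<and> total s' + s' vViol 0 \<le> total s1)"
        using relax_pass[of s1] by (simp add: s1)
      from runs_frame[OF this] show "runs (For vK M6 relax) s1 (3 + (6 * P + 1) * 110) (\<lambda>s'. \<exists>k'<k. J k' s')"
      proof (rule runs_weaken)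
        fix s' assume s': "(sound R s' \<and> tight R s' \<and> total s' + s' vViol 0 \<le> total s1) \<and>
          (\<forall>a. a \<notin> mods (For vK M6 relax) \<longrightarrow> s' a = s1 a)"
        have "total s1 + 1 \<le> k" using J v1 by (simp add: J_def s1 total_def)
        moreover have "s' a = s0 a" if "a \<notin> mods potentials" for a
        proof -
          have "a \<notin> mods (For vK M6 relax)" "a \<noteq> vViol"
            using that by (auto simp: mods_potentials mods_For relax_def)
          then show ?thesis using s' J that by (simp add: s1 J_def)
        qed
        ultimately show "\<exists>k'<k. J k' s'" using s' by (intro exI[of _ "total s1"]) (auto simp: J_def)
      qed simp
    qed simp
  qed (intro mult_le_mono, simp_all)
  show ?thesis
    unfolding potentials_def
  proof (rule runs_Seq[OF 1])
    fix s1 assume s1: "s1 aD = (\<lambda>j. if 0 \<le> j \<and> j < 0 + 2 * P then B else s0 aD j) \<and> (\<forall>a'. a' \<noteq> vK \<longrightarrow> a' \<noteq> aD \<longrightarrow> s1 a' = s0 a')"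
    let ?s2 = "s1(vFail := (s1 vFail)(0 := 0), vViol := (s1 vViol)(0 := 1))"
    have J: "J (2 * P * B + 1) ?s2"
    proof -
      have "total ?s2 = 2 * P * B" using s1 by (simp add: total_def)
      moreover have "sound R ?s2" using s1 by (auto simp: sound_def in_range_def)
      moreover have "?s2 a = s0 a" if "a \<notin> mods potentials" for a using s1 that by (auto simp: mods_potentials)
      ultimately show ?thesis by (simp add: J_def tight_def)
    qed
    show "runs (Seq (Assign vFail (Num 0)) (Seq (Assign vViol (Num 1))
       (While (Var vViol) (Seq (Assign vViol (Num 0)) (For vK M6 relax))))) s1 (6 + (2 * P * B + 2) * (10 + (6 * P + 1) * 110)) ?Q"
    proof (rule runs_Seq)
      show "runs (Assign vFail (Num 0)) s1 3 (\<lambda>s'. s' = s1(vFail := (s1 vFail)(0 := 0)))"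
        by (rule runs_loop_free) simp_all
      fix s2 assume s2: "s2 = s1(vFail := (s1 vFail)(0 := 0))"
      show "runs (Seq (Assign vViol (Num 1))
         (While (Var vViol) (Seq (Assign vViol (Num 0)) (For vK M6 relax)))) s2 (3 + (2 * P * B + 2) * (10 + (6 * P + 1) * 110)) ?Q"
      proof (rule runs_Seq)
        show "runs (Assign vViol (Num 1)) s2 3 (\<lambda>s'. s' = ?s2)"
          by (rule runs_loop_free) (simp_all add: s2)
        fix s3 assume "s3 = ?s2"
        then show "runs (While (Var vViol) (Seq (Assign vViol (Num 0)) (For vK M6 relax))) s3
            ((2 * P * B + 2) * (10 + (6 * P + 1) * 110)) ?Q" using loop J by simp
      qed simp
    qed simp
  qed (simp add: pot_time_def)
qed

definition infeasible :: "nat set \<Rightarrow> bool" where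
  "infeasible R \<longleftrightarrow> (\<forall>\<phi>. satisfies \<phi> R \<longrightarrow> \<not> in_range \<phi>)"

definition min_time :: nat where
  "min_time = 3 + (6 * P + 1) * (17 + (pot_time + 20) + 10)"

lemma satisfies_subset: "satisfies \<phi> R \<Longrightarrow> R' \<subseteq> R \<Longrightarrow> satisfies \<phi> R'"
  by (auto simp: satisfies_def)

text \<open>An arc is kept only if the others have a potential without it, and this remains true
  when more arcs are deleted. So a single sweep reaches a minimal system.\<close>

lemma runs_minimize:
  assumes env: "env s0" and bin: "\<And>j. j < 6 * P \<Longrightarrow> s0 aA j \<le> 1" and inf: "infeasible (active s0)"
  shows "runs minimize s0 min_time (\<lambda>s. (\<forall>j<6 * P. s aA j \<le> 1) \<and> active s \<subseteq> active s0 \<and>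
    infeasible (active s) \<and> (\<forall>j\<in>active s. \<exists>\<phi>. satisfies \<phi> (active s - {j})))"
  unfolding minimize_def min_time_def
proof (rule runs_For[where b = "6 * P" and tb = "pot_time + 20" and
      I = "\<lambda>k s. env s \<and> (\<forall>j<6 * P. s aA j \<le> 1) \<and> active s \<subseteq> active s0 \<and> infeasible (active s) \<and>
        (\<forall>j\<in>active s. j < k \<longrightarrow> (\<exists>\<phi>. satisfies \<phi> (active s - {j})))"])
  let ?c = "If (Cell aA (Var vJ)) (Seq (Store aA (Var vJ) (Num 0)) (Seq potentials
     (If (Var vFail) Skip (Store aA (Var vJ) (Num 1))))) Skip"
  show "vJ \<notin> mods ?c" by (simp add: mods_potentials)
  show "val M6 s = 6 * P" if "\<And>a. a \<noteq> vJ \<Longrightarrow> a \<notin> mods ?c \<Longrightarrow> s a = s0 a" for s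
    using that[of vP] env by (simp add: mods_potentials env_def)
  have "active (s0(vJ := (s0 vJ)(0 := 0))) = active s0" by (simp add: active_def)
  moreover have "env (s0(vJ := (s0 vJ)(0 := 0)))" by (rule env_cong[OF env]) auto
  ultimately show "env (s0(vJ := (s0 vJ)(0 := 0))) \<and> (\<forall>j<6 * P. (s0(vJ := (s0 vJ)(0 := 0))) aA j \<le> 1) \<and>
      active (s0(vJ := (s0 vJ)(0 := 0))) \<subseteq> active s0 \<and> infeasible (active (s0(vJ := (s0 vJ)(0 := 0)))) \<and>
      (\<forall>j\<in>active (s0(vJ := (s0 vJ)(0 := 0))). j < 0 \<longrightarrow>
        (\<exists>\<phi>. satisfies \<phi> (active (s0(vJ := (s0 vJ)(0 := 0))) - {j})))"
    using inf bin by simp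
  fix k s assume k: "k < 6 * P" "s vJ 0 = k"
    and I: "env s \<and> (\<forall>j<6 * P. s aA j \<le> 1) \<and> active s \<subseteq> active s0 \<and> infeasible (active s) \<and>
        (\<forall>j\<in>active s. j < k \<longrightarrow> (\<exists>\<phi>. satisfies \<phi> (active s - {j})))"
  define G where "G k s \<longleftrightarrow> env s \<and> (\<forall>j<6 * P. s aA j \<le> 1) \<and> active s \<subseteq> active s0 \<and> infeasible (active s) \<and>
        (\<forall>j\<in>active s. j < k \<longrightarrow> (\<exists>\<phi>. satisfies \<phi> (active s - {j})))" for k s
  have Gup: "G k' (s'(vJ := x))" if "G k' s'" for k' s' x
  proof -
    have "active (s'(vJ := x)) = active s'" by (simp add: active_def)
    moreover have "env (s'(vJ := x))" by (rule env_cong[of s']) (use that in \<open>auto simp: G_def\<close>)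
    ultimately show ?thesis using that by (simp add: G_def)
  qed
  have "runs ?c s (pot_time + 20) (G (Suc k))"
  proof (rule runs_If)
    assume "val (Cell aA (Var vJ)) s = 0"
    then have "k \<notin> active s" using k by (simp add: active_def)
    then have "G (Suc k) s" using I unfolding G_def by (metis less_Suc_eq)
    then show "runs Skip s (pot_time + 16) (G (Suc k))" by (intro runs_loop_free) simp_all
  next
    assume "val (Cell aA (Var vJ)) s \<noteq> 0"
    then have kR: "k \<in> active s" using k by (simp add: active_def)
    define s1 where "s1 = s(aA := (s aA)(k := 0))"
    have act1: "active s1 = active s - {k}" by (auto simp: s1_def active_def)
    have env1: "env s1" by (rule env_cong[of s]) (use I in \<open>auto simp: s1_def\<close>)
    show "runs (Seq (Store aA (Var vJ) (Num 0)) (Seq potentials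
       (If (Var vFail) Skip (Store aA (Var vJ) (Num 1))))) s (pot_time + 16) (G (Suc k))"
    proof (rule runs_Seq[where ?Q1.0 = "\<lambda>s'. s' = s1"])
      show "runs (Store aA (Var vJ) (Num 0)) s 4 (\<lambda>s'. s' = s1)"
        using k by (intro runs_loop_free) (simp_all add: s1_def)
      fix s' assume s': "s' = s1"
      show "runs (Seq potentials (If (Var vFail) Skip (Store aA (Var vJ) (Num 1)))) s' (pot_time + 12) (G (Suc k))"
        unfolding s'
      proof (rule runs_Seq[OF runs_potentials[OF env1]])
        fix s2 assume q: "(\<forall>v<2 * P. s2 aD v \<le> B) \<and>
          (s2 vFail 0 = 0 \<longrightarrow> satisfies (\<lambda>v. int (s2 aD v)) (active s1)) \<and>
          (s2 vFail 0 \<noteq> 0 \<longrightarrow> (\<forall>\<phi>. satisfies \<phi> (active s1) \<longrightarrow> \<not> in_range \<phi>))"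
          and f: "\<And>a. a \<notin> mods potentials \<Longrightarrow> s2 a = s1 a"
        have A2: "s2 aA = (s aA)(k := 0)" and J2: "s2 vJ 0 = k"
          using f[of aA] f[of vJ] k by (simp_all add: mods_potentials s1_def)
        have env2: "env s2" by (rule env_cong[OF env1]) (use f in \<open>auto simp: mods_potentials\<close>)
        have act2: "active s2 = active s - {k}" using A2 by (auto simp: active_def)
        show "runs (If (Var vFail) Skip (Store aA (Var vJ) (Num 1))) s2 12 (G (Suc k))"
        proof (rule runs_loop_free)
          show "G (Suc k) (sem (If (Var vFail) Skip (Store aA (Var vJ) (Num 1))) s2)"
          proof (cases "s2 vFail 0 = 0")
            case True
            define s3 where "s3 = s2(aA := (s2 aA)(k := 1))"
            have "sem (If (Var vFail) Skip (Store aA (Var vJ) (Num 1))) s2 = s3"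
              using True J2 by (simp add: s3_def)
            moreover have "env s3" by (rule env_cong[OF env2]) (auto simp: s3_def)
            moreover have act3: "active s3 = active s" using A2 kR k by (auto simp: s3_def active_def)
            moreover have "\<forall>j<6 * P. s3 aA j \<le> 1" using I A2 by (simp add: s3_def)
            moreover have "\<exists>\<phi>. satisfies \<phi> (active s - {k})" using q True act1 by auto
            ultimately show ?thesis using I by (auto simp: G_def less_Suc_eq)
          next
            case False
            have "sem (If (Var vFail) Skip (Store aA (Var vJ) (Num 1))) s2 = s2" using False by simp
            moreover have "infeasible (active s2)" using q False act1 act2 by (simp add: infeasible_def)
            moreover have "\<forall>j<6 * P. s2 aA j \<le> 1" using I A2 by simp
            moreover have "\<exists>\<phi>. satisfies \<phi> (active s2 - {j})" if "j \<in> active s2" "j < Suc k" for j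
            proof -
              have "j \<in> active s" "j < k" using that act2 by auto
              then obtain \<phi> where "satisfies \<phi> (active s - {j})" using I by blast
              then have "satisfies \<phi> (active s2 - {j})" by (rule satisfies_subset) (use act2 in auto)
              then show ?thesis by blast
            qed
            moreover have "active s2 \<subseteq> active s0" using I act2 by auto
            ultimately show ?thesis using env2 by (simp add: G_def)
          qed
        qed simp_all
      qed simp
    qed simp
  qed simp
  then show "runs ?c s (pot_time + 20) (\<lambda>s'. env (s'(vJ := (s' vJ)(0 := Suc k))) \<and>
      (\<forall>j<6 * P. (s'(vJ := (s' vJ)(0 := Suc k))) aA j \<le> 1) \<and> active (s'(vJ := (s' vJ)(0 := Suc k))) \<subseteq> active s0 \<and>
      infeasible (active (s'(vJ := (s' vJ)(0 := Suc k)))) \<and>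
      (\<forall>j\<in>active (s'(vJ := (s' vJ)(0 := Suc k))). j < Suc k \<longrightarrow>
        (\<exists>\<phi>. satisfies \<phi> (active (s'(vJ := (s' vJ)(0 := Suc k))) - {j}))))"
    by (rule runs_weaken[OF _ order_refl]) (drule Gup, unfold G_def, assumption)
next
  fix s assume "env s \<and> (\<forall>j<6 * P. s aA j \<le> 1) \<and> active s \<subseteq> active s0 \<and> infeasible (active s) \<and>
        (\<forall>j\<in>active s. j < 6 * P \<longrightarrow> (\<exists>\<phi>. satisfies \<phi> (active s - {j})))"
  moreover have "j < 6 * P" if "j \<in> active s" for j using that by (simp add: active_def)
  ultimately show "(\<forall>j<6 * P. s aA j \<le> 1) \<and> active s \<subseteq> active s0 \<and>
    infeasible (active s) \<and> (\<forall>j\<in>active s. \<exists>\<phi>. satisfies \<phi> (active s - {j}))" by blast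
qed simp

lemma runs_push:
  assumes P: "s0 vP 0 = P"
  shows "runs push s0 (3 + (3 * P + 1) * 50) (\<lambda>s. \<forall>i<3 * P. s aU i = s0 aU i + s0 aA i - s0 aA (3 * P + i))"
proof -
  have "runs push s0 (3 + (3 * P + 1) * 50)
      (\<lambda>s'. s' aU = (\<lambda>j. if 0 \<le> j \<and> j < 0 + 3 * P then s0 aU (j - 0) + s0 aA (j - 0) - s0 aA (3 * P + (j - 0)) else s0 aU j) \<and>
        (\<forall>a'. a' \<noteq> vJ \<longrightarrow> a' \<noteq> aU \<longrightarrow> s' a' = s0 a'))"
    unfolding push_def
  proof (rule runs_fill[where tb = 30])
    let ?c = "Store aU (Var vJ) (Sub (Add (Cell aU (Var vJ)) (Cell aA (Var vJ))) (Cell aA (Add M3 (Var vJ))))"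
    show "runs ?c s 30 (\<lambda>s'. s' aU = (s aU)(0 + k := s0 aU k + s0 aA k - s0 aA (3 * P + k)))"
      if "s vJ 0 = k" "\<And>a'. a' \<noteq> vJ \<Longrightarrow> a' \<noteq> aU \<Longrightarrow> s a' = s0 a'"
        "s aU = (\<lambda>j. if 0 \<le> j \<and> j < 0 + k then s0 aU (j - 0) + s0 aA (j - 0) - s0 aA (3 * P + (j - 0)) else s0 aU j)" for k s
    proof -
      have "s aU k = s0 aU k" using that(3) by simp
      then show ?thesis using that(1,2) P by (intro runs_loop_free) simp_all
    qed
  qed (use P in simp_all)
  then show ?thesis by (rule runs_weaken) simp_all
qed

lemma runs_residual_arcs:
  assumes P: "s0 vP 0 = P"
  shows "runs residual_arcs s0 (6 + (3 * P + 1) * 100) (\<lambda>s. \<forall>j<6 * P. s aA j =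
    (if j < 3 * P then 1 else if s0 aF (j - 3 * P) + s0 aU (j - 3 * P) \<noteq> 0 then 1 else 0))"
  unfolding residual_arcs_def
proof (rule runs_Seq)
  show "runs (For vJ M3 (Store aA (Var vJ) (Num 1))) s0 (3 + (3 * P + 1) * 30)
      (\<lambda>s'. s' aA = (\<lambda>j. if 0 \<le> j \<and> j < 0 + 3 * P then 1 else s0 aA j) \<and>
        (\<forall>a'. a' \<noteq> vJ \<longrightarrow> a' \<noteq> aA \<longrightarrow> s' a' = s0 a'))"
  proof (rule runs_fill[where tb = 8])
    show "runs (Store aA (Var vJ) (Num 1)) s 8 (\<lambda>s'. s' aA = (s aA)(0 + k := 1))"
      if "s vJ 0 = k" for k s
      using that by (intro runs_loop_free) simp_all
  qed (use P in simp_all)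
  fix s1 assume s1: "s1 aA = (\<lambda>j. if 0 \<le> j \<and> j < 0 + 3 * P then 1 else s0 aA j) \<and>
        (\<forall>a'. a' \<noteq> vJ \<longrightarrow> a' \<noteq> aA \<longrightarrow> s1 a' = s0 a')"
  let ?f = "\<lambda>k. if s0 aF k + s0 aU k \<noteq> 0 then 1 else 0 :: nat"
  let ?c = "If (Add (Cell aF (Var vJ)) (Cell aU (Var vJ)))
       (Store aA (Add M3 (Var vJ)) (Num 1)) (Store aA (Add M3 (Var vJ)) (Num 0))"
  have P1: "s1 vP 0 = P" using s1 P by simp
  have "runs (For vJ M3 ?c) s1 (3 + (3 * P + 1) * 70)
      (\<lambda>s'. s' aA = (\<lambda>j. if 3 * P \<le> j \<and> j < 3 * P + 3 * P then ?f (j - 3 * P) else s1 aA j) \<and>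
        (\<forall>a'. a' \<noteq> vJ \<longrightarrow> a' \<noteq> aA \<longrightarrow> s' a' = s1 a'))"
  proof (rule runs_fill[where tb = 50])
    show "runs ?c s 50 (\<lambda>s'. s' aA = (s aA)(3 * P + k := ?f k))"
      if "s vJ 0 = k" "\<And>a'. a' \<noteq> vJ \<Longrightarrow> a' \<noteq> aA \<Longrightarrow> s a' = s1 a'" for k s
      using that P1 s1 by (intro runs_loop_free) simp_all
  qed (use P1 in simp_all)
  then show "runs (For vJ M3 ?c) s1 (3 + (3 * P + 1) * 70) (\<lambda>s. \<forall>j<6 * P. s aA j =
    (if j < 3 * P then 1 else if s0 aF (j - 3 * P) + s0 aU (j - 3 * P) \<noteq> 0 then 1 else 0))"
    by (rule runs_weaken) (use s1 in auto)
qed simp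

definition solve_time :: "nat \<Rightarrow> nat" where
  "solve_time k = 3 + (k + 2) * (30 + (3 * P + 1) * 150 + pot_time + min_time)"

text \<open>Costs of flows are nonnegative by weak duality with \<open>\<psi>0\<close>, and every
  augmentation lowers the integral cost, so the initial cost bounds the number of rounds.\<close>

lemma runs_solve:
  assumes env: "env s0" and F: "\<And>i. i < 3 * P \<Longrightarrow> s0 aF i \<noteq> 0 \<longleftrightarrow> fr i"
    and U: "\<And>i. i < 3 * P \<Longrightarrow> \<not> fr i \<Longrightarrow> int (s0 aU i) = u0 i"
    and u0: "flow u0" "flow_cost u0 \<le> int k0" and \<psi>0: "feasible \<psi>0" "0 \<le> \<beta> \<psi>0"
  shows "runs solve s0 (solve_time k0) (\<lambda>s. feasible (\<lambda>v. int (s aD v)) \<and>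
    (\<forall>\<psi>. feasible \<psi> \<longrightarrow> \<beta> \<psi> \<le> \<beta> (\<lambda>v. int (s aD v))))"
proof -
  define opt where "opt s \<longleftrightarrow> feasible (\<lambda>v. int (s aD v)) \<and>
    (\<forall>\<psi>. feasible \<psi> \<longrightarrow> \<beta> \<psi> \<le> \<beta> (\<lambda>v. int (s aD v)))" for s :: memory
  have nonneg: "0 \<le> flow_cost u" if "flow u" for u using weak_duality[OF that \<psi>0(1)] \<psi>0(2) by linarith
  define base where "base s \<longleftrightarrow> env s \<and> (\<forall>i<3 * P. s aF i \<noteq> 0 \<longleftrightarrow> fr i)" for s
  \<comment> \<open>The flow on free arcs may be negative and is not represented in memory. This is
    harmless because such arcs are residual in both directions anyway.\<close>
  define good where "good k s \<longleftrightarrow> (\<exists>u. flow u \<and> (\<forall>i<3 * P. \<not> fr i \<longrightarrow> int (s aU i) = u i) \<and> nat (flow_cost u) < k)" for k s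
  define I where "I k s \<longleftrightarrow> base s \<and> (s vOk 0 = 0 \<and> good k s \<or> s vOk 0 = 1 \<and> opt s)" for k s
  let ?body = "Seq residual_arcs (Seq potentials (If (Var vFail) (Seq minimize push) (Assign vOk (Num 1))))"
  have base_cong: "base s'" if "base s" "\<And>a. a \<in> {vP, vB, aT, aH, aP, aM, aF} \<Longrightarrow> s' a = s a" for s s'
  proof -
    have "env s'" by (rule env_cong[of s]) (use that in \<open>auto simp: base_def\<close>)
    then show ?thesis using that by (simp add: base_def)
  qed
  have main: "runs ?body s (24 + (3 * P + 1) * 150 + pot_time + min_time) (\<lambda>s'. \<exists>k'<k. I k' s')"
    if I: "I k s" and ok: "s vOk 0 = 0" for k s
  proof (rule runs_Seq)
    have bs: "base s" using I by (simp add: I_def)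
    obtain u where u: "flow u" "\<And>i. i < 3 * P \<Longrightarrow> \<not> fr i \<Longrightarrow> int (s aU i) = u i" "nat (flow_cost u) < k"
      using I ok by (auto simp: I_def good_def)
    have P: "s vP 0 = P" using bs by (simp add: base_def env_def)
    show "runs residual_arcs s (6 + (3 * P + 1) * 100) (\<lambda>s'. \<forall>j<6 * P. s' aA j =
      (if j < 3 * P then 1 else if s aF (j - 3 * P) + s aU (j - 3 * P) \<noteq> 0 then 1 else 0))"
      by (rule runs_residual_arcs[of s, OF P])
    fix s1 assume A1: "\<forall>j<6 * P. s1 aA j = (if j < 3 * P then 1 else if s aF (j - 3 * P) + s aU (j - 3 * P) \<noteq> 0 then 1 else 0)"
      and f1: "\<And>a. a \<notin> mods residual_arcs \<Longrightarrow> s1 a = s a"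
    have b1: "base s1" by (rule base_cong[OF bs]) (use f1 in \<open>auto simp: mods_residual_arcs\<close>)
    have act1: "active s1 = residual u"
    proof -
      have "s aF i + s aU i \<noteq> 0 \<longleftrightarrow> fr i \<or> 0 < u i" if "i < 3 * P" for i
        using bs u(2)[OF that] that by (cases "fr i") (auto simp: base_def)
      then have "j \<in> active s1 \<longleftrightarrow> j \<in> residual u" for j
        using A1 by (cases "j < 3 * P"; cases "j < 6 * P") (auto simp: active_def residual_def)
      then show ?thesis by blast
    qed
    have bin1: "s1 aA j \<le> 1" if "j < 6 * P" for j using A1 that by simp
    have env1: "env s1" using b1 by (simp add: base_def)
    show "runs (Seq potentials (If (Var vFail) (Seq minimize push) (Assign vOk (Num 1)))) s1
        (18 + (3 * P + 1) * 50 + pot_time + min_time) (\<lambda>s'. \<exists>k'<k. I k' s')"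
    proof (rule runs_Seq[OF runs_potentials[OF env1]])
      fix s2 assume q: "(\<forall>v<2 * P. s2 aD v \<le> B) \<and>
          (s2 vFail 0 = 0 \<longrightarrow> satisfies (\<lambda>v. int (s2 aD v)) (active s1)) \<and>
          (s2 vFail 0 \<noteq> 0 \<longrightarrow> (\<forall>\<phi>. satisfies \<phi> (active s1) \<longrightarrow> \<not> in_range \<phi>))"
        and f2: "\<And>a. a \<notin> mods potentials \<Longrightarrow> s2 a = s1 a"
      have b2: "base s2" by (rule base_cong[OF b1]) (use f2 in \<open>auto simp: mods_potentials\<close>)
      have act2: "active s2 = residual u" using act1 f2[of aA] by (simp add: active_def mods_potentials)
      have U2: "s2 aU = s aU" using f2[of aU] f1[of aU] by (simp add: mods_potentials mods_residual_arcs)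
      show "runs (If (Var vFail) (Seq minimize push) (Assign vOk (Num 1))) s2
        (18 + (3 * P + 1) * 50 + min_time) (\<lambda>s'. \<exists>k'<k. I k' s')"
      proof (rule runs_If)
        assume "val (Var vFail) s2 = 0"
        then have sat: "satisfies (\<lambda>v. int (s2 aD v)) (residual u)" using q act1 by simp
        have "opt s2"
          unfolding opt_def using residual_feasible[OF sat] residual_optimal[OF u(1) sat] weak_duality[OF u(1)] by auto
        moreover have "base (s2(vOk := (s2 vOk)(0 := 1)))" by (rule base_cong[OF b2]) auto
        ultimately have "I 0 (s2(vOk := (s2 vOk)(0 := 1)))" by (simp add: I_def opt_def)
        then show "runs (Assign vOk (Num 1)) s2 (10 + (3 * P + 1) * 50 + min_time) (\<lambda>s'. \<exists>k'<k. I k' s')"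
          using u(3) by (intro runs_loop_free) (auto intro!: exI[of _ 0])
      next
        assume "val (Var vFail) s2 \<noteq> 0"
        then have inf: "infeasible (active s2)" using q act1 act2 by (simp add: infeasible_def)
        have env2: "env s2" using b2 by (simp add: base_def)
        have bin2: "s2 aA j \<le> 1" if "j < 6 * P" for j using bin1[OF that] f2[of aA] by (simp add: mods_potentials)
        show "runs (Seq minimize push) s2 (10 + (3 * P + 1) * 50 + min_time) (\<lambda>s'. \<exists>k'<k. I k' s')"
        proof (rule runs_Seq[OF runs_minimize[OF env2 bin2 inf]])
          fix s3 assume q3: "(\<forall>j<6 * P. s3 aA j \<le> 1) \<and> active s3 \<subseteq> active s2 \<and>
            infeasible (active s3) \<and> (\<forall>j\<in>active s3. \<exists>\<phi>. satisfies \<phi> (active s3 - {j}))"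
            and f3: "\<And>a. a \<notin> mods minimize \<Longrightarrow> s3 a = s2 a"
          have b3: "base s3" by (rule base_cong[OF b2]) (use f3 in \<open>auto simp: mods_minimize\<close>)
          have P3: "s3 vP 0 = P" using b3 by (simp add: base_def env_def)
          define R where "R = active s3"
          have Rlt: "j < 6 * P" if "j \<in> R" for j using that by (simp add: R_def active_def)
          have "\<exists>w. negative_cycle w \<and> set w = R"
          proof (rule minimal_infeasible[of R "{..<2 * P}" "int C" "int B"])
            show "finite R" by (rule finite_subset[of _ "{..<6 * P}"]) (use Rlt in auto)
            show "rh ` R \<subseteq> {..<2 * P}" using Rlt rnodes by auto
            show "\<bar>rc a\<bar> \<le> int C" if "a \<in> R" for a using rcosts Rlt[OF that] by blast
            show "int (card {..<2 * P}) * int C \<le> int B"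
              using bound by (simp only: card_lessThan of_nat_mult[symmetric] of_nat_le_iff)
            show False if "satisfies \<phi> R" "\<And>v. 0 \<le> \<phi> v \<and> \<phi> v \<le> int B" for \<phi>
              using q3 that by (auto simp: infeasible_def in_range_def R_def)
            show "\<exists>\<phi>. satisfies \<phi> (R - {a})" if "a \<in> R" for a using q3 that by (simp add: R_def)
          qed simp_all
          then obtain w where w: "negative_cycle w" "set w = R" by blast
          have wr: "set w \<subseteq> residual u" using w(2) q3 act2 by (simp add: R_def)
          note aug = augment_flow[OF u(1) w(1) wr]
          have U3: "s3 aU = s aU" using f3[of aU] U2 by (simp add: mods_minimize)
          \<comment> \<open>On non-free arcs the truncated subtraction is exact, since a reversed
            arc on the cycle carries at least one unit.\<close>
          have new: "int (s3 aU i + s3 aA i - s3 aA (3 * P + i)) = augment u (set w) i" if "i < 3 * P" "\<not> fr i" for i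
          proof -
            have "s3 aA j = of_bool (j \<in> R)" if "j < 6 * P" for j
              using q3 that by (auto simp: R_def active_def le_Suc_eq)
            then have a: "s3 aA i = of_bool (i \<in> R)" "s3 aA (3 * P + i) = of_bool (i + 3 * P \<in> R)"
              using \<open>i < 3 * P\<close> by (simp_all add: add.commute)
            have "i + 3 * P \<in> R \<Longrightarrow> 0 < u i" using wr w(2) that by (auto simp: residual_def)
            then show ?thesis using u(2)[OF that] w(2) unfolding U3 a augment_def by auto
          qed
          from runs_frame[OF runs_push[of s3, OF P3]]
          show "runs push s3 (3 + (3 * P + 1) * 50) (\<lambda>s'. \<exists>k'<k. I k' s')"
          proof (rule runs_weaken)
            fix s4 assume s4: "(\<forall>i<3 * P. s4 aU i = s3 aU i + s3 aA i - s3 aA (3 * P + i)) \<and> (\<forall>a. a \<notin> mods push \<longrightarrow> s4 a = s3 a)"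
            have "base s4" by (rule base_cong[OF b3]) (use s4 in \<open>auto simp: mods_push\<close>)
            moreover have "good (k - 1) s4"
              unfolding good_def
            proof (intro exI[of _ "augment u (set w)"] conjI allI impI)
              show "flow (augment u (set w))" by (rule aug(1))
              show "int (s4 aU i) = augment u (set w) i" if "i < 3 * P" "\<not> fr i" for i
                using s4 new[OF that] that by simp
              show "nat (flow_cost (augment u (set w))) < k - 1"
                using aug(2) u(3) nonneg[OF aug(1)] by linarith
            qed
            moreover have "s4 vOk 0 = 0"
              using s4 f3[of vOk] f2[of vOk] f1[of vOk] ok
              by (simp add: mods_push mods_minimize mods_potentials mods_residual_arcs)
            ultimately have "I (k - 1) s4" by (simp add: I_def)
            then show "\<exists>k'<k. I k' s4" using u(3) by (intro exI[of _ "k - 1"]) simp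
          qed simp
        qed simp_all
      qed simp
    qed simp
  qed simp
  show ?thesis
    unfolding solve_def
  proof (rule runs_Seq)
    let ?s = "s0(vOk := (s0 vOk)(0 := 0))"
    show "runs (Assign vOk (Num 0)) s0 3 (\<lambda>s'. s' = ?s)" by (rule runs_loop_free) simp_all
    fix s1 assume s1: "s1 = ?s"
    have "base s0" using env F by (simp add: base_def)
    then have "base s1" by (rule base_cong) (auto simp: s1)
    moreover have "good (k0 + 1) s1"
      unfolding good_def using u0 U nonneg[OF u0(1)] by (intro exI[of _ u0]) (auto simp: s1)
    ultimately have I0: "I (k0 + 1) s1" by (simp add: I_def s1)
    show "runs (While (Sub (Num 1) (Var vOk)) ?body) s1 ((k0 + 2) * (30 + (3 * P + 1) * 150 + pot_time + min_time))
      (\<lambda>s. feasible (\<lambda>v. int (s aD v)) \<and> (\<forall>\<psi>. feasible \<psi> \<longrightarrow> \<beta> \<psi> \<le> \<beta> (\<lambda>v. int (s aD v))))"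
    proof (rule runs_While[where I = I, OF _ I0])
      show "runs ?body s (24 + (3 * P + 1) * 150 + pot_time + min_time) (\<lambda>s'. \<exists>k'<k. I k' s')"
        if "I k s" "val (Sub (Num 1) (Var vOk)) s \<noteq> 0" for k s
        using main[OF that(1)] that by (auto simp: I_def)
      show "feasible (\<lambda>v. int (s aD v)) \<and> (\<forall>\<psi>. feasible \<psi> \<longrightarrow> \<beta> \<psi> \<le> \<beta> (\<lambda>v. int (s aD v)))"
        if "I k s" "val (Sub (Num 1) (Var vOk)) s = 0" for k s
        using that by (auto simp: I_def opt_def)
    qed (intro mult_le_mono, simp_all)
  qed (simp add: solve_time_def)
qed

end

section \<open>From the input to the network, and the complete algorithm\<close>

section \<open>Construction of the network\<close>

definition scalar :: "nat \<Rightarrow> nat \<Rightarrow> nat" where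
  "scalar x = (\<lambda>j. if j = 0 then x else 0)"

definition table :: "nat \<Rightarrow> (nat \<Rightarrow> nat) \<Rightarrow> nat \<Rightarrow> nat" where
  "table b f = (\<lambda>j. if j < b then f j else 0)"

lemma scalar_0 [simp]: "scalar x 0 = x"
  by (simp add: scalar_def)

lemma table_less [simp]: "j < b \<Longrightarrow> table b f j = f j"
  by (simp add: table_def)

lemma table_Suc: "table (Suc k) f = (table k f)(k := f k)"
  by (auto simp: table_def less_Suc_eq)

lemma table_0: "table 0 f = (\<lambda>_. 0)"
  by (simp add: table_def)

text \<open>A sum of the two truncated differences vanishes iff the numbers are equal. So
  \<open>q = p + d\<close> is tested first and then \<open>p = q + d\<close>, because the
  orientation of input edges is arbitrary.\<close>

definition edge_loop :: "nat \<Rightarrow> exp \<Rightarrow> com" where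
  "edge_loop a d = (let p = Cell aIdx (Cell 5 (Var vI)); q = Cell aIdx (Cell 6 (Var vI)) in
     For vI (Var vE)
       (If (Add (Sub q (Add p d)) (Sub (Add p d) q))
          (If (Add (Sub p (Add q d)) (Sub (Add q d) p)) Skip (Store a q (Num 1)))
          (Store a p (Num 1))))"

definition by_kind :: "com \<Rightarrow> com \<Rightarrow> com \<Rightarrow> com" where
  "by_kind c1 c2 c3 = If (Sub (Var vP) (Var vI)) c1 (If (Sub M2 (Var vI)) c2 c3)"

text \<open>Coordinates relative to the first vertex, shifted by \<open>n + 1\<close> to stay
  nonnegative, computed from pairs of naturals. The product with the row length is looked up in
  \<open>aRow\<close>.\<close>

definition index_exp :: exp where
  "index_exp = (let shift = (\<lambda>p m. Sub (Add (Add (Cell p (Var vI)) (Var m)) (Add (Var vN) (Num 1)))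
       (Add (Cell m (Var vI)) (Var p)))
     in Add (shift 1 2) (Cell aRow (shift 3 4)))"

text \<open>Products are read off tables of multiples: \<open>aRow\<close> provides
  \<open>P = W * W\<close>, and \<open>aMul\<close> provides \<open>P * P\<close>.\<close>

definition steps :: "com list" where
  "steps = (let i = Var vI; j = Sub i (Var vP); l = Sub j (Var vP); i3 = Sub i M3 in
    [Assign vN (Cell 0 (Num 0)),
     Assign vE (Cell 0 (Num 1)),
     Assign vW (Add (Add (Var vN) (Var vN)) (Num 3)),
     For vI (Add (Var vW) (Num 1)) (If i (Store aRow i (Add (Cell aRow (Sub i (Num 1))) (Var vW))) Skip),
     Assign vP (Cell aRow (Var vW)),
     For vI (Add (Var vP) (Num 1)) (If i (Store aMul i (Add (Cell aMul (Sub i (Num 1))) (Var vP))) Skip),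
     Assign vB (Add (Cell aMul (Var vP)) (Cell aMul (Var vP))),
     For vI (Var vN) (Store aIdx i index_exp),
     For vI (Var vN) (Store aVx (Cell aIdx i) (Num 1)),
     edge_loop aEh (Num 1),
     edge_loop aEv (Var vW),
     For vI (Var vP) (If i (Store aPar i (Sub (Num 1) (Cell aPar (Sub i (Num 1))))) Skip),
     For vI (Var vP) (If (Sub (Add (Add (Cell aEh i) (Cell aEh (Add i (Var vW))))
           (Add (Cell aEv i) (Cell aEv (Add i (Num 1))))) (Num 3))
         (Store aNb i (Add i (Var vP))) (Store aNb i i)),
     For vI M3 (by_kind
         (If (Cell aPar i) (Store aT0 i (Sub i (Var vW))) (Store aT0 i i))
         (If (Cell aPar j) (Store aT0 i j) (Store aT0 i (Sub j (Num 1))))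
         (Store aT0 i (Cell aNb l))),
     For vI M3 (by_kind
         (If (Cell aPar i) (Store aH0 i (Cell aNb i)) (Store aH0 i (Cell aNb (Sub i (Var vW)))))
         (If (Cell aPar j) (Store aH0 i (Cell aNb (Sub j (Num 1)))) (Store aH0 i (Cell aNb j)))
         (Store aH0 i l)),
     For vI (Var vP) (If (Sub i (Num 1))
         (Store aP0 i (Add (Cell aVx i) (Cell aP0 (Sub i (Num 2))))) (Store aP0 i (Cell aVx i))),
     For vI (Var vP) (If i (Store aM0 i (Cell aP0 (Sub i (Num 1)))) Skip),
     For vI M6 (If (Sub M3 i) (Store aT i (Cell aT0 i)) (Store aT i (Cell aH0 i3))),
     For vI M6 (If (Sub M3 i) (Store aH i (Cell aH0 i)) (Store aH i (Cell aT0 i3))),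
     For vI M6 (If (Sub M3 i) (Store aP i (Cell aP0 i)) (Store aP i (Cell aM0 i3))),
     For vI M6 (If (Sub M3 i) (Store aM i (Cell aM0 i)) (Store aM i (Cell aP0 i3))),
     For vI M3 (by_kind (Store aF i (Sub (Num 1) (Cell aEh i))) (Store aF i (Sub (Num 1) (Cell aEv j))) Skip),
     For vI M3 (by_kind (Store aU i (Add (Cell aVx i) (Cell aVx (Add i (Num 1)))))
         (Store aU i (Add (Cell aVx j) (Cell aVx (Add j (Var vW)))))
         (Store aU i (Num 3)))])"

definition collect :: com where
  "collect = Seq (For vI (Var vP)
       (Assign vSum (Add (Var vSum) (Sub (Cell aD (Cell aNb (Var vI))) (Cell aD (Var vI))))))
     (Assign 0 (Var vSum))"

definition algorithm :: com where
  "algorithm = foldr Seq steps (Seq solve collect)"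

text \<open>The input memory as seen from the lattice. The window is centred at the first vertex in
  the list.\<close>

locale encoded_region = indexed_region +
  fixes \<sigma>0 :: memory and vs :: "nat \<Rightarrow> cell" and led :: "nat \<Rightarrow> ledge" and ne :: nat
  assumes n0: "\<sigma>0 0 0 = n" and ne0: "\<sigma>0 0 1 = ne"
    and coords: "i < n \<Longrightarrow> int (\<sigma>0 1 i) - int (\<sigma>0 2 i) = fst (vs i) \<and> int (\<sigma>0 3 i) - int (\<sigma>0 4 i) = snd (vs i)"
    and vs: "vs ` {..<n} = Vt" "0 < n" "vs 0 = (x0, y0)"
    and ends: "i < ne \<Longrightarrow> \<sigma>0 5 i < n \<and> \<sigma>0 6 i < n \<and>
      {vs (\<sigma>0 5 i), vs (\<sigma>0 6 i)} = (let (b, x, y) = led i in {(x, y), if b then (x + 1, y) else (x, y + 1)})"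
    and led: "led ` {..<ne} = E"
    and zero: "7 \<le> a \<Longrightarrow> \<sigma>0 a = (\<lambda>_. 0)"
begin

lemma vx_iff: "vx p \<longleftrightarrow> (\<exists>i<n. idx (vs i) = p)"
proof
  assume "vx p"
  then obtain i where "i < n" "vs i = cell_of p" using vs(1) unfolding vx_def by (metis imageE lessThan_iff)
  then show "\<exists>i<n. idx (vs i) = p" using idx_cell_of by metis
next
  assume "\<exists>i<n. idx (vs i) = p"
  then obtain i where "i < n" "idx (vs i) = p" by blast
  moreover have "vs i \<in> Vt" using vs(1) \<open>i < n\<close> by blast
  ultimately show "vx p" using Vt_idx(2) by blast
qed

lemma idx_right:
  assumes "(x, y) \<in> Vt"
  shows "idx (x + 1, y) = idx (x, y) + 1" "idx (x, y + 1) = idx (x, y) + W"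
proof -
  have "0 \<le> x - x0 + int n + 1" "0 \<le> y - y0 + int n + 1" using window[OF assms] by linarith+
  then show "idx (x + 1, y) = idx (x, y) + 1" "idx (x, y + 1) = idx (x, y) + W"
    using nat_add_distrib[of "x - x0 + int n + 1" 1] nat_add_distrib[of "y - y0 + int n + 1" 1]
    by (simp_all add: idx_def algebra_simps)
qed

lemma led_E: "k < ne \<Longrightarrow> led k \<in> E"
  using led by blast

lemma led_anchor: "k < ne \<Longrightarrow> snd (led k) \<in> Vt"
proof -
  assume "k < ne"
  then have "led k \<in> E" by (rule led_E)
  then show ?thesis using E_h E_v by (cases "led k"; cases "fst (led k)") auto
qed

lemma eh_iff: "eh p \<longleftrightarrow> (\<exists>k<ne. fst (led k) \<and> idx (snd (led k)) = p)"
proof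
  assume "eh p"
  then obtain k where "k < ne" "led k = (True, cell_of p)" using led unfolding eh_def by (metis imageE lessThan_iff)
  then show "\<exists>k<ne. fst (led k) \<and> idx (snd (led k)) = p" using idx_cell_of by (intro exI[of _ k]) simp
next
  assume "\<exists>k<ne. fst (led k) \<and> idx (snd (led k)) = p"
  then obtain k where k: "k < ne" "fst (led k)" "idx (snd (led k)) = p" by blast
  then have "cell_of p = snd (led k)" using Vt_idx(1)[OF led_anchor[OF k(1)]] by simp
  then show "eh p" using led_E[OF k(1)] k(2) unfolding eh_def by (metis prod.collapse)
qed

lemma ev_iff: "ev p \<longleftrightarrow> (\<exists>k<ne. \<not> fst (led k) \<and> idx (snd (led k)) = p)"
proof
  assume "ev p"
  then obtain k where "k < ne" "led k = (False, cell_of p)" using led unfolding ev_def by (metis imageE lessThan_iff)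
  then show "\<exists>k<ne. \<not> fst (led k) \<and> idx (snd (led k)) = p" using idx_cell_of by (intro exI[of _ k]) simp
next
  assume "\<exists>k<ne. \<not> fst (led k) \<and> idx (snd (led k)) = p"
  then obtain k where k: "k < ne" "\<not> fst (led k)" "idx (snd (led k)) = p" by blast
  then have "cell_of p = snd (led k)" using Vt_idx(1)[OF led_anchor[OF k(1)]] by simp
  then show "ev p" using led_E[OF k(1)] k(2) unfolding ev_def by (metis prod.collapse)
qed

lemma edge_code:
  assumes k: "k < ne"
  defines "p \<equiv> idx (vs (\<sigma>0 5 k))" and "q \<equiv> idx (vs (\<sigma>0 6 k))" and "r \<equiv> idx (snd (led k))"
  shows "if fst (led k) then p = r \<and> q = r + 1 \<or> q = r \<and> p = r + 1
    else p = r \<and> q = r + W \<or> q = r \<and> p = r + W"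
proof -
  obtain b x y where l: "led k = (b, x, y)" by (cases "led k")
  have v: "(x, y) \<in> Vt" using led_anchor[OF k] by (simp add: l)
  have e: "{vs (\<sigma>0 5 k), vs (\<sigma>0 6 k)} = {(x, y), if b then (x + 1, y) else (x, y + 1)}"
    using ends[OF k] by (simp add: l)
  then have "vs (\<sigma>0 5 k) = (x, y) \<and> vs (\<sigma>0 6 k) = (if b then (x + 1, y) else (x, y + 1)) \<or>
     vs (\<sigma>0 6 k) = (x, y) \<and> vs (\<sigma>0 5 k) = (if b then (x + 1, y) else (x, y + 1))"
    by (simp only: doubleton_eq_iff) blast
  then show ?thesis using idx_right[OF v] unfolding p_def q_def r_def l by auto
qed

text \<open>The costs are alternating sums. Collecting every second term writes \<open>cst\<close>
  as a difference of two natural numbers.\<close>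

fun prefix_cost :: "nat \<Rightarrow> nat" where
  "prefix_cost p = (if p < 2 then of_bool (vx p) else of_bool (vx p) + prefix_cost (p - 2))"

declare prefix_cost.simps [simp del]

definition ap :: "nat \<Rightarrow> nat" where "ap = table P prefix_cost"
definition am :: "nat \<Rightarrow> nat" where "am = table P (\<lambda>p. if p = 0 then 0 else prefix_cost (p - 1))"

lemma cst_prefix: "cst p = int (prefix_cost p) - (if p = 0 then 0 else int (prefix_cost (p - 1)))"
proof (induction p)
  case 0
  then show ?case by (simp add: prefix_cost.simps)
next
  case (Suc p)
  then show ?case
    by (cases "p = 0") (simp_all add: prefix_cost.simps[of "Suc p"] prefix_cost.simps[of 0] prefix_cost.simps[of "Suc 0"])
qed

lemma prefix_cost_le: "prefix_cost p \<le> p + 1"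
proof (induction p rule: prefix_cost.induct)
  case (1 p)
  then show ?case by (cases "p < 2") (auto simp: prefix_cost.simps[of p])
qed

lemma acost_eq: "acost = (\<lambda>i. int (ap i) - int (am i))"
  by (auto simp: acost_def ap_def am_def table_def cst_prefix)

text \<open>The sums in \<open>ap\<close> and \<open>am\<close> are at most \<open>P\<close>, so
  \<open>P\<close> serves as \<open>C\<close>, and \<open>2 * P\<close> nodes lead to the range
  \<open>2 * P * P\<close>.\<close>

sublocale network P tail head ap am free gain "2 * P * P" P
  rewrites "(\<lambda>i. int (ap i) - int (am i)) = acost"
proof -
  show "network P tail head ap am (2 * P * P) P"
  proof
    have "nb p < 2 * P" if "p < P" for p using that by (simp add: nb_def)
    moreover have "lV (i - P) < P" "rV (i - P) < P" if "i < 2 * P" "\<not> i < P" for i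
      using index_le[of "i - P"] that by linarith+
    ultimately show "tail i < 2 * P \<and> head i < 2 * P" if "i < 3 * P" for i
      using index_le[of i] that by (fastforce simp: tail_def head_def)
    show "ap i \<le> P \<and> am i \<le> P" if "i < 3 * P" for i
      using prefix_cost_le[of i] prefix_cost_le[of "i - 1"] by (auto simp: ap_def am_def table_def)
  qed simp
qed (simp add: acost_eq)

definition target :: memory where
  "target a = (if a < 7 then \<sigma>0 a
     else if a = vN then scalar n
     else if a = vE then scalar ne
     else if a = vW then scalar W
     else if a = aRow then table (W + 1) (\<lambda>k. k * W)
     else if a = vP then scalar P
     else if a = aMul then table (P + 1) (\<lambda>k. k * P)
     else if a = vB then scalar (2 * P * P)
     else if a = aIdx then table n (\<lambda>i. idx (vs i))
     else if a = aVx then (\<lambda>p. of_bool (vx p))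
     else if a = aEh then (\<lambda>p. of_bool (eh p))
     else if a = aEv then (\<lambda>p. of_bool (ev p))
     else if a = aPar then table P (\<lambda>p. of_bool (odd p))
     else if a = aNb then table P nb
     else if a = aT0 then table (3 * P) tail
     else if a = aH0 then table (3 * P) head
     else if a = aP0 then ap
     else if a = aM0 then am
     else if a = aT then table (6 * P) rt
     else if a = aH then table (6 * P) rh
     else if a = aP then table (6 * P) rp
     else if a = aM then table (6 * P) rm
     else if a = aF then table (3 * P) (\<lambda>i. of_bool (free i))
     else table (3 * P) (\<lambda>i. nat (flow0 i)))"

lemma target_simps:
  "a < 7 \<Longrightarrow> target a = \<sigma>0 a"
  "target vN = scalar n"
  "target vE = scalar ne"
  "target vW = scalar W"
  "target aRow = table (W + 1) (\<lambda>k. k * W)"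
  "target vP = scalar P"
  "target aMul = table (P + 1) (\<lambda>k. k * P)"
  "target vB = scalar (2 * P * P)"
  "target aIdx = table n (\<lambda>i. idx (vs i))"
  "target aVx = (\<lambda>p. of_bool (vx p))"
  "target aEh = (\<lambda>p. of_bool (eh p))"
  "target aEv = (\<lambda>p. of_bool (ev p))"
  "target aPar = table P (\<lambda>p. of_bool (odd p))"
  "target aNb = table P nb"
  "target aT0 = table (3 * P) tail"
  "target aH0 = table (3 * P) head"
  "target aP0 = ap"
  "target aM0 = am"
  "target aT = table (6 * P) rt"
  "target aH = table (6 * P) rh"
  "target aP = table (6 * P) rp"
  "target aM = table (6 * P) rm"
  "target aF = table (3 * P) (\<lambda>i. of_bool (free i))"
  "target aU = table (3 * P) (\<lambda>i. nat (flow0 i))"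
  by (simp_all add: target_def)

lemma target_0 [simp]: "target vN 0 = n" "target vE 0 = ne" "target vW 0 = W" "target vP 0 = P" "target vB 0 = 2 * P * P"
  by (simp_all add: target_simps)

text \<open>The arrays are computed in the order of their numbers, and the counters \<open>7\<close>, \<open>8\<close>, \<open>9\<close> are
  disregarded.\<close>

definition stage :: "nat \<Rightarrow> memory \<Rightarrow> bool" where
  "stage a s \<longleftrightarrow> (\<forall>a'<a. a' \<notin> {7, 8, 9} \<longrightarrow> s a' = target a') \<and> (\<forall>a'\<ge>a. s a' = (\<lambda>_. 0))"

definition size_bound :: nat where "size_bound = 6 * P + n + ne + W + 1"

definition unit_time :: nat where "unit_time = 3 + (size_bound + 1) * 300"

lemma stage_init: "stage vN \<sigma>0"
  using zero by (auto simp: stage_def target_def)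

lemma stage_prev: "stage a s \<Longrightarrow> a' < a \<Longrightarrow> a' \<notin> {7, 8, 9} \<Longrightarrow> s a' = target a'"
  by (simp add: stage_def)

lemma stage_Assign:
  assumes "stage a s" "10 \<le> a" "cost e \<le> 100" "target a = scalar (val e s)"
  shows "runs (Assign a e) s unit_time (stage (Suc a))"
proof (rule runs_loop_free)
  have "s a = (\<lambda>_. 0)" using assms(1) by (simp add: stage_def)
  then show "stage (Suc a) (sem (Assign a e) s)"
    using assms(1,2,4) by (auto simp: stage_def less_Suc_eq scalar_def)
qed (use assms(3) in \<open>simp_all add: unit_time_def\<close>)

text \<open>\<open>f k\<close> is the content of the array after \<open>k\<close> rounds. Lower
  arrays are final and higher ones still zero, so each step of the construction can be verified on
  its own.\<close>

lemma stage_loop: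
  fixes f :: "nat \<Rightarrow> nat \<Rightarrow> nat"
  assumes st: "stage a s0" and a: "10 \<le> a" and c: "mods c \<subseteq> {a}" "loop_free c" "duration c \<le> 200"
    and e: "\<And>s. (\<And>a'. a' < a \<Longrightarrow> a' \<notin> {7, 8, 9} \<Longrightarrow> s a' = target a') \<Longrightarrow> val e s = b" "cost e \<le> 20" "b \<le> size_bound"
    and f: "f 0 = (\<lambda>_. 0)" "f b = target a"
    and body: "\<And>k s. k < b \<Longrightarrow> (\<And>a'. a' < a \<Longrightarrow> a' \<notin> {7, 8, 9} \<Longrightarrow> s a' = target a') \<Longrightarrow> s 7 0 = k \<Longrightarrow>
      s a = f k \<Longrightarrow> sem c s a = f (Suc k)"
  shows "runs (For vI e c) s0 unit_time (stage (Suc a))"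
proof (rule runs_For[where b = b and tb = 200 and I = "\<lambda>k s. s a = f k \<and> (\<forall>a'. a' \<noteq> 7 \<longrightarrow> a' \<noteq> a \<longrightarrow> s a' = s0 a')"])
  show "7 \<notin> mods c" using a c by auto
  show "val e s = b" if s: "\<And>a'. a' \<noteq> 7 \<Longrightarrow> a' \<notin> mods c \<Longrightarrow> s a' = s0 a'" for s
  proof (rule e(1))
    fix a' assume a': "a' < a" "a' \<notin> {7, 8, 9}"
    then have "a' \<notin> mods c" using c(1) by auto
    then show "s a' = target a'" using s[of a'] a' stage_prev[OF st] by simp
  qed
  show "(s0(7 := (s0 7)(0 := 0))) a = f 0 \<and>
    (\<forall>a'. a' \<noteq> 7 \<longrightarrow> a' \<noteq> a \<longrightarrow> (s0(7 := (s0 7)(0 := 0))) a' = s0 a')"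
    using st a f(1) by (simp add: stage_def)
  show "runs c s 200 (\<lambda>s'. (s'(7 := (s' 7)(0 := Suc k))) a = f (Suc k) \<and>
      (\<forall>a'. a' \<noteq> 7 \<longrightarrow> a' \<noteq> a \<longrightarrow> (s'(7 := (s' 7)(0 := Suc k))) a' = s0 a'))"
    if k: "k < b" "s a = f k \<and> (\<forall>a'. a' \<noteq> 7 \<longrightarrow> a' \<noteq> a \<longrightarrow> s a' = s0 a')" "s 7 0 = k" for k s
  proof -
    have prev: "s a' = target a'" if "a' < a" "a' \<notin> {7, 8, 9}" for a'
      using k(2) st that by (simp add: stage_def)
    have "sem c s a = f (Suc k)" using body[OF k(1) prev k(3)] k(2) by blast
    then have "runs c s 200 (\<lambda>s'. s' a = f (Suc k))" using c by (intro runs_loop_free)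
    from runs_frame[OF this] show ?thesis
      by (rule runs_weaken) (use k(2) a c(1) in auto)
  qed
  show "stage (Suc a) s" if "s a = f b \<and> (\<forall>a'. a' \<noteq> 7 \<longrightarrow> a' \<noteq> a \<longrightarrow> s a' = s0 a')" for s
    using that st a f(2) by (auto simp: stage_def less_Suc_eq)
  have "(b + 1) * (cost e + 200 + 10) \<le> (size_bound + 1) * 300"
    using e(2,3) by (intro mult_le_mono) simp_all
  then show "3 + (b + 1) * (cost e + 200 + 10) \<le> unit_time" by (simp add: unit_time_def)
qed

lemma stage_fill:
  assumes st: "stage a s0" "10 \<le> a" "mods c \<subseteq> {a}" "loop_free c" "duration c \<le> 200"
    and e: "\<And>s. (\<And>a'. a' < a \<Longrightarrow> a' \<notin> {7, 8, 9} \<Longrightarrow> s a' = target a') \<Longrightarrow> val e s = b" "cost e \<le> 20" "b \<le> size_bound"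
    and f: "target a = table b f"
    and body: "\<And>k s. k < b \<Longrightarrow> (\<And>a'. a' < a \<Longrightarrow> a' \<notin> {7, 8, 9} \<Longrightarrow> s a' = target a') \<Longrightarrow> s 7 0 = k \<Longrightarrow>
      (\<And>j. s a j = (if j < k then f j else 0)) \<Longrightarrow> sem c s a = (s a)(k := f k)"
  shows "runs (For vI e c) s0 unit_time (stage (Suc a))"
proof (rule stage_loop[OF st e(1) e(2) e(3), where f = "\<lambda>k. table k f"])
  show "sem c s a = table (Suc k) f"
    if "k < b" "\<And>a'. a' < a \<Longrightarrow> a' \<notin> {7, 8, 9} \<Longrightarrow> s a' = target a'" "s 7 0 = k" "s a = table k f" for k s
    using body[OF that(1,2,3)] that(4) by (simp add: table_Suc) (simp add: table_def)
qed (simp_all add: f table_0)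

lemma stage_scatter:
  assumes st: "stage a s0" "10 \<le> a" "mods c \<subseteq> {a}" "loop_free c" "duration c \<le> 200"
    and e: "\<And>s. (\<And>a'. a' < a \<Longrightarrow> a' \<notin> {7, 8, 9} \<Longrightarrow> s a' = target a') \<Longrightarrow> val e s = b" "cost e \<le> 20" "b \<le> size_bound"
    and f: "target a = (\<lambda>p. of_bool (R p))" "\<And>p. R p \<longleftrightarrow> (\<exists>k<b. sel k \<and> g k = p)"
    and body: "\<And>k s. k < b \<Longrightarrow> (\<And>a'. a' < a \<Longrightarrow> a' \<notin> {7, 8, 9} \<Longrightarrow> s a' = target a') \<Longrightarrow> s 7 0 = k \<Longrightarrow>
      sem c s a = (if sel k then (s a)(g k := 1) else s a)"
  shows "runs (For vI e c) s0 unit_time (stage (Suc a))"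
proof (rule stage_loop[OF st e(1) e(2) e(3), where f = "\<lambda>k p. of_bool (\<exists>k'<k. sel k' \<and> g k' = p)"])
  show "sem c s a = (\<lambda>p. of_bool (\<exists>k'<Suc k. sel k' \<and> g k' = p))"
    if "k < b" "\<And>a'. a' < a \<Longrightarrow> a' \<notin> {7, 8, 9} \<Longrightarrow> s a' = target a'" "s 7 0 = k"
      "s a = (\<lambda>p. of_bool (\<exists>k'<k. sel k' \<and> g k' = p))" for k s
    using body[OF that(1,2,3)] that(4) by (auto simp: fun_eq_iff less_Suc_eq of_bool_def)
qed (simp_all add: f)

definition advance :: "nat \<Rightarrow> com \<Rightarrow> bool" where
  "advance a c \<longleftrightarrow> (\<forall>s. stage a s \<longrightarrow> runs c s unit_time (stage (Suc a)))"

primrec advances :: "nat \<Rightarrow> com list \<Rightarrow> bool" where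
  "advances a [] \<longleftrightarrow> True"
| "advances a (c # cs) \<longleftrightarrow> advance a c \<and> advances (Suc a) cs"

lemma runs_advances:
  assumes "advances a cs" "stage a s" "\<And>s'. stage (a + length cs) s' \<Longrightarrow> runs d s' t Q"
  shows "runs (foldr Seq cs d) s (length cs * unit_time + t) Q"
  using assms
proof (induction cs arbitrary: a s)
  case Nil
  then show ?case by simp
next
  case (Cons c cs)
  have "runs c s unit_time (stage (Suc a))" using Cons.prems by (simp add: advance_def)
  then show ?case
    unfolding foldr.simps o_apply
  proof (rule runs_Seq)
    show "runs (foldr Seq cs d) s' (length cs * unit_time + t) Q" if "stage (Suc a) s'" for s'
      by (rule Cons.IH[OF _ that]) (use Cons.prems in simp_all)
  qed simp
qed

lemma advance_Assign:
  assumes "10 \<le> a" "cost e \<le> 100"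
    and "\<And>s. (\<And>a'. a' < a \<Longrightarrow> a' \<notin> {7, 8, 9} \<Longrightarrow> s a' = target a') \<Longrightarrow> target a = scalar (val e s)"
  shows "advance a (Assign a e)"
  unfolding advance_def using stage_Assign[OF _ assms(1,2)] assms(3) stage_prev by blast

lemma advance_fill:
  assumes "10 \<le> a" "mods c \<subseteq> {a}" "loop_free c" "duration c \<le> 200" 
    "\<And>s. (\<And>a'. a' < a \<Longrightarrow> a' \<notin> {7, 8, 9} \<Longrightarrow> s a' = target a') \<Longrightarrow> val e s = b" "cost e \<le> 20" "b \<le> size_bound"
    "target a = table b f"
    "\<And>k s. k < b \<Longrightarrow> (\<And>a'. a' < a \<Longrightarrow> a' \<notin> {7, 8, 9} \<Longrightarrow> s a' = target a') \<Longrightarrow> s 7 0 = k \<Longrightarrow>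
      (\<And>j. s a j = (if j < k then f j else 0)) \<Longrightarrow> sem c s a = (s a)(k := f k)"
  shows "advance a (For vI e c)"
  unfolding advance_def using stage_fill[OF _ assms] by blast

lemma advance_scatter:
  assumes "10 \<le> a" "mods c \<subseteq> {a}" "loop_free c" "duration c \<le> 200" 
    "\<And>s. (\<And>a'. a' < a \<Longrightarrow> a' \<notin> {7, 8, 9} \<Longrightarrow> s a' = target a') \<Longrightarrow> val e s = b" "cost e \<le> 20" "b \<le> size_bound"
    "target a = (\<lambda>p. of_bool (R p))" "\<And>p. R p \<longleftrightarrow> (\<exists>k<b. sel k \<and> g k = p)"
    "\<And>k s. k < b \<Longrightarrow> (\<And>a'. a' < a \<Longrightarrow> a' \<notin> {7, 8, 9} \<Longrightarrow> s a' = target a') \<Longrightarrow> s 7 0 = k \<Longrightarrow>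
      sem c s a = (if sel k then (s a)(g k := 1) else s a)"
  shows "advance a (For vI e c)"
  unfolding advance_def using stage_scatter[OF _ assms] by blast

text \<open>Inside the window the shift by \<open>n + 1\<close> makes the truncated differences
  exact and keeps the row number within the table.\<close>

lemma index_value:
  assumes "i < n"
  shows "\<sigma>0 3 i + \<sigma>0 4 0 + (n + 1) - (\<sigma>0 4 i + \<sigma>0 3 0) < W + 1"
    and "\<sigma>0 1 i + \<sigma>0 2 0 + (n + 1) - (\<sigma>0 2 i + \<sigma>0 1 0) +
      (\<sigma>0 3 i + \<sigma>0 4 0 + (n + 1) - (\<sigma>0 4 i + \<sigma>0 3 0)) * W = idx (vs i)"
proof -
  obtain x y where xy: "vs i = (x, y)" by (cases "vs i")
  have "\<bar>x - x0\<bar> < int n" "\<bar>y - y0\<bar> < int n" using vs(1) assms window[of x y] xy by (metis imageI lessThan_iff)+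
  moreover have "int (\<sigma>0 1 i) - int (\<sigma>0 2 i) = x" "int (\<sigma>0 3 i) - int (\<sigma>0 4 i) = y"
    "int (\<sigma>0 1 0) - int (\<sigma>0 2 0) = x0" "int (\<sigma>0 3 0) - int (\<sigma>0 4 0) = y0"
    using coords[OF assms] coords[OF vs(2)] vs(3) by (simp_all add: xy)
  ultimately have "\<sigma>0 1 i + \<sigma>0 2 0 + (n + 1) - (\<sigma>0 2 i + \<sigma>0 1 0) = nat (x - x0 + int n + 1)"
    and Y: "\<sigma>0 3 i + \<sigma>0 4 0 + (n + 1) - (\<sigma>0 4 i + \<sigma>0 3 0) = nat (y - y0 + int n + 1)"
    and "nat (y - y0 + int n + 1) < W + 1"
    by (simp_all add: W_def)
  then show "\<sigma>0 3 i + \<sigma>0 4 0 + (n + 1) - (\<sigma>0 4 i + \<sigma>0 3 0) < W + 1"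
    and "\<sigma>0 1 i + \<sigma>0 2 0 + (n + 1) - (\<sigma>0 2 i + \<sigma>0 1 0) +
      (\<sigma>0 3 i + \<sigma>0 4 0 + (n + 1) - (\<sigma>0 4 i + \<sigma>0 3 0)) * W = idx (vs i)"
    by (simp_all add: idx_def xy)
qed

lemma advance_edges:
  assumes "a = aEh \<or> a = aEv" and R: "target a = (\<lambda>p. of_bool (R p))" "\<And>p. R p \<longleftrightarrow> (\<exists>k<ne. fst (led k) = b \<and> idx (snd (led k)) = p)"
    and d: "\<And>s. s vW 0 = W \<Longrightarrow> val d s = w" "w = (if b then 1 else W)" "cost d \<le> 2"
  shows "advance a (edge_loop a d)"
  unfolding edge_loop_def Let_def
proof (rule advance_scatter[OF _ _ _ _ _ _ _ R])
  fix k s assume k: "k < ne" and prev: "\<And>a'. a' < a \<Longrightarrow> a' \<notin> {7, 8, 9} \<Longrightarrow> s a' = target a'" and s7: "s 7 0 = k"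
  have "s 5 = \<sigma>0 5" "s 6 = \<sigma>0 6" and ix: "s aIdx = table n (\<lambda>i. idx (vs i))" and w: "val d s = w"
    using prev[of 5] prev[of 6] prev[of aIdx] prev[of vW] d(1)[of s] assms(1) by (auto simp: target_simps)
  moreover have "\<sigma>0 5 k < n" "\<sigma>0 6 k < n" using ends[OF k] by simp_all
  moreover have "W \<noteq> 1" "W \<noteq> 0" using W_pos by simp_all
  ultimately show "sem (If (Add (Sub (Cell aIdx (Cell 6 (Var vI))) (Add (Cell aIdx (Cell 5 (Var vI))) d))
             (Sub (Add (Cell aIdx (Cell 5 (Var vI))) d) (Cell aIdx (Cell 6 (Var vI)))))
          (If (Add (Sub (Cell aIdx (Cell 5 (Var vI))) (Add (Cell aIdx (Cell 6 (Var vI))) d))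
             (Sub (Add (Cell aIdx (Cell 6 (Var vI))) d) (Cell aIdx (Cell 5 (Var vI)))))
             Skip (Store a (Cell aIdx (Cell 6 (Var vI))) (Num 1)))
          (Store a (Cell aIdx (Cell 5 (Var vI))) (Num 1))) s a =
      (if fst (led k) = b then (s a)(idx (snd (led k)) := 1) else s a)"
    using edge_code[OF k] d(2) s7 by (auto split: if_splits)
qed (use assms in \<open>auto simp: target_simps size_bound_def\<close>)

end

lemma mods_solve: "mods solve = {vOk, vJ, aA, vK, aD, vFail, vViol, aU}"
  by (auto simp: solve_def mods_residual_arcs mods_potentials mods_minimize mods_push)

context encoded_region begin

lemma parity_step: "0 < k \<Longrightarrow> Suc 0 - of_bool (odd (k - Suc 0)) = (of_bool (odd k) :: nat)"
  by (cases k) auto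

lemma advances_steps: "advances vN steps"
  unfolding steps_def Let_def advances.simps Suc_numeral add_num_simps
proof (intro conjI TrueI, goal_cases)
  case 1
  show ?case
    by (rule advance_Assign) (simp_all add: target_simps n0 ne0[simplified])
next
  case 2
  show ?case
    by (rule advance_Assign) (simp_all add: target_simps n0 ne0[simplified])
next
  case 3
  show ?case
    by (rule advance_Assign) (simp_all add: target_simps W_def)
next
  case 4
  show ?case
    by (rule advance_fill[where b = "W + 1" and f = "\<lambda>k. k * W"]) (auto simp: target_simps size_bound_def fun_upd_idem_iff add.commute mult_eq_if)
next
  case 5
  show ?case
    by (rule advance_Assign) (simp_all add: target_simps P_def)
next
  case 6
  show ?case
    by (rule advance_fill[where b = "P + 1" and f = "\<lambda>k. k * P"]) (auto simp: target_simps size_bound_def fun_upd_idem_iff add.commute mult_eq_if)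
next
  case 7
  show ?case
    by (rule advance_Assign) (simp_all add: target_simps mult_2 distrib_right)
next
  case 8
  show ?case
    by (rule advance_fill[where b = n and f = "\<lambda>i. idx (vs i)"]) (use index_value in \<open>simp_all add: target_simps size_bound_def index_exp_def\<close>)
next
  case 9
  show ?case
    by (rule advance_scatter[where b = n and R = vx and sel = "\<lambda>_. True" and g = "\<lambda>i. idx (vs i)"]) (use vx_iff in \<open>simp_all add: target_simps size_bound_def\<close>)
next
  case 10
  show ?case
    by (rule advance_edges[where R = eh and b = True and w = 1]) (use eh_iff W_pos in \<open>simp_all add: target_simps\<close>)
next
  case 11
  show ?case
    by (rule advance_edges[where R = ev and b = False and w = W]) (use ev_iff W_pos in \<open>simp_all add: target_simps\<close>)
next
  case 12
  show ?case
    by (rule advance_fill[where b = P and f = "\<lambda>p. of_bool (odd p)"]) (auto simp: target_simps size_bound_def fun_upd_idem_iff parity_step)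
next
  case 13
  show ?case
    by (rule advance_fill[where b = P and f = nb]) (auto simp: target_simps size_bound_def nb_def sq_iff)
next
  case 14
  show ?case
    by (rule advance_fill[where b = "3 * P" and f = tail]) (auto simp: target_simps size_bound_def by_kind_def mult_2 tail_def lH_def lV_def simp del: even_diff_nat)
next
  case 15
  show ?case
    by (rule advance_fill[where b = "3 * P" and f = head]) (auto simp: target_simps size_bound_def by_kind_def mult_2 head_def rH_def rV_def simp del: even_diff_nat)
next
  case 16
  show ?case
    by (rule advance_fill[where b = P and f = prefix_cost]) (auto simp: target_simps size_bound_def ap_def prefix_cost.simps)
next
  case 17
  show ?case
    by (rule advance_fill[where b = P and f = "\<lambda>p. if p = 0 then 0 else prefix_cost (p - 1)"]) (auto simp: target_simps size_bound_def am_def ap_def fun_upd_idem_iff)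
next
  case 18
  show ?case
    by (rule advance_fill[where b = "6 * P" and f = rt]) (auto simp: target_simps size_bound_def rt_def)
next
  case 19
  show ?case
    by (rule advance_fill[where b = "6 * P" and f = rh]) (auto simp: target_simps size_bound_def rh_def)
next
  case 20
  show ?case
    by (rule advance_fill[where b = "6 * P" and f = rp]) (auto simp: target_simps size_bound_def rp_def)
next
  case 21
  show ?case
    by (rule advance_fill[where b = "6 * P" and f = rm]) (auto simp: target_simps size_bound_def rm_def)
next
  case 22
  show ?case
    by (rule advance_fill[where b = "3 * P" and f = "\<lambda>i. of_bool (free i)"]) (auto simp: target_simps size_bound_def by_kind_def free_def fun_upd_idem_iff)
next
  case 23
  show ?case
    by (rule advance_fill[where b = "3 * P" and f = "\<lambda>i. nat (flow0 i)"]) (auto simp: target_simps size_bound_def by_kind_def flow0_def nat_add_distrib)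
qed

definition optimal :: "nat \<Rightarrow> bool" where
  "optimal N \<longleftrightarrow> (\<exists>m K. pm m \<and> finite K \<and> K \<subseteq> Sq \<and> packed m K \<and> card K = N) \<and>
     (\<forall>m K. pm m \<and> finite K \<and> K \<subseteq> Sq \<and> packed m K \<longrightarrow> card K \<le> N)"

text \<open>The third block of constraints makes the truncated subtraction in \<open>collect\<close>
  exact.\<close>

lemma nat_gain:
  assumes "feasible (\<lambda>v. int (\<psi> v))"
  shows "int (\<Sum>p<P. \<psi> (nb p) - \<psi> p) = gain (\<lambda>v. int (\<psi> v))"
  unfolding gain_def of_nat_sum
proof (rule sum.cong)
  fix p assume "p \<in> {..<P}"
  then have "\<psi> p \<le> \<psi> (nb p)"
    using assms[unfolded feasible_def, rule_format, of "p + 2 * P"] by (simp add: head_def tail_def acost_def)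
  then show "int (\<psi> (nb p) - \<psi> p) = int (\<psi> (nb p)) - int (\<psi> p)" by simp
qed simp

lemma runs_collect:
  assumes "s0 aNb = table P nb" "s0 vP 0 = P" "s0 vSum 0 = 0"
  shows "runs collect s0 (2 * unit_time) (\<lambda>s. s 0 0 = (\<Sum>p<P. s0 aD (nb p) - s0 aD p))"
  unfolding collect_def
proof (rule runs_Seq)
  let ?c = "Assign vSum (Add (Var vSum) (Sub (Cell aD (Cell aNb (Var vI))) (Cell aD (Var vI))))"
  show "runs (For vI (Var vP) ?c) s0 unit_time (\<lambda>s. s vSum 0 = (\<Sum>p<P. s0 aD (nb p) - s0 aD p))"
  proof (rule runs_For[where b = P and tb = 20 and I = "\<lambda>k s. s vSum 0 = (\<Sum>p<k. s0 aD (nb p) - s0 aD p)"])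
    show "runs ?c s 20 (\<lambda>s'. (s'(vI := (s' vI)(0 := Suc k))) vSum 0 = (\<Sum>p<Suc k. s0 aD (nb p) - s0 aD p))"
      if "k < P" "s vSum 0 = (\<Sum>p<k. s0 aD (nb p) - s0 aD p)" "s vI 0 = k"
        "\<And>a. a \<noteq> vI \<Longrightarrow> a \<notin> mods ?c \<Longrightarrow> s a = s0 a" for k s
      using that assms by (intro runs_loop_free) simp_all
    have "(P + 1) * 32 \<le> (size_bound + 1) * 300" by (intro mult_le_mono) (simp_all add: size_bound_def)
    then show "3 + (P + 1) * (cost (Var vP) + 20 + 10) \<le> unit_time" by (simp add: unit_time_def)
  qed (use assms in simp_all)
  show "runs (Assign 0 (Var vSum)) s unit_time (\<lambda>s. s 0 0 = (\<Sum>p<P. s0 aD (nb p) - s0 aD p))"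
    if "s vSum 0 = (\<Sum>p<P. s0 aD (nb p) - s0 aD p)" for s
    using that by (intro runs_loop_free) (simp_all add: unit_time_def)
qed simp

definition total_time :: nat where
  "total_time = 25 * unit_time + solve_time (2 * P * P)"

lemma runs_algorithm:
  assumes m: "pm m"
  shows "runs algorithm \<sigma>0 total_time (\<lambda>s. optimal (s 0 0))"
proof -
  have "runs (Seq solve collect) s (solve_time (2 * P * P) + 2 * unit_time) (\<lambda>s. optimal (s 0 0))"
    if st: "stage aA s" for s
  proof (rule runs_Seq)
    have ar: "s a = target a" if "a < 33" "a \<notin> {7, 8, 9}" for a
      using stage_prev[OF st that] .
    \<comment> \<open>The given matching with the empty resonant set provides a potential of gain 0,
      from which the costs of all flows are seen to be nonnegative.\<close>
    obtain \<psi>0 where \<psi>0: "feasible \<psi>0" "gain \<psi>0 = 0"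
      using resonant_feasible[OF m, of "{}"] by (auto simp: packed_def)
    show "runs solve s (solve_time (2 * P * P)) (\<lambda>s. feasible (\<lambda>v. int (s aD v)) \<and>
      (\<forall>\<psi>. feasible \<psi> \<longrightarrow> gain \<psi> \<le> gain (\<lambda>v. int (s aD v))))"
    proof (rule runs_solve[of s flow0 "2 * P * P" \<psi>0])
      show "env s" by (simp add: env_def ar target_simps)
      show "s aF i \<noteq> 0 \<longleftrightarrow> free i" if "i < 3 * P" for i using that by (simp add: ar target_simps)
      show "int (s aU i) = flow0 i" if "i < 3 * P" "\<not> free i" for i
        using that by (simp add: ar target_simps flow0_def)
      show "flow_cost flow0 \<le> int (2 * P * P)" using flow_cost_flow0 by simp
    qed (use flow0 \<psi>0 in simp_all)
    fix s1 assume s1: "feasible (\<lambda>v. int (s1 aD v)) \<and> (\<forall>\<psi>. feasible \<psi> \<longrightarrow> gain \<psi> \<le> gain (\<lambda>v. int (s1 aD v)))"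
      and f1: "\<And>a. a \<notin> mods solve \<Longrightarrow> s1 a = s a"
    have "s1 aNb = table P nb" "s1 vP 0 = P" "s1 vSum 0 = 0"
      using f1[of aNb] f1[of vP] f1[of vSum] st by (simp_all add: mods_solve ar target_simps) (simp add: stage_def)
    from runs_collect[OF this] show "runs collect s1 (2 * unit_time) (\<lambda>s. optimal (s 0 0))"
    proof (rule runs_weaken)
      fix s2 :: memory assume "s2 0 0 = (\<Sum>p<P. s1 aD (nb p) - s1 aD p)"
      then have N: "int (s2 0 0) = gain (\<lambda>v. int (s1 aD v))" using nat_gain s1 by simp
      show "optimal (s2 0 0)"
        unfolding optimal_def
      proof (intro conjI allI impI)
        show "\<exists>m K. pm m \<and> finite K \<and> K \<subseteq> Sq \<and> packed m K \<and> card K = s2 0 0"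
          using feasible_resonant[of "\<lambda>v. int (s1 aD v)"] s1 N by (metis of_nat_eq_iff)
        fix m K assume "pm m \<and> finite K \<and> K \<subseteq> Sq \<and> packed m K"
        then obtain \<psi> where "feasible \<psi>" "gain \<psi> = int (card K)" using resonant_feasible by blast
        then show "card K \<le> s2 0 0" using s1 N by (metis of_nat_le_iff)
      qed
    qed simp
  qed simp
  moreover have "vN + length steps = aA" by (simp add: steps_def Let_def)
  ultimately have "runs algorithm \<sigma>0 (length steps * unit_time + (solve_time (2 * P * P) + 2 * unit_time)) (\<lambda>s. optimal (s 0 0))"
    unfolding algorithm_def by (intro runs_advances[OF advances_steps stage_init]) simp
  then show ?thesis
    by (rule runs_weaken) (simp_all add: total_time_def steps_def Let_def)
qed

end

text \<open>A discrete intermediate value theorem: along the walk every integer between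
  \<open>f u\<close> and \<open>f v\<close> is attained. Hence a connected graph fits into the
  window around its first vertex.\<close>

lemma walk_extent:
  fixes f :: "'a \<Rightarrow> int"
  assumes "R\<^sup>*\<^sup>* u v" "u \<in> V" "finite V" "\<And>x y. R x y \<Longrightarrow> y \<in> V \<and> \<bar>f x - f y\<bar> \<le> 1"
  shows "\<bar>f v - f u\<bar> < int (card V)"
proof -
  have "{min (f u) (f v)..max (f u) (f v)} \<subseteq> f ` V"
    using assms(1)
  proof (induction rule: rtranclp_induct)
    case base
    then show ?case using assms(2) by simp
  next
    case (step y z)
    show ?case
    proof
      fix c assume c: "c \<in> {min (f u) (f z)..max (f u) (f z)}"
      have z: "z \<in> V" "\<bar>f y - f z\<bar> \<le> 1" using assms(4)[OF step.hyps(2)] by simp_all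
      show "c \<in> f ` V"
      proof (cases "c = f z")
        case False
        then have "c \<in> {min (f u) (f y)..max (f u) (f y)}" using c z(2) by auto
        then show ?thesis using step.IH by blast
      qed (use z in blast)
    qed
  qed
  then have "card {min (f u) (f v)..max (f u) (f v)} \<le> card V"
    using assms(3) by (meson card_image_le card_mono finite_imageI order_trans)
  then show ?thesis by (auto simp: min_def max_def split: if_splits)
qed

text \<open>\<open>W\<close> and \<open>P\<close> are bounded by polynomials in the size, and the
  time bounds are monotone in them, being built by sums and products.\<close>

lemma (in encoded_region) total_time_poly:
  fixes q w b pt X :: "nat poly"
  defines "X \<equiv> [:0, 1:]"
  defines "w \<equiv> 2 * X + 3" defines "q \<equiv> w * w" defines "b \<equiv> 2 * q * q"
  defines "pt \<equiv> 20 + (2 * q + 1) * 30 + (2 * q * b + 2) * (10 + (6 * q + 1) * 110)"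
  shows "total_time \<le> poly (25 * (3 + (6 * q + 2 * X + w + 2) * 300) +
    (3 + (b + 2) * (30 + (3 * q + 1) * 150 + pt + (3 + (6 * q + 1) * (17 + (pt + 20) + 10))))) (n + ne)"
proof -
  let ?p = "\<lambda>r. poly r (n + ne)"
  have X: "?p X = n + ne" by (simp add: X_def)
  have w: "W \<le> ?p w" by (simp add: W_def w_def X)
  then have P: "P \<le> ?p q" unfolding P_def q_def by (simp add: mult_le_mono)
  then have b: "2 * P * P \<le> ?p b" unfolding b_def by (simp add: mult_le_mono)
  have pt: "pot_time \<le> ?p pt"
    unfolding pot_time_def pt_def poly_add poly_mult poly_numeral poly_1
    by (intro add_mono mult_le_mono order_refl P b)
  have "unit_time \<le> ?p (3 + (6 * q + 2 * X + w + 2) * 300)"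
    unfolding unit_time_def size_bound_def using P w by (simp add: X)
  moreover have "min_time \<le> ?p (3 + (6 * q + 1) * (17 + (pt + 20) + 10))"
    unfolding min_time_def poly_add poly_mult poly_numeral poly_1
    by (intro add_mono mult_le_mono order_refl P pt)
  ultimately show ?thesis
    unfolding total_time_def solve_time_def poly_add poly_mult poly_numeral poly_1
    by (intro add_mono mult_le_mono order_refl P pt b)
qed

lemma polyomino_encoding:
  assumes G: "polyomino_graph G" and rep: "represents vs es G"
  defines "led \<equiv> (\<lambda>k. inv ends {vs ! fst (es ! k), vs ! snd (es ! k)})"
  shows "encoded_region (verts G) (ledges G) (fst (vs ! 0)) (snd (vs ! 0)) (length vs)
    (input_memory vs es) ((!) vs) led (length es)"
proof -
  have sub: "grid_subgraph G" and con: "connected_graph G" and fin: "finite (verts G)"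
    using G by (simp_all add: polyomino_graph_def)
  have vs: "distinct vs" "set vs = verts G"
    using rep by (simp_all add: represents_def)
  have bounds: "fst (es ! k) < length vs \<and> snd (es ! k) < length vs" if "k < length es" for k
    using rep nth_mem[OF that] by (simp add: represents_def case_prod_beta)
  have nth_es: "set es = (!) es ` {..<length es}" by (auto simp: set_conv_nth)
  have es: "edges G = (\<lambda>k. {vs ! fst (es ! k), vs ! snd (es ! k)}) ` {..<length es}"
  proof -
    have "edges G = (\<lambda>(i, j). {vs ! i, vs ! j}) ` set es" using rep by (simp add: represents_def)
    then show ?thesis by (simp only: nth_es image_image case_prod_beta)
  qed
  have n: "length vs = card (verts G)" using vs distinct_card by metis
  have n0: "0 < length vs" using con vs(2) by (auto simp: connected_graph_def)
  have edge: "{vs ! fst (es ! k), vs ! snd (es ! k)} \<in> edges G" if "k < length es" for k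
    using that by (simp add: es)
  have led: "ends (led k) = {vs ! fst (es ! k), vs ! snd (es ! k)}" if "k < length es" for k
  proof -
    have "{vs ! fst (es ! k), vs ! snd (es ! k)} \<in> range ends"
      using edge[OF that] unfolding ledges_image[OF sub, symmetric] by blast
    then show ?thesis unfolding led_def by (rule f_inv_into_f)
  qed
  have step: "v \<in> verts G \<and> \<bar>fst u - fst v\<bar> \<le> 1 \<and> \<bar>snd u - snd v\<bar> \<le> 1" if uv: "{u, v} \<in> edges G" for u v
  proof -
    obtain b x y where "{u, v} = ends (b, x, y)" using grid_edges(1)[OF sub uv] by (metis prod.collapse)
    then show ?thesis using grid_edges(2)[OF sub uv] by (auto simp: doubleton_eq_iff split: if_splits)
  qed
  have v0: "vs ! 0 \<in> verts G" using n0 vs(2) by auto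
  have window: "\<bar>x - fst (vs ! 0)\<bar> < int (length vs) \<and> \<bar>y - snd (vs ! 0)\<bar> < int (length vs)" if "(x, y) \<in> verts G" for x y
  proof -
    have w: "(\<lambda>u v. {u, v} \<in> edges G)\<^sup>*\<^sup>* (vs ! 0) (x, y)"
      using con v0 that unfolding connected_graph_def by blast
    show ?thesis
      using walk_extent[OF w v0 fin, of fst] walk_extent[OF w v0 fin, of snd] step n by simp
  qed
  interpret lattice_region "verts G" "ledges G" by (rule polyomino_lattice_region[OF G])
  show ?thesis
  proof
    show "int (input_memory vs es 1 i) - int (input_memory vs es 2 i) = fst (vs ! i) \<and>
      int (input_memory vs es 3 i) - int (input_memory vs es 4 i) = snd (vs ! i)" if "i < length vs" for i
      using that by (simp add: input_memory_def array_def)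
    show "(!) vs ` {..<length vs} = verts G" using vs(2) by (auto simp: set_conv_nth)
    show "input_memory vs es 5 k < length vs \<and> input_memory vs es 6 k < length vs \<and>
      {vs ! input_memory vs es 5 k, vs ! input_memory vs es 6 k} =
        (let (b, x, y) = led k in {(x, y), if b then (x + 1, y) else (x, y + 1)})" if "k < length es" for k
    proof -
      obtain b x y where l: "led k = (b, x, y)" by (cases "led k")
      have "input_memory vs es 5 k = fst (es ! k)" "input_memory vs es 6 k = snd (es ! k)"
        using that by (simp_all add: input_memory_def array_def)
      then show ?thesis using bounds[OF that] led[OF that] by (simp add: l) metis
    qed
    show "led ` {..<length es} = ledges G"
    proof (intro equalityI subsetI)
      fix e assume "e \<in> ledges G"
      then have "ends e \<in> edges G" unfolding ledges_def by (rule CollectD)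
      then obtain k where k: "k \<in> {..<length es}" "ends e = {vs ! fst (es ! k), vs ! snd (es ! k)}"
        unfolding es image_iff by (elim bexE)
      have "led k = e" unfolding led_def k(2)[symmetric] by (rule inv_f_f[OF inj_ends])
      then show "e \<in> led ` {..<length es}" using k(1) by blast
    next
      fix e assume "e \<in> led ` {..<length es}"
      then obtain k where "k < length es" "e = led k" by blast
      then show "e \<in> ledges G" using led edge unfolding ledges_def by simp
    qed
  qed (use window n0 in \<open>auto simp: input_memory_def array_def\<close>)
qed

theorem theorem4p7:
  "\<exists>(c :: com) (p :: nat poly). \<forall>(G :: grid_graph) vs es.
     polyomino_graph G \<and> (\<exists>M. perfect_matching G M) \<and> represents vs es G \<longrightarrow>
     (\<exists>t s. exec c (input_memory vs es) t s \<and>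
        result s = max_forcing_number G \<and> t \<le> poly p (graph_size G))"
proof -
  define X :: "nat poly" where "X = [:0, 1:]"
  define w where "w = 2 * X + 3"
  define q where "q = w * w"
  define b where "b = 2 * q * q"
  define pt where "pt = 20 + (2 * q + 1) * 30 + (2 * q * b + 2) * (10 + (6 * q + 1) * 110)"
  define p where "p = 25 * (3 + (6 * q + 2 * X + w + 2) * 300) +
    (3 + (b + 2) * (30 + (3 * q + 1) * 150 + pt + (3 + (6 * q + 1) * (17 + (pt + 20) + 10))))"
  have "\<exists>t s. exec algorithm (input_memory vs es) t s \<and> result s = max_forcing_number G \<and> t \<le> poly p (graph_size G)"
    if G: "polyomino_graph G" and M: "perfect_matching G M" and rep: "represents vs es G" for G M vs es
  proof -
    interpret encoded_region "verts G" "ledges G" "fst (vs ! 0)" "snd (vs ! 0)" "length vs" "input_memory vs es"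
      "(!) vs" "\<lambda>k. inv ends {vs ! fst (es ! k), vs ! snd (es ! k)}" "length es"
      by (rule polyomino_encoding[OF G rep])
    have "M \<subseteq> ends ` ledges G"
      using M ledges_image G by (auto simp: perfect_matching_def polyomino_graph_def)
    then obtain m where "m \<subseteq> ledges G" "M = ends ` m" by (auto simp: subset_image_iff)
    then have "pm m" using M pm_iff[OF G] by simp
    from runs_algorithm[OF this] obtain t s where t: "exec algorithm (input_memory vs es) t s" "t \<le> total_time"
      and N: "optimal (s 0 0)"
      by (auto simp: runs_def)
    have "resonant G m K \<longleftrightarrow> pm m \<and> finite K \<and> K \<subseteq> Sq \<and> packed m K" for m K
      using pm_iff[OF G, of m] pm_subset[of m] unfolding resonant_def Sq_def by blast
    then have "max_forcing_number G = s 0 0"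
      using N max_forcing_number_eq[OF G] unfolding optimal_def by metis
    moreover have "length vs + length es = graph_size G"
      using rep distinct_card[of vs] by (simp add: represents_def graph_size_def)
    then have "total_time \<le> poly p (graph_size G)"
      using total_time_poly by (simp only: p_def pt_def b_def q_def w_def X_def)
    ultimately show ?thesis using t by (auto simp: result_def intro: order_trans)
  qed
  then show ?thesis by blast
qed

end
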